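(* Let $T,T'$ be contractions on a complex Hilbert space $\mathcal{H}$ such that $T^*$ is quasi-normal, $T$ commutes with $T'$ and with $T'^*T'$, and $T'$ commutes with $TT^*$. The following are equivalent: (i) $T$ is Harnack dominated by $T'$; (ii) $T$ is Harnack equivalent to $T'$; (iii) $T$ is Shmul'yan equivalent to $T'$; (iv) there exist $z_0\in\mathbb{D}$ and a $\mathcal{B}(\mathcal{H})$-valued contractive analytic function $F$ on $\mathbb{D}$ such that $F(0)=T$ and $F(z_0)=T'$; (v) there exists an operator $B\in\mathcal{B}(\ell^2_{\mathbb{N}}(\mathcal{D}_{T'}),\mathcal{H})$ such that $$T=T'+BJ'D_{T'},\qquad BS'=TB,$$ where $J'$ is the canonical inclusion of $\mathcal{D}_{T'}$ into $\ell^2_{\mathbb{N}}(\mathcal{D}_{T'})$ (as the zeroth coordinate) and $S'$ is the forward shift on $\ell^2_{\mathbb{N}}(\mathcal{D}_{T'})$.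
   Context: A contraction is a bounded linear operator of norm at most $1$; $\mathbb{D}$ is the open unit disc; $\operatorname{Re}A=\frac12(A+A^* )$. An operator $A$ is quasi-normal if $A$ commutes with $A^*A$. For a contraction $A\in\mathcal{B}(\mathcal{H}_1,\mathcal{H}_2)$, $D_A=(I-A^*A)^{1/2}$ is the defect operator and $\mathcal{D}_A=\overline{\mathcal{R}(D_A)}$ the defect space. Harnack domination: for contractions $T,T'$ on the same Hilbert space, $T$ is Harnack dominated by $T'$ if there is a constant $c\ge 1$ such that $\operatorname{Re}p(T)\le c\,\operatorname{Re}p(T')$ for every analytic polynomial $p$ with $\operatorname{Re}p(z)\ge 0$ for $|z|\le 1$. $T$ and $T'$ are Harnack equivalent if each is Harnack dominated by the other. Shmul'yan domination: for contractions $A,B\in\mathcal{B}(\mathcal{H}_1,\mathcal{H}_2)$, $A$ Shmul'yan dominates $B$ if $B=A+D_{A^*}XD_A$ for some bounded $X\in\mathcal{B}(\mathcal{D}_A,\mathcal{D}_{A^*})$. $A$ and $B$ are Shmul'yan equivalent if each Shmul'yan dominates the other. A contractive analytic function on $\mathbb{D}$ is an analytic function $F:\mathbb{D}\to\mathcal{B}(\mathcal{H})$ with $\|F(z)\|\le 1$ for all $z\in\mathbb{D}$. *)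

theory Defs
  imports "HOL-Analysis.Analysis" "HOL-Computational_Algebra.Polynomial"
begin

text \<open>
  Complex Hilbert spaces. The real inner product of the superclass is the real part of
  \<open>cinner\<close>, so \<open>cinner\<close> is positive definite and \<open>(norm x)\<^sup>2 = Re (cinner x x)\<close>.
  \<open>cinner\<close> is linear in the first argument.
\<close>

class complex_hilbert_space = real_inner + complete_space +
  fixes scaleC :: "complex \<Rightarrow> 'a \<Rightarrow> 'a"  (infixr \<open>*\<^sub>C\<close> 75)
    and cinner :: "'a \<Rightarrow> 'a \<Rightarrow> complex"
  assumes scaleC_add_right: "a *\<^sub>C (x + y) = a *\<^sub>C x + a *\<^sub>C y"
    and scaleC_add_left: "(a + b) *\<^sub>C x = a *\<^sub>C x + b *\<^sub>C x"
    and scaleC_scaleC: "a *\<^sub>C b *\<^sub>C x = (a * b) *\<^sub>C x"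
    and scaleR_scaleC: "r *\<^sub>R x = complex_of_real r *\<^sub>C x"
    and cinner_commute: "cinner x y = cnj (cinner y x)"
    and cinner_add_left: "cinner (x + y) z = cinner x z + cinner y z"
    and cinner_scaleC_left: "cinner (a *\<^sub>C x) y = a * cinner x y"
    and inner_cinner: "inner x y = Re (cinner x y)"

instantiation complex :: complex_hilbert_space
begin

definition scaleC_complex :: "complex \<Rightarrow> complex \<Rightarrow> complex"
  where "scaleC_complex a x = a * x"

definition cinner_complex :: "complex \<Rightarrow> complex \<Rightarrow> complex"
  where "cinner_complex x y = x * cnj y"

instance
  by standard
    (simp_all add: scaleC_complex_def cinner_complex_def inner_complex_def
      algebra_simps scaleR_conv_of_real)

end

text \<open>
  Operators between Hilbert spaces are represented by functions. An operator defined on a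
  subspace \<open>M\<close> is a function whose values outside \<open>M\<close> are irrelevant.
\<close>

definition bounded_clinear_on ::
    "'a::complex_hilbert_space set \<Rightarrow> ('a \<Rightarrow> 'b::complex_hilbert_space) \<Rightarrow> bool"
  where "bounded_clinear_on M A \<longleftrightarrow>
    (\<forall>x\<in>M. \<forall>y\<in>M. A (x + y) = A x + A y) \<and>
    (\<forall>a. \<forall>x\<in>M. A (a *\<^sub>C x) = a *\<^sub>C A x) \<and>
    (\<exists>K. \<forall>x\<in>M. norm (A x) \<le> K * norm x)"

abbreviation bounded_clinear ::
    "('a::complex_hilbert_space \<Rightarrow> 'b::complex_hilbert_space) \<Rightarrow> bool"
  where "bounded_clinear \<equiv> bounded_clinear_on UNIV"

definition contraction ::
    "('a::complex_hilbert_space \<Rightarrow> 'b::complex_hilbert_space) \<Rightarrow> bool"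
  where "contraction A \<longleftrightarrow> bounded_clinear A \<and> onorm A \<le> 1"

definition cadjoint ::
    "('a::complex_hilbert_space \<Rightarrow> 'b::complex_hilbert_space) \<Rightarrow> 'b \<Rightarrow> 'a"
  where "cadjoint A = (THE A'. \<forall>x y. cinner (A x) y = cinner x (A' y))"

definition positive_op :: "('a::complex_hilbert_space \<Rightarrow> 'a) \<Rightarrow> bool"
  where "positive_op A \<longleftrightarrow> (\<forall>x. cinner (A x) x \<in> \<real>\<^sub>\<ge>\<^sub>0)"

definition op_le ::
    "('a::complex_hilbert_space \<Rightarrow> 'a) \<Rightarrow> ('a \<Rightarrow> 'a) \<Rightarrow> bool"
  where "op_le A B \<longleftrightarrow> positive_op (\<lambda>x. B x - A x)"

definition op_sqrt :: "('a::complex_hilbert_space \<Rightarrow> 'a) \<Rightarrow> 'a \<Rightarrow> 'a"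
  where "op_sqrt P = (THE S. bounded_clinear S \<and> positive_op S \<and> S \<circ> S = P)"

definition op_Re :: "('a::complex_hilbert_space \<Rightarrow> 'a) \<Rightarrow> 'a \<Rightarrow> 'a"
  where "op_Re A = (\<lambda>x. (1/2) *\<^sub>R (A x + cadjoint A x))"

definition quasi_normal :: "('a::complex_hilbert_space \<Rightarrow> 'a) \<Rightarrow> bool"
  where "quasi_normal A \<longleftrightarrow> A \<circ> (cadjoint A \<circ> A) = (cadjoint A \<circ> A) \<circ> A"

definition defect_op ::
    "('a::complex_hilbert_space \<Rightarrow> 'b::complex_hilbert_space) \<Rightarrow> 'a \<Rightarrow> 'a"
  where "defect_op A = op_sqrt (\<lambda>x. x - cadjoint A (A x))"

definition defect_space ::
    "('a::complex_hilbert_space \<Rightarrow> 'b::complex_hilbert_space) \<Rightarrow> 'a set"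
  where "defect_space A = closure (range (defect_op A))"

definition poly_op ::
    "complex poly \<Rightarrow> ('a::complex_hilbert_space \<Rightarrow> 'a) \<Rightarrow> 'a \<Rightarrow> 'a"
  where "poly_op p T = (\<lambda>x. \<Sum>k\<le>degree p. coeff p k *\<^sub>C (T ^^ k) x)"

definition Harnack_dominated ::
    "('a::complex_hilbert_space \<Rightarrow> 'a) \<Rightarrow> ('a \<Rightarrow> 'a) \<Rightarrow> bool"
  where "Harnack_dominated T T' \<longleftrightarrow>
    (\<exists>c::real. c \<ge> 1 \<and>
      (\<forall>p::complex poly. (\<forall>z. cmod z \<le> 1 \<longrightarrow> Re (poly p z) \<ge> 0) \<longrightarrow>
        op_le (op_Re (poly_op p T)) (\<lambda>x. c *\<^sub>R op_Re (poly_op p T') x)))"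

definition Harnack_equivalent ::
    "('a::complex_hilbert_space \<Rightarrow> 'a) \<Rightarrow> ('a \<Rightarrow> 'a) \<Rightarrow> bool"
  where "Harnack_equivalent T T' \<longleftrightarrow> Harnack_dominated T T' \<and> Harnack_dominated T' T"

definition Shmulyan_dominates ::
    "('a::complex_hilbert_space \<Rightarrow> 'b::complex_hilbert_space) \<Rightarrow> ('a \<Rightarrow> 'b) \<Rightarrow> bool"
  where "Shmulyan_dominates A B \<longleftrightarrow>
    (\<exists>X. bounded_clinear_on (defect_space A) X \<and>
      X ` defect_space A \<subseteq> defect_space (cadjoint A) \<and>
      (\<forall>x. B x = A x + defect_op (cadjoint A) (X (defect_op A x))))"

definition Shmulyan_equivalent ::
    "('a::complex_hilbert_space \<Rightarrow> 'b::complex_hilbert_space) \<Rightarrow> ('a \<Rightarrow> 'b) \<Rightarrow> bool"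
  where "Shmulyan_equivalent A B \<longleftrightarrow> Shmulyan_dominates A B \<and> Shmulyan_dominates B A"

text \<open>Analyticity is complex differentiability with respect to the operator norm.\<close>

definition contractive_analytic ::
    "(complex \<Rightarrow> 'a::complex_hilbert_space \<Rightarrow> 'a) \<Rightarrow> bool"
  where "contractive_analytic F \<longleftrightarrow>
    (\<forall>z\<in>ball 0 1. contraction (F z)) \<and>
    (\<forall>z\<in>ball 0 1. \<exists>L. bounded_clinear L \<and>
      ((\<lambda>w. onorm (\<lambda>x. inverse (w - z) *\<^sub>C (F w x - F z x) - L x)) \<longlongrightarrow> 0) (at z))"

text \<open>Square-summable sequences in a closed subspace \<open>M\<close>.\<close>

definition ell2 :: "'a::complex_hilbert_space set \<Rightarrow> (nat \<Rightarrow> 'a) set"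
  where "ell2 M = {f. (\<forall>n. f n \<in> M) \<and> summable (\<lambda>n. (norm (f n))\<^sup>2)}"

definition ell2_norm :: "(nat \<Rightarrow> 'a::complex_hilbert_space) \<Rightarrow> real"
  where "ell2_norm f = sqrt (\<Sum>n. (norm (f n))\<^sup>2)"

definition ell2_bounded_clinear ::
    "'a::complex_hilbert_space set \<Rightarrow> ((nat \<Rightarrow> 'a) \<Rightarrow> 'b::complex_hilbert_space) \<Rightarrow> bool"
  where "ell2_bounded_clinear M B \<longleftrightarrow>
    (\<forall>f\<in>ell2 M. \<forall>g\<in>ell2 M. B (\<lambda>n. f n + g n) = B f + B g) \<and>
    (\<forall>a. \<forall>f\<in>ell2 M. B (\<lambda>n. a *\<^sub>C f n) = a *\<^sub>C B f) \<and>
    (\<exists>K. \<forall>f\<in>ell2 M. norm (B f) \<le> K * ell2_norm f)"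

definition ell2_incl :: "'a::complex_hilbert_space \<Rightarrow> nat \<Rightarrow> 'a"
  where "ell2_incl x = (\<lambda>n. if n = 0 then x else 0)"

definition ell2_shift :: "(nat \<Rightarrow> 'a::complex_hilbert_space) \<Rightarrow> nat \<Rightarrow> 'a"
  where "ell2_shift f = (\<lambda>n. case n of 0 \<Rightarrow> 0 | Suc m \<Rightarrow> f m)"

end

theory Submission
  imports Defs "HOL-Complex_Analysis.Complex_Analysis"
begin

text \<open>
  Write \<open>D_A\<close> for the defect operator of \<open>A\<close>. Every condition is compared with the mixed bound
  \<open>|<(T - T') x, y>| \<le> C |D_T' x| |D_T* y|\<close>.

  For arbitrary contractions the mixed bound gives \<open>|D_T x| ~ |D_T' x|\<close>. It also gives Harnack
  domination: in terms of the minimal isometric dilations this is an inequality between Toeplitz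
  kernels, whose two sides are computed by Horner recursions, and the isometry of the Julia operator
  of \<open>T\<close> controls the difference of the recursions for \<open>T\<close> and \<open>T'\<close>. Moreover
  \<open>T + w (T' - T)\<close> is contractive for \<open>w\<close> near \<open>[0, 1]\<close>, and composing with a conformal map of the
  disc gives (iv); conversely (iv) implies the mixed bound by Harnack's inequality.

  Condition (i) or (v) bounds \<open>\<Sum>k. T^k (T - T') x_k\<close> by the \<open>l2\<close>-norm of \<open>D_T' x_k\<close>. The
  commutation relations enter on choosing \<open>x_k = T*^k D_T* x\<close>: then \<open>T^k T*^k = (T T*)^k\<close> and the
  geometric series \<open>(1 - T T*) \<Sum>k. (T T*)^k\<close> yields the mixed bound. They are used again, with
  hyponormality of \<open>T*\<close>, for \<open>|D_T* y| \<le> K |D_T'* y|\<close>, which makes the situation symmetric and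
  gives (ii) and (iii).
\<close>

section \<open>Complex Hilbert spaces and bounded operators\<close>

text \<open>The obstacle in the geometric series is the kernel of \<open>1 - Q\<close> for
  \<open>Q = T T*\<close>: the partial sums give \<open>(1 - Q) (\<Sum>k<n. Q^k) = 1 - Q^n\<close>,
  and \<open>Q^n\<close> fixes every vector on which \<open>T*\<close> is isometric. So
  \<open>(T - T') Q^n\<close> must be shown to tend to zero pointwise. The row estimate does this
  too, for the vectors \<open>x_k = T*^k Q^(n-k) a\<close>: all \<open>n + 1\<close> summands
  coincide, so the left side grows like \<open>(n + 1)^2\<close> and the right side only like
  \<open>n + 1\<close>.

  The mixed bound pairs a defect of \<open>T'\<close> with an adjoint defect of \<open>T\<close>
  because the two recursions meet in this way: their difference is driven by
  \<open>(T - T') s'\<close> for a state \<open>s'\<close> of the \<open>T'\<close>-recursion, whose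
  loss is measured by \<open>D_T'\<close>, while inputs enter the Julia operator of \<open>T\<close>
  through \<open>D_T*\<close>. The comparison of \<open>D_T\<close> with \<open>D_T'\<close> comes
  from testing at \<open>y = T x\<close> and does not reach the adjoint defects, which is why
  symmetry in \<open>T\<close> and \<open>T'\<close> calls on the commutation relations.

  Harnack domination concerns single vectors, Toeplitz forms concern finite families. Fejer means,
  averaged over roots of unity in place of an integral, translate between the two.\<close>

lemma scaleC_one [simp]: "1 *\<^sub>C x = (x::'a::complex_hilbert_space)"
  using scaleR_scaleC[of 1 x] by simp

lemma scaleC_zero_left [simp]: "0 *\<^sub>C x = (0::'a::complex_hilbert_space)"
  using scaleR_scaleC[of 0 x] by simp

lemma scaleC_zero_right [simp]: "a *\<^sub>C (0::'a::complex_hilbert_space) = 0"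
  using scaleC_add_right[of a 0 0] by simp

lemma scaleC_minus_left [simp]: "(- a) *\<^sub>C x = - (a *\<^sub>C (x::'a::complex_hilbert_space))"
  using scaleC_add_left[of "-a" a x] by (simp add: eq_neg_iff_add_eq_0)

lemma scaleC_minus_right [simp]: "a *\<^sub>C (- x) = - (a *\<^sub>C (x::'a::complex_hilbert_space))"
  using scaleC_add_right[of a "-x" x] by (simp add: eq_neg_iff_add_eq_0)

lemma scaleC_diff_right: "a *\<^sub>C (x - y) = a *\<^sub>C x - a *\<^sub>C (y::'a::complex_hilbert_space)"
  using scaleC_add_right[of a x "-y"] by simp

lemma scaleC_diff_left: "(a - b) *\<^sub>C x = a *\<^sub>C x - b *\<^sub>C (x::'a::complex_hilbert_space)"
  using scaleC_add_left[of a "-b" x] by simp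

lemma scaleC_scaleR_commute:
  "a *\<^sub>C (r *\<^sub>R x) = r *\<^sub>R (a *\<^sub>C (x::'a::complex_hilbert_space))"
  by (simp add: scaleR_scaleC scaleC_scaleC mult.commute)

lemma cinner_add_right:
  "cinner x (y + z) = cinner x y + cinner x (z::'a::complex_hilbert_space)"
  by (metis cinner_commute cinner_add_left complex_cnj_add)

lemma cinner_scaleC_right:
  "cinner x (a *\<^sub>C y) = cnj a * cinner x (y::'a::complex_hilbert_space)"
  by (metis cinner_commute cinner_scaleC_left complex_cnj_mult)

lemma cinner_zero_left [simp]: "cinner 0 (y::'a::complex_hilbert_space) = 0"
  using cinner_add_left[of 0 0 y] by simp

lemma cinner_zero_right [simp]: "cinner (y::'a::complex_hilbert_space) 0 = 0"
  using cinner_add_right[of y 0 0] by simp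

lemma cinner_minus_left [simp]: "cinner (- x) y = - cinner x (y::'a::complex_hilbert_space)"
  using cinner_add_left[of "-x" x y] by (simp add: eq_neg_iff_add_eq_0)

lemma cinner_minus_right [simp]: "cinner x (- y) = - cinner x (y::'a::complex_hilbert_space)"
  using cinner_add_right[of x "-y" y] by (simp add: eq_neg_iff_add_eq_0)

lemma cinner_diff_left:
  "cinner (x - y) z = cinner x z - cinner y (z::'a::complex_hilbert_space)"
  using cinner_add_left[of x "-y" z] by simp

lemma cinner_diff_right:
  "cinner x (y - z) = cinner x y - cinner x (z::'a::complex_hilbert_space)"
  using cinner_add_right[of x y "-z"] by simp

lemma cinner_scaleR_left: "cinner (r *\<^sub>R x) (y::'a::complex_hilbert_space) = r *\<^sub>R cinner x y"
  by (simp add: scaleR_scaleC[of r x] cinner_scaleC_left scaleR_conv_of_real)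

lemma cinner_scaleR_right: "cinner x (r *\<^sub>R y::'a::complex_hilbert_space) = r *\<^sub>R cinner x y"
  by (simp add: scaleR_scaleC[of r y] cinner_scaleC_right scaleR_conv_of_real)

lemma cinner_sum_left:
  "cinner (\<Sum>i\<in>I. f i) y = (\<Sum>i\<in>I. cinner (f i) (y::'a::complex_hilbert_space))"
  by (induction I rule: infinite_finite_induct) (simp_all add: cinner_add_left)

lemma cinner_sum_right:
  "cinner y (\<Sum>i\<in>I. f i) = (\<Sum>i\<in>I. cinner (y::'a::complex_hilbert_space) (f i))"
  by (induction I rule: infinite_finite_induct) (simp_all add: cinner_add_right)

lemmas cinner_linear = cinner_add_left cinner_add_right cinner_diff_left cinner_diff_right
  cinner_scaleC_left cinner_scaleC_right

lemma cinner_self: "cinner x (x::'a::complex_hilbert_space) = complex_of_real ((norm x)\<^sup>2)"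
proof (rule complex_eqI)
  show "Re (cinner x x) = Re (complex_of_real ((norm x)\<^sup>2))"
    by (simp add: inner_cinner[symmetric] power2_norm_eq_inner)
  show "Im (cinner x x) = Im (complex_of_real ((norm x)\<^sup>2))"
    using arg_cong[OF cinner_commute[of x x], of Im] by simp
qed

lemma cmod_cinner_self: "cmod (cinner x (x::'a::complex_hilbert_space)) = norm x * norm x"
  by (simp only: cinner_self norm_of_real) (simp add: power2_eq_square)

lemma norm_scaleC: "norm (a *\<^sub>C (x::'a::complex_hilbert_space)) = cmod a * norm x"
proof -
  have "complex_of_real ((norm (a *\<^sub>C x))\<^sup>2) = complex_of_real ((cmod a * norm x)\<^sup>2)"
    by (simp only: cinner_self[symmetric] cinner_scaleC_left cinner_scaleC_right)
      (simp add: cinner_self power_mult_distrib complex_norm_square del: of_real_power)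
  then show ?thesis
    by (metis mult_nonneg_nonneg norm_ge_zero of_real_eq_iff power2_eq_imp_eq)
qed

lemma norm_cinner_le: "cmod (cinner x y) \<le> norm x * norm (y::'a::complex_hilbert_space)"
proof (cases "cinner x y = 0")
  case False
  define a where "a = cnj (cinner x y) / cmod (cinner x y)"
  have a: "cmod a = 1"
    using False by (simp add: a_def norm_divide)
  have "cinner (a *\<^sub>C x) y = (cinner x y * cnj (cinner x y)) / cmod (cinner x y)"
    by (simp add: a_def cinner_scaleC_left)
  also have "\<dots> = complex_of_real ((cmod (cinner x y))\<^sup>2 / cmod (cinner x y))"
    by (simp only: complex_norm_square[symmetric] of_real_divide)
  finally have "cmod (cinner x y) = Re (cinner (a *\<^sub>C x) y)"
    by (simp add: power2_eq_square)
  also have "\<dots> \<le> norm (a *\<^sub>C x) * norm y"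
    unfolding inner_cinner[symmetric] by (rule norm_cauchy_schwarz)
  finally show ?thesis
    by (simp add: norm_scaleC a)
qed simp

lemma cinner_eqI:
  assumes "\<And>y. cinner x y = cinner z (y::'a::complex_hilbert_space)"
  shows "x = z"
proof -
  have "cinner (x - z) (x - z) = 0"
    using assms by (simp add: cinner_diff_left)
  then show ?thesis
    by (simp add: cinner_self)
qed

lemma bounded_linear_cinner_left:
  "bounded_linear (\<lambda>x. cinner x (y::'a::complex_hilbert_space))"
  by (rule bounded_linear_intro[where K = "norm y"])
    (simp_all add: cinner_add_left cinner_scaleR_left norm_cinner_le)

lemma bounded_linear_cinner_right:
  "bounded_linear (\<lambda>y. cinner (x::'a::complex_hilbert_space) y)"
  by (rule bounded_linear_intro[where K = "norm x"])
    (simp_all add: cinner_add_right cinner_scaleR_right norm_cinner_le mult.commute[of "norm _" "norm x"])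

lemma bounded_linear_scaleC_right:
  "bounded_linear (\<lambda>x. a *\<^sub>C (x::'a::complex_hilbert_space))"
  by (rule bounded_linear_intro[where K = "cmod a"])
    (simp_all add: scaleC_add_right scaleC_scaleR_commute norm_scaleC)

lemma norm_add_sqr:
  "(norm (x + y::'a::complex_hilbert_space))\<^sup>2 = (norm x)\<^sup>2 + 2 * Re (cinner x y) + (norm y)\<^sup>2"
  by (simp add: power2_norm_eq_inner inner_add inner_commute inner_cinner[symmetric])

lemma norm_diff_sqr:
  "(norm (x - y::'a::complex_hilbert_space))\<^sup>2 = (norm x)\<^sup>2 - 2 * Re (cinner x y) + (norm y)\<^sup>2"
  using norm_add_sqr[of x "-y"] by simp

lemma norm_le_if_cinner_le:
  assumes "K \<ge> 0" and "\<And>y. cmod (cinner x y) \<le> K * norm (y::'a::complex_hilbert_space)"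
  shows "norm x \<le> K"
proof (cases "x = 0")
  case False
  have "norm x * norm x \<le> K * norm x"
    using assms(2)[of x] by (simp add: cmod_cinner_self)
  then show ?thesis
    using False by (simp add: mult_le_cancel_right)
qed (simp add: assms)

section \<open>Bounded complex-linear operators and contractions\<close>

lemma bounded_clinearI:
  assumes "\<And>x y. A (x + y) = A x + A y" and "\<And>a x. A (a *\<^sub>C x) = a *\<^sub>C A x"
    and "\<And>x. norm (A x) \<le> K * norm x"
  shows "bounded_clinear A"
  using assms unfolding bounded_clinear_on_def by blast

lemma bounded_clinear_imp_bounded_linear:
  assumes "bounded_clinear A"
  shows "bounded_linear A"
proof -
  from assms obtain K where "\<And>x. norm (A x) \<le> K * norm x"
    and "\<And>x y. A (x + y) = A x + A y" and "\<And>a x. A (a *\<^sub>C x) = a *\<^sub>C A x"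
    unfolding bounded_clinear_on_def by blast
  then show ?thesis
    by (intro bounded_linear_intro[where K = K]) (simp_all add: scaleR_scaleC mult.commute)
qed

lemma bounded_clinear_scaleC:
  "bounded_clinear A \<Longrightarrow> A (a *\<^sub>C x) = a *\<^sub>C A x"
  unfolding bounded_clinear_on_def by blast

lemma bounded_clinear_add:
  "bounded_clinear A \<Longrightarrow> A (x + y) = A x + A y"
  unfolding bounded_clinear_on_def by blast

lemma bounded_clinear_zero: "bounded_clinear A \<Longrightarrow> A 0 = 0"
  by (metis bounded_clinear_imp_bounded_linear linear_simps(3))

lemma bounded_clinear_diff: "bounded_clinear A \<Longrightarrow> A (x - y) = A x - A y"
  by (metis bounded_clinear_imp_bounded_linear linear_simps(2))

lemma bounded_clinear_minus: "bounded_clinear A \<Longrightarrow> A (- x) = - A x"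
  by (metis bounded_clinear_imp_bounded_linear linear_simps(4))

lemma bounded_clinear_scaleR: "bounded_clinear A \<Longrightarrow> A (r *\<^sub>R x) = r *\<^sub>R A x"
  by (simp add: scaleR_scaleC bounded_clinear_scaleC)

lemma bounded_clinear_sum: "bounded_clinear A \<Longrightarrow> A (\<Sum>i\<in>I. f i) = (\<Sum>i\<in>I. A (f i))"
  by (induction I rule: infinite_finite_induct)
    (simp_all add: bounded_clinear_zero bounded_clinear_add)

lemmas bounded_clinear_simps = bounded_clinear_scaleC bounded_clinear_add bounded_clinear_zero
  bounded_clinear_diff bounded_clinear_minus bounded_clinear_scaleR bounded_clinear_sum

lemma bounded_clinear_tendsto:
  "bounded_clinear A \<Longrightarrow> (f \<longlongrightarrow> l) F \<Longrightarrow> ((\<lambda>n. A (f n)) \<longlongrightarrow> A l) F"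
  by (rule bounded_linear.tendsto[OF bounded_clinear_imp_bounded_linear])

lemma bounded_clinear_pos_bound:
  assumes "bounded_clinear A"
  obtains K where "K \<ge> 0" and "\<And>x. norm (A x) \<le> K * norm x"
  using bounded_linear.nonneg_bounded[OF bounded_clinear_imp_bounded_linear[OF assms]]
  by (metis mult.commute)

lemma bounded_clinear_on_pos_bound:
  assumes "bounded_clinear_on M A"
  obtains K where "K \<ge> 0" and "\<And>x. x \<in> M \<Longrightarrow> norm (A x) \<le> K * norm x"
proof -
  from assms obtain K where "\<And>x. x \<in> M \<Longrightarrow> norm (A x) \<le> K * norm x"
    unfolding bounded_clinear_on_def by blast
  then have "x \<in> M \<Longrightarrow> norm (A x) \<le> \<bar>K\<bar> * norm x" for x
    by (meson abs_ge_self mult_right_mono norm_ge_zero order_trans)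
  then show ?thesis
    using that[of "\<bar>K\<bar>"] by simp
qed

lemma bounded_clinear_compose:
  assumes "bounded_clinear A" and "bounded_clinear B"
  shows "bounded_clinear (\<lambda>x. A (B x))"
proof -
  obtain K where K: "K \<ge> 0" "\<And>x. norm (A x) \<le> K * norm x"
    using bounded_clinear_pos_bound[OF assms(1)] by blast
  obtain L where L: "L \<ge> 0" "\<And>x. norm (B x) \<le> L * norm x"
    using bounded_clinear_pos_bound[OF assms(2)] by blast
  show ?thesis
  proof (rule bounded_clinearI[where K = "K * L"])
    fix x
    have "norm (A (B x)) \<le> K * norm (B x)" by (rule K)
    also have "\<dots> \<le> K * (L * norm x)" by (intro mult_left_mono K L)
    finally show "norm (A (B x)) \<le> K * L * norm x" by (simp add: mult.assoc)
  qed (simp_all add: assms bounded_clinear_simps)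
qed

lemma bounded_clinear_id: "bounded_clinear (\<lambda>x. x)"
  by (rule bounded_clinearI[where K = 1]) simp_all

lemma bounded_clinear_add_op:
  assumes "bounded_clinear A" and "bounded_clinear B"
  shows "bounded_clinear (\<lambda>x. A x + B x)"
proof -
  obtain K where K: "\<And>x. norm (A x) \<le> K * norm x"
    using bounded_clinear_pos_bound[OF assms(1)] by blast
  obtain L where L: "\<And>x. norm (B x) \<le> L * norm x"
    using bounded_clinear_pos_bound[OF assms(2)] by blast
  show ?thesis
    by (rule bounded_clinearI[where K = "K + L"])
      (use norm_triangle_mono[OF K L] in \<open>simp_all add: assms bounded_clinear_simps scaleC_add_right algebra_simps\<close>)
qed

lemma bounded_clinear_scaleC_op:
  assumes "bounded_clinear A"
  shows "bounded_clinear (\<lambda>x. a *\<^sub>C A x)"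
proof -
  obtain K where K: "\<And>x. norm (A x) \<le> K * norm x"
    using bounded_clinear_pos_bound[OF assms] by blast
  show ?thesis
    by (rule bounded_clinearI[where K = "cmod a * K"])
      (use mult_left_mono[OF K, of "cmod a"] in
        \<open>simp_all add: assms bounded_clinear_simps scaleC_add_right scaleC_scaleC norm_scaleC mult.commute mult.left_commute\<close>)
qed

lemma bounded_clinear_diff_op:
  assumes "bounded_clinear A" and "bounded_clinear B"
  shows "bounded_clinear (\<lambda>x. A x - B x)"
  using bounded_clinear_add_op[OF assms(1) bounded_clinear_scaleC_op[OF assms(2), of "-1"]] by simp

lemma bounded_clinear_funpow:
  fixes A :: "'a::complex_hilbert_space \<Rightarrow> 'a"
  assumes "bounded_clinear A"
  shows "bounded_clinear (A ^^ n)"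
proof (induction n)
  case 0
  show ?case using bounded_clinear_id by (simp only: funpow.simps(1) id_def)
next
  case (Suc n)
  then show ?case using bounded_clinear_compose[OF assms] by (simp add: o_def)
qed

lemma contraction_iff:
  "contraction A \<longleftrightarrow> bounded_clinear A \<and> (\<forall>x. norm (A x) \<le> norm x)"
proof (intro iffI conjI allI)
  fix x assume A: "contraction A"
  then have "norm (A x) \<le> onorm A * norm x"
    unfolding contraction_def by (intro onorm bounded_clinear_imp_bounded_linear) blast
  also have "\<dots> \<le> 1 * norm x"
    using A unfolding contraction_def by (intro mult_right_mono) auto
  finally show "norm (A x) \<le> norm x" by simp
next
  assume "bounded_clinear A \<and> (\<forall>x. norm (A x) \<le> norm x)"
  then show "contraction A"
    unfolding contraction_def by (auto intro!: onorm_bound)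
qed (simp add: contraction_def)

lemma contraction_bounded_clinear: "contraction A \<Longrightarrow> bounded_clinear A"
  by (simp add: contraction_def)

lemma contraction_norm_le: "contraction A \<Longrightarrow> norm (A x) \<le> norm x"
  by (simp add: contraction_iff)

section \<open>Representation of functionals, adjoints and factorization\<close>

text \<open>A nonzero linear term dominates near zero: \<open>t = - a / q\<close> with
  \<open>q > \<bar>b\<bar>\<close> makes the expression at most \<open>- a\<^sup>2 / q\<close>. This
  evaluates first variations of quadratic functionals.\<close>

lemma quadratic_nonneg_imp_zero:
  fixes a b :: real
  assumes "\<And>t. 0 \<le> t\<^sup>2 * b + 2 * t * a"
  shows "a = 0"
proof (rule ccontr)
  assume "a \<noteq> 0"
  define q where "q = \<bar>b\<bar> + 1"
  have q: "q > 0" by (simp add: q_def)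
  have "0 \<le> (a / q)\<^sup>2 * b - 2 * (a / q) * a"
    using assms[of "- (a / q)"] by simp
  also have "\<dots> \<le> (a / q)\<^sup>2 * q - 2 * (a / q) * a"
    by (simp add: q_def mult_left_mono)
  also have "\<dots> = - (a\<^sup>2 / q)"
    using q by (simp add: power2_eq_square field_simps)
  also have "\<dots> < 0"
    using q \<open>a \<noteq> 0\<close> by simp
  finally show False by simp
qed

text \<open>
  Minimizing \<open>(norm (D y))\<^sup>2 - 2 * f y\<close> yields a vector representing \<open>f\<close> in the closure of the
  range of \<open>D\<close>; for \<open>D\<close> the identity this is the Riesz representation theorem.
\<close>

lemma representation_on_range:
  fixes D :: "'b::real_vector \<Rightarrow> 'a::{real_inner, complete_space}" and f :: "'b \<Rightarrow> real"
  assumes D: "linear D" and f: "linear f" and bound: "\<And>y. \<bar>f y\<bar> \<le> K * norm (D y)"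
  shows "\<exists>u\<in>closure (range D). \<forall>y. inner (D y) u = f y"
proof -
  define J where "J y = (norm (D y))\<^sup>2 - 2 * f y" for y
  have J_ge: "J y \<ge> - K\<^sup>2" for y
  proof -
    have "0 \<le> (norm (D y) - K)\<^sup>2" by simp
    then show ?thesis
      using bound[of y] by (simp add: J_def power2_eq_square algebra_simps abs_le_iff)
  qed
  define m where "m = (INF y. J y)"
  have bdd: "bdd_below (range J)"
    using J_ge by (intro bdd_belowI[where m = "- K\<^sup>2"]) auto
  have m_le: "m \<le> J y" for y
    unfolding m_def by (rule cINF_lower[OF bdd]) simp
  have "\<exists>y. J y < m + inverse (real (Suc n))" for n
    using cINF_less_iff[of UNIV J "m + inverse (real (Suc n))"] bdd
    by (auto simp: m_def)
  then obtain y where y: "\<And>n. J (y n) < m + inverse (real (Suc n))"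
    by metis
  \<comment> \<open>The parallelogram law with the midpoint of \<open>a\<close> and \<open>b\<close>
    as competitor. It makes the images \<open>D (y n)\<close> Cauchy, although the
    \<open>y n\<close> themselves need not converge.\<close>
  have par: "(norm (D a - D b))\<^sup>2 \<le> 2 * (J a - m) + 2 * (J b - m)" for a b
  proof -
    have "4 * m \<le> 4 * J ((1/2) *\<^sub>R (a + b))"
      using m_le by simp
    also have "\<dots> = (norm (D a + D b))\<^sup>2 - 4 * (f a + f b)"
      by (simp add: J_def linear_scale[OF D] linear_add[OF D] linear_scale[OF f] linear_add[OF f]
          power_mult_distrib power_divide add_divide_distrib)
    finally have "4 * m \<le> (norm (D a + D b))\<^sup>2 - 4 * (f a + f b)" .
    moreover have "(norm (D a + D b))\<^sup>2 + (norm (D a - D b))\<^sup>2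
        = 2 * (norm (D a))\<^sup>2 + 2 * (norm (D b))\<^sup>2"
      by (simp add: power2_norm_eq_inner algebra_simps)
    ultimately show ?thesis
      by (simp add: J_def)
  qed
  have "Cauchy (\<lambda>n. D (y n))"
  proof (rule CauchyI)
    fix e :: real assume e: "e > 0"
    then obtain N where N: "inverse (real (Suc N)) < e\<^sup>2 / 4"
      using reals_Archimedean[of "e\<^sup>2 / 4"] by auto
    have "norm (D (y p) - D (y q)) < e" if "p \<ge> N" "q \<ge> N" for p q
    proof -
      have "J (y k) < m + e\<^sup>2 / 4" if "k \<ge> N" for k
      proof -
        have "inverse (real (Suc k)) \<le> inverse (real (Suc N))"
          using that by (auto intro!: le_imp_inverse_le)
        with N have "inverse (real (Suc k)) < e\<^sup>2 / 4" by (rule le_less_trans[rotated])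
        then show ?thesis
          by (rule less_trans[OF y add_strict_left_mono])
      qed
      from this[OF that(1)] this[OF that(2)]
      have "(norm (D (y p) - D (y q)))\<^sup>2 < e\<^sup>2"
        using par[of "y p" "y q"] by auto
      then show ?thesis
        using e by (simp add: power_less_imp_less_base)
    qed
    then show "\<exists>M. \<forall>p\<ge>M. \<forall>q\<ge>M. norm (D (y p) - D (y q)) < e" by blast
  qed
  then obtain u where u: "(\<lambda>n. D (y n)) \<longlonglongrightarrow> u"
    using Cauchy_convergent convergent_def by blast
  have mem: "u \<in> closure (range D)"
    unfolding closure_sequential using u by (intro exI[of _ "\<lambda>n. D (y n)"]) simp
  have J_lim: "(\<lambda>n. J (y n)) \<longlonglongrightarrow> m"
  proof (rule tendsto_sandwich)
    show "\<forall>\<^sub>F n in sequentially. m \<le> J (y n)"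
      by (simp add: m_le)
    show "\<forall>\<^sub>F n in sequentially. J (y n) \<le> m + inverse (real (Suc n))"
      using y by (intro always_eventually allI less_imp_le)
    show "(\<lambda>n. m + inverse (real (Suc n))) \<longlonglongrightarrow> m"
      using tendsto_add[OF tendsto_const LIMSEQ_inverse_real_of_nat] by simp
  qed simp
  \<comment> \<open>First variation in the direction \<open>v\<close>. There may be no minimizer
    \<open>y\<close>, so \<open>m \<le> J (y n + t *\<^sub>R v)\<close> is expanded and passed to
    the limit, where only \<open>D (y n)\<close> and \<open>J (y n)\<close> occur.\<close>
  have quad: "0 \<le> t\<^sup>2 * (norm (D v))\<^sup>2 + 2 * t * (inner (D v) u - f v)" for t v
  proof -
    have "m \<le> J (y n) + (t\<^sup>2 * (norm (D v))\<^sup>2 + 2 * t * (inner (D v) (D (y n)) - f v))" for n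
    proof -
      have "(norm (D (y n) + t *\<^sub>R D v))\<^sup>2
          = (norm (D (y n)))\<^sup>2 + 2 * t * inner (D v) (D (y n)) + t\<^sup>2 * (norm (D v))\<^sup>2"
        by (simp add: power2_norm_eq_inner inner_add inner_commute algebra_simps)
          (simp add: power2_eq_square)
      moreover have "m \<le> J (y n + t *\<^sub>R v)" by (rule m_le)
      ultimately show ?thesis
        by (simp add: J_def linear_scale[OF D] linear_add[OF D] linear_scale[OF f]
            linear_add[OF f] algebra_simps)
    qed
    moreover have "(\<lambda>n. J (y n) + (t\<^sup>2 * (norm (D v))\<^sup>2 + 2 * t * (inner (D v) (D (y n)) - f v)))
        \<longlonglongrightarrow> m + (t\<^sup>2 * (norm (D v))\<^sup>2 + 2 * t * (inner (D v) u - f v))"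
      by (intro tendsto_intros J_lim u)
    ultimately have "m \<le> m + (t\<^sup>2 * (norm (D v))\<^sup>2 + 2 * t * (inner (D v) u - f v))"
      by (meson LIMSEQ_le_const)
    then show ?thesis by simp
  qed
  have "inner (D v) u = f v" for v
    using quadratic_nonneg_imp_zero[OF quad] by simp
  with mem show ?thesis by blast
qed

lemma crepresentation_on_range:
  fixes D :: "'b::complex_hilbert_space \<Rightarrow> 'a::complex_hilbert_space"
  assumes D: "bounded_clinear D"
    and f: "\<And>x y. f (x + y) = f x + f y" "\<And>a x. f (a *\<^sub>C x) = a * f x"
    and K: "K \<ge> 0" and bound: "\<And>y. cmod (f y) \<le> K * norm (D y)"
  shows "\<exists>u\<in>closure (range D). norm u \<le> K \<and> (\<forall>y. cinner (D y) u = f y)"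
proof -
  have "linear D"
    using D by (simp add: bounded_linear.linear bounded_clinear_imp_bounded_linear)
  moreover have "linear (\<lambda>y. Re (f y))"
    by (rule linearI) (simp_all add: f scaleR_scaleC)
  moreover have "\<bar>Re (f y)\<bar> \<le> K * norm (D y)" for y
    using bound[of y] abs_Re_le_cmod[of "f y"] by linarith
  ultimately obtain u where u: "u \<in> closure (range D)" "\<And>y. inner (D y) u = Re (f y)"
    using representation_on_range by blast
  have eq: "cinner (D y) u = f y" for y
  proof (rule complex_eqI)
    show "Re (cinner (D y) u) = Re (f y)"
      using u(2)[of y] by (simp add: inner_cinner)
    \<comment> \<open>Complex linearity recovers the imaginary part from the real part at
      \<open>\<i> *\<^sub>C y\<close>.\<close>
    show "Im (cinner (D y) u) = Im (f y)"
      using u(2)[of "\<i> *\<^sub>C y"] by (simp add: inner_cinner f D bounded_clinear_simps cinner_linear)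
  qed
  obtain y where y: "(\<lambda>n. D (y n)) \<longlonglongrightarrow> u"
  proof -
    from u(1) obtain d where "\<forall>n. d n \<in> range D" "d \<longlonglongrightarrow> u"
      unfolding closure_sequential by blast
    then show thesis
      using that[of "\<lambda>n. inv D (d n)"] by (simp add: f_inv_into_f)
  qed
  have "norm u * norm u \<le> K * norm u"
  proof (rule LIMSEQ_le)
    show "(\<lambda>n. cmod (cinner (D (y n)) u)) \<longlonglongrightarrow> norm u * norm u"
      using tendsto_norm[OF bounded_linear.tendsto[OF bounded_linear_cinner_left[of u] y]]
      by (simp add: cmod_cinner_self)
    show "(\<lambda>n. K * norm (D (y n))) \<longlonglongrightarrow> K * norm u"
      by (intro tendsto_intros y)
  qed (simp add: eq bound)
  then have "norm u \<le> K"
    using K by (cases "u = 0") (auto simp: mult_le_cancel_right)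
  with u(1) eq show ?thesis by blast
qed

lemma cadjoint_exists:
  assumes "bounded_clinear A"
  shows "\<exists>A'. \<forall>x y. cinner (A x) y = cinner x (A' y)"
proof -
  obtain K where K: "K \<ge> 0" "\<And>x. norm (A x) \<le> K * norm x"
    using bounded_clinear_pos_bound[OF assms] by blast
  have "\<exists>u. \<forall>x. cinner x u = cinner (A x) y" for y
  proof -
    have "cmod (cinner (A x) y) \<le> (K * norm y) * norm x" for x
      using norm_cinner_le[of "A x" y] mult_right_mono[OF K(2)[of x] norm_ge_zero[of y]]
      by (simp add: mult.commute mult.left_commute)
    then show ?thesis
      using crepresentation_on_range[OF bounded_clinear_id, of "\<lambda>x. cinner (A x) y" "K * norm y"] K
      by (auto simp: bounded_clinear_simps[OF assms] cinner_linear)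
  qed
  then show ?thesis by metis
qed

lemma cadjoint_unique:
  assumes "\<And>x y. cinner (A x) y = cinner x (A' y)"
  shows "cadjoint A = A'"
  unfolding cadjoint_def
proof (rule the_equality)
  fix A'' assume "\<forall>x y. cinner (A x) y = cinner x (A'' y)"
  then have "cinner (A'' y) x = cinner (A' y) x" for x y
    using assms by (metis cinner_commute)
  then show "A'' = A'"
    by (intro ext) (rule cinner_eqI, simp)
qed (use assms in blast)

lemma cinner_cadjoint: "bounded_clinear A \<Longrightarrow> cinner (A x) y = cinner x (cadjoint A y)"
proof -
  assume "bounded_clinear A"
  then obtain A' where A': "\<And>x y. cinner (A x) y = cinner x (A' y)"
    using cadjoint_exists by blast
  then have "cadjoint A = A'"
    by (rule cadjoint_unique)
  with A' show ?thesis by simp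
qed

lemma cinner_cadjoint': "bounded_clinear A \<Longrightarrow> cinner (cadjoint A y) x = cinner y (A x)"
  by (subst (1 2) cinner_commute) (simp add: cinner_cadjoint)

lemma cadjoint_bounded_clinear:
  assumes A: "bounded_clinear A"
  shows "bounded_clinear (cadjoint A)"
proof -
  obtain K where K: "K \<ge> 0" "\<And>x. norm (A x) \<le> K * norm x"
    using bounded_clinear_pos_bound[OF A] by blast
  show ?thesis
  proof (rule bounded_clinearI[where K = K])
    show "cadjoint A (x + y) = cadjoint A x + cadjoint A y" for x y
      by (rule cinner_eqI) (simp add: A cinner_cadjoint' cinner_linear)
    show "cadjoint A (a *\<^sub>C x) = a *\<^sub>C cadjoint A x" for a x
      by (rule cinner_eqI) (simp add: A cinner_cadjoint' cinner_linear)
    show "norm (cadjoint A y) \<le> K * norm y" for y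
    proof (rule norm_le_if_cinner_le)
      fix x
      show "cmod (cinner (cadjoint A y) x) \<le> K * norm y * norm x"
        using norm_cinner_le[of y "A x"] mult_left_mono[OF K(2)[of x] norm_ge_zero[of y]]
        by (simp add: A cinner_cadjoint' mult.commute mult.left_commute)
    qed (simp add: K)
  qed
qed

lemma cadjoint_cadjoint: "bounded_clinear A \<Longrightarrow> cadjoint (cadjoint A) = A"
  by (rule cadjoint_unique) (rule cinner_cadjoint')

lemma cadjoint_contraction:
  assumes "contraction A"
  shows "contraction (cadjoint A)"
proof -
  have A: "bounded_clinear A" using assms by (rule contraction_bounded_clinear)
  have "norm (cadjoint A y) \<le> norm y" for y
  proof (rule norm_le_if_cinner_le)
    fix x
    show "cmod (cinner (cadjoint A y) x) \<le> norm y * norm x"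
      using norm_cinner_le[of y "A x"]
        mult_left_mono[OF contraction_norm_le[OF assms, of x] norm_ge_zero[of y]]
      by (simp add: A cinner_cadjoint')
  qed simp
  then show ?thesis
    by (simp add: contraction_iff cadjoint_bounded_clinear A)
qed

text \<open>
  Douglas' lemma: \<open>V x\<close> is determined by lying in the closure of the range of \<open>D\<close>, hence depends
  linearly on \<open>x\<close>.
\<close>

lemma factor_through_selfadjoint:
  fixes D :: "'b::complex_hilbert_space \<Rightarrow> 'b" and U :: "'a::complex_hilbert_space \<Rightarrow> 'b"
  assumes D: "bounded_clinear D" and sym: "\<And>x y. cinner (D x) y = cinner x (D y)"
    and U: "bounded_clinear U"
    and bound: "\<And>x y. cmod (cinner (U x) y) \<le> k x * norm (D y)"
    and k: "\<And>x. 0 \<le> k x" "\<And>x. k x \<le> K * norm x"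
  obtains V where "bounded_clinear V" and "\<And>x. U x = D (V x)"
    and "\<And>x. norm (V x) \<le> k x" and "range V \<subseteq> closure (range D)"
proof -
  have "\<exists>v\<in>closure (range D). norm v \<le> k x \<and> (\<forall>y. cinner (D y) v = cinner y (U x))" for x
    by (rule crepresentation_on_range[OF D]) (simp_all add: cinner_linear k,
      metis bound cinner_commute complex_mod_cnj)
  then obtain V where V: "\<And>x. V x \<in> closure (range D)" "\<And>x. norm (V x) \<le> k x"
    "\<And>x y. cinner (D y) (V x) = cinner y (U x)"
    by metis
  have uniq: "v = 0" if "v \<in> closure (range D)" "\<And>y. cinner (D y) v = 0" for v
  proof -
    from that(1) obtain d where d: "\<And>n. d n \<in> range D" "d \<longlonglongrightarrow> v"
      unfolding closure_sequential by blast
    have "cinner (d n) v = 0" for n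
      using d(1)[of n] that(2) by auto
    moreover have "(\<lambda>n. cinner (d n) v) \<longlonglongrightarrow> cinner v v"
      by (rule bounded_linear.tendsto[OF bounded_linear_cinner_left d(2)])
    ultimately show ?thesis
      by (simp add: LIMSEQ_const_iff cinner_self)
  qed
  have mem: "z \<in> closure (range D)" if "\<And>n. f n \<in> range D" "f \<longlonglongrightarrow> z" for f z
    unfolding closure_sequential using that by (intro exI[of _ f]) simp
  have cl: "x + y \<in> closure (range D)" "a *\<^sub>C x \<in> closure (range D)"
    if "x \<in> closure (range D)" "y \<in> closure (range D)" for x y a
  proof -
    from that obtain d e where d: "\<And>n. d n \<in> range D" "d \<longlonglongrightarrow> x" "\<And>n. e n \<in> range D" "e \<longlonglongrightarrow> y"
      unfolding closure_sequential by metis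
    have "d n + e n \<in> range D" "a *\<^sub>C d n \<in> range D" for n
      using d(1,3)[of n] by (auto simp flip: bounded_clinear_simps[OF D])
    moreover have "(\<lambda>n. d n + e n) \<longlonglongrightarrow> x + y" "(\<lambda>n. a *\<^sub>C d n) \<longlonglongrightarrow> a *\<^sub>C x"
      by (intro tendsto_add d bounded_linear.tendsto[OF bounded_linear_scaleC_right])+
    ultimately show "x + y \<in> closure (range D)" "a *\<^sub>C x \<in> closure (range D)"
      using mem[of "\<lambda>n. d n + e n"] mem[of "\<lambda>n. a *\<^sub>C d n"] by simp_all
  qed
  have eqI: "v = w" if "v \<in> closure (range D)" "w \<in> closure (range D)"
    "\<And>y. cinner (D y) v = cinner (D y) w" for v w
  proof -
    have "v + (- 1) *\<^sub>C w \<in> closure (range D)"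
      by (intro cl(1) cl(2)[OF that(2) that(2)] that)
    then show ?thesis
      using uniq[of "v + (- 1) *\<^sub>C w"] that(3) by (simp add: cinner_linear)
  qed
  have "bounded_clinear V"
  proof (rule bounded_clinearI[where K = K])
    show "V (x + y) = V x + V y" for x y
      by (rule eqI) (simp_all add: V cl cinner_linear bounded_clinear_simps[OF U])
    show "V (a *\<^sub>C x) = a *\<^sub>C V x" for a x
      by (rule eqI) (simp_all add: V cl(2)[OF V(1) V(1)] cinner_linear bounded_clinear_simps[OF U])
    show "norm (V x) \<le> K * norm x" for x
      using V(2)[of x] k(2)[of x] by linarith
  qed
  moreover have "U x = D (V x)" for x
    by (rule cinner_eqI) (metis V(3) sym cinner_commute)
  ultimately show thesis
    using that V by blast
qed

section \<open>Positive square roots and defect operators\<close>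

text \<open>Picard iteration for \<open>Y = (C + Y\<^sup>2) / 2\<close> from zero. The iterates are
  polynomials in \<open>C\<close>, so they inherit its symmetry and its intertwining
  relations.\<close>

primrec sqrt_iter :: "('a::complex_hilbert_space \<Rightarrow> 'a) \<Rightarrow> nat \<Rightarrow> 'a \<Rightarrow> 'a" where
  "sqrt_iter C 0 = (\<lambda>x. 0)"
| "sqrt_iter C (Suc n) = (\<lambda>x. (1/2) *\<^sub>R (C x + sqrt_iter C n (sqrt_iter C n x)))"

text \<open>The scalar case \<open>C = 1\<close> of the same iteration. It increases and is bounded
  by \<open>1\<close>, and it majorizes the operator iteration, which gives convergence without any
  order on operators.\<close>

primrec sqrt_iter_bound :: "nat \<Rightarrow> real" where
  "sqrt_iter_bound 0 = 0"
| "sqrt_iter_bound (Suc n) = (1 + (sqrt_iter_bound n)\<^sup>2) / 2"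

text \<open>The fixed point \<open>Y = (C + Y\<^sup>2) / 2\<close> of the iteration satisfies \<open>(1 - Y)\<^sup>2 = 1 - C\<close>.\<close>

definition sqrt_one_minus :: "('a::complex_hilbert_space \<Rightarrow> 'a) \<Rightarrow> 'a \<Rightarrow> 'a" where
  "sqrt_one_minus C x = x - lim (\<lambda>n. sqrt_iter C n x)"

lemma sqrt_iter_bound_nonneg: "0 \<le> sqrt_iter_bound n"
  by (cases n) simp_all

lemma sqrt_iter_bound_le_1: "sqrt_iter_bound n \<le> 1"
  by (induction n) (simp_all add: power_le_one sqrt_iter_bound_nonneg)

lemma sqrt_iter_bound_mono: "sqrt_iter_bound n \<le> sqrt_iter_bound (Suc n)"
  by (induction n) (simp_all add: power_mono sqrt_iter_bound_nonneg del: power_Suc)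

lemma sqrt_iter_bounded_clinear:
  assumes "bounded_clinear C"
  shows "bounded_clinear (sqrt_iter C n)"
proof (induction n)
  case 0
  show ?case by (rule bounded_clinearI[where K = 0]) simp_all
next
  case (Suc n)
  then show ?case
    using bounded_clinear_scaleC_op[OF bounded_clinear_add_op[OF assms bounded_clinear_compose[OF Suc Suc]],
        of "complex_of_real (1/2)"]
    by (simp add: scaleR_scaleC)
qed

lemma sqrt_iter_norm_le:
  assumes "contraction C"
  shows "norm (sqrt_iter C n x) \<le> sqrt_iter_bound n * norm x"
proof (induction n arbitrary: x)
  case (Suc n)
  have "norm (sqrt_iter C n (sqrt_iter C n x)) \<le> sqrt_iter_bound n * norm (sqrt_iter C n x)"
    by (rule Suc)
  also have "\<dots> \<le> sqrt_iter_bound n * (sqrt_iter_bound n * norm x)"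
    by (intro mult_left_mono Suc sqrt_iter_bound_nonneg)
  finally have "norm (C x + sqrt_iter C n (sqrt_iter C n x))
      \<le> norm x + sqrt_iter_bound n * (sqrt_iter_bound n * norm x)"
    by (intro norm_triangle_mono contraction_norm_le assms)
  then show ?case
    unfolding sqrt_iter.simps norm_scaleR by (simp add: power2_eq_square distrib_right)
qed simp

text \<open>With \<open>Y_n\<close> for the iterates, \<open>Y_(n+1)^2 - Y_n^2 = Y_(n+1) (Y_(n+1) -
  Y_n) + (Y_(n+1) - Y_n) Y_n\<close>. Bounding each factor by its scalar majorant reproduces the
  factorization of \<open>r_(n+1)^2 - r_n^2\<close>, which is twice the next scalar
  increment.\<close>

lemma sqrt_iter_step_le:
  assumes C: "contraction C"
  shows "norm (sqrt_iter C (Suc n) x - sqrt_iter C n x)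
    \<le> (sqrt_iter_bound (Suc n) - sqrt_iter_bound n) * norm x"
proof (induction n arbitrary: x)
  case 0
  show ?case
    using contraction_norm_le[OF C, of x] by (simp add: bounded_clinear_zero contraction_bounded_clinear C)
next
  case (Suc n)
  let ?Y = "sqrt_iter C" and ?r = sqrt_iter_bound
  have Y: "bounded_clinear (?Y m)" for m
    by (rule sqrt_iter_bounded_clinear[OF contraction_bounded_clinear[OF C]])
  define u where "u = ?Y (Suc n) x - ?Y n x"
  define v where "v = ?Y (Suc n) (?Y n x) - ?Y n (?Y n x)"
  have "?Y (Suc (Suc n)) x - ?Y (Suc n) x
      = (1/2) *\<^sub>R (?Y (Suc n) (?Y (Suc n) x) - ?Y n (?Y n x))"
    by (subst (1 2) sqrt_iter.simps(2)) (simp add: scaleR_diff_right[symmetric] del: sqrt_iter.simps)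
  also have "\<dots> = (1/2) *\<^sub>R (?Y (Suc n) u + v)"
    by (simp add: u_def v_def bounded_clinear_diff[OF Y] del: sqrt_iter.simps)
  finally have eq: "?Y (Suc (Suc n)) x - ?Y (Suc n) x = (1/2) *\<^sub>R (?Y (Suc n) u + v)" .
  have "norm (?Y (Suc n) u) \<le> ?r (Suc n) * norm u"
    by (rule sqrt_iter_norm_le[OF C])
  also have "\<dots> \<le> ?r (Suc n) * ((?r (Suc n) - ?r n) * norm x)"
    unfolding u_def by (intro mult_left_mono Suc.IH sqrt_iter_bound_nonneg)
  finally have 1: "norm (?Y (Suc n) u) \<le> ?r (Suc n) * ((?r (Suc n) - ?r n) * norm x)" .
  have "norm v \<le> (?r (Suc n) - ?r n) * norm (?Y n x)"
    unfolding v_def by (rule Suc.IH)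
  also have "\<dots> \<le> (?r (Suc n) - ?r n) * (?r n * norm x)"
    using sqrt_iter_bound_mono[of n] by (intro mult_left_mono sqrt_iter_norm_le[OF C]) simp
  finally have 2: "norm v \<le> (?r (Suc n) - ?r n) * (?r n * norm x)" .
  have r: "?r (Suc (Suc n)) = (1 + (?r (Suc n))\<^sup>2) / 2"
    by (rule sqrt_iter_bound.simps)
  have "?r (Suc n) = (1 + (?r n)\<^sup>2) / 2"
    by (rule sqrt_iter_bound.simps)
  then have "(?r n)\<^sup>2 = 2 * ?r (Suc n) - 1"
    by (simp add: field_simps del: sqrt_iter_bound.simps)
  then have "?r (Suc n) * ((?r (Suc n) - ?r n) * norm x) + (?r (Suc n) - ?r n) * (?r n * norm x)
      = (?r (Suc (Suc n)) - ?r (Suc n)) * norm x * 2"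
    unfolding r by algebra
  with 1 2 show ?case
    unfolding eq using norm_triangle_ineq[of "?Y (Suc n) u" v]
    by (simp del: sqrt_iter.simps sqrt_iter_bound.simps)
qed

lemma sqrt_iter_diff_le:
  assumes "contraction C"
  shows "norm (sqrt_iter C (n + k) x - sqrt_iter C n x)
    \<le> (sqrt_iter_bound (n + k) - sqrt_iter_bound n) * norm x"
proof (induction k)
  case (Suc k)
  have "norm (sqrt_iter C (n + Suc k) x - sqrt_iter C n x)
      \<le> norm (sqrt_iter C (Suc (n + k)) x - sqrt_iter C (n + k) x)
        + norm (sqrt_iter C (n + k) x - sqrt_iter C n x)"
    using norm_triangle_ineq[of "sqrt_iter C (Suc (n + k)) x - sqrt_iter C (n + k) x"
        "sqrt_iter C (n + k) x - sqrt_iter C n x"] by simp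
  then show ?case
    using sqrt_iter_step_le[OF assms, of "n + k" x] Suc by (simp add: algebra_simps del: sqrt_iter.simps sqrt_iter_bound.simps)
qed simp

lemma sqrt_iter_convergent:
  assumes C: "contraction C"
  shows "(\<lambda>n. sqrt_iter C n x) \<longlonglongrightarrow> x - sqrt_one_minus C x"
proof -
  have "incseq sqrt_iter_bound"
    by (rule incseq_SucI) (rule sqrt_iter_bound_mono)
  then have "convergent sqrt_iter_bound"
    using sqrt_iter_bound_le_1 sqrt_iter_bound_nonneg
    by (intro Bseq_mono_convergent BseqI'[where K = 1]) (auto simp: incseq_def)
  then have "Cauchy (\<lambda>n. sqrt_iter_bound n * norm x)"
    by (intro convergent_Cauchy convergent_mult convergent_const)
  have "Cauchy (\<lambda>n. sqrt_iter C n x)"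
  proof (rule CauchyI)
    fix e :: real assume "e > 0"
    then obtain M where M: "\<And>m n. m \<ge> M \<Longrightarrow> n \<ge> M
        \<Longrightarrow> norm (sqrt_iter_bound m * norm x - sqrt_iter_bound n * norm x) < e"
      using CauchyD[OF \<open>Cauchy (\<lambda>n. sqrt_iter_bound n * norm x)\<close>] by blast
    have le: "norm (sqrt_iter C m x - sqrt_iter C n x) < e" if "m \<ge> n" "n \<ge> M" for m n
      using sqrt_iter_diff_le[OF C, of n "m - n" x] M[of m n] that by (simp add: algebra_simps)
    show "\<exists>M. \<forall>m\<ge>M. \<forall>n\<ge>M. norm (sqrt_iter C m x - sqrt_iter C n x) < e"
      by (metis le linorder_linear norm_minus_commute)
  qed
  then have "convergent (\<lambda>n. sqrt_iter C n x)"
    by (rule Cauchy_convergent)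
  then show ?thesis
    by (simp add: sqrt_one_minus_def convergent_LIMSEQ_iff)
qed

lemma sqrt_iter_intertwine:
  assumes A: "bounded_clinear A" and "\<And>x. A (C x) = C' (A x)"
  shows "A (sqrt_iter C n x) = sqrt_iter C' n (A x)"
  by (induction n arbitrary: x) (simp_all add: bounded_clinear_simps[OF A] assms(2))

text \<open>Two operators \<open>C\<close> and \<open>C'\<close> are allowed so that one statement
  yields both the commutation of defect operators with other operators and the relation
  \<open>A D_A = D_A* A\<close>.\<close>

lemma sqrt_one_minus_intertwine:
  assumes A: "bounded_clinear A" and C: "contraction C" "contraction C'"
    and "\<And>x. A (C x) = C' (A x)"
  shows "A (sqrt_one_minus C x) = sqrt_one_minus C' (A x)"
proof -
  have "(\<lambda>n. sqrt_iter C' n (A x)) \<longlonglongrightarrow> A (x - sqrt_one_minus C x)"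
    using bounded_clinear_tendsto[OF A sqrt_iter_convergent[OF C(1), of x]]
    by (simp add: sqrt_iter_intertwine[of A C C', OF A assms(4)])
  then have "A x - A (sqrt_one_minus C x) = A x - sqrt_one_minus C' (A x)"
    using LIMSEQ_unique sqrt_iter_convergent[OF C(2), of "A x"]
    by (fastforce simp: bounded_clinear_diff[OF A])
  then show ?thesis by simp
qed

lemma sqrt_one_minus_norm_le:
  assumes "contraction C"
  shows "norm (x - sqrt_one_minus C x) \<le> norm x"
proof (rule LIMSEQ_le_const2)
  show "(\<lambda>n. norm (sqrt_iter C n x)) \<longlonglongrightarrow> norm (x - sqrt_one_minus C x)"
    by (intro tendsto_norm sqrt_iter_convergent assms)
  have "norm (sqrt_iter C n x) \<le> norm x" for n
    using sqrt_iter_norm_le[OF assms, of n x] mult_right_mono[OF sqrt_iter_bound_le_1[of n] norm_ge_zero[of x]]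
    by simp
  then show "\<exists>N. \<forall>n\<ge>N. norm (sqrt_iter C n x) \<le> norm x" by blast
qed

lemma sqrt_one_minus_bounded_clinear:
  assumes C: "contraction C"
  shows "bounded_clinear (sqrt_one_minus C)"
proof -
  note lim = sqrt_iter_convergent[OF C]
  note lin = bounded_clinear_simps[OF sqrt_iter_bounded_clinear[OF contraction_bounded_clinear[OF C]]]
  have "bounded_clinear (\<lambda>x. x - sqrt_one_minus C x)"
  proof (rule bounded_clinearI[where K = 1])
    fix x y and a :: complex
    have "(\<lambda>n. sqrt_iter C n (x + y)) \<longlonglongrightarrow> (x - sqrt_one_minus C x) + (y - sqrt_one_minus C y)"
      unfolding lin by (intro tendsto_add lim)
    then show "x + y - sqrt_one_minus C (x + y) = (x - sqrt_one_minus C x) + (y - sqrt_one_minus C y)"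
      using LIMSEQ_unique lim by blast
    have "(\<lambda>n. sqrt_iter C n (a *\<^sub>C x)) \<longlonglongrightarrow> a *\<^sub>C (x - sqrt_one_minus C x)"
      unfolding lin by (intro bounded_linear.tendsto[OF bounded_linear_scaleC_right] lim)
    then show "a *\<^sub>C x - sqrt_one_minus C (a *\<^sub>C x) = a *\<^sub>C (x - sqrt_one_minus C x)"
      using LIMSEQ_unique lim by blast
  qed (simp add: sqrt_one_minus_norm_le[OF C])
  from bounded_clinear_diff_op[OF bounded_clinear_id this] show ?thesis by simp
qed

lemma sqrt_one_minus_square:
  assumes C: "contraction C"
  shows "sqrt_one_minus C (sqrt_one_minus C x) = x - C x"
proof -
  define Y where "Y x = x - sqrt_one_minus C x" for x
  have Y: "(\<lambda>n. sqrt_iter C n x) \<longlonglongrightarrow> Y x" for x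
    unfolding Y_def by (rule sqrt_iter_convergent[OF C])
  have diff: "sqrt_iter C n (x - y) = sqrt_iter C n x - sqrt_iter C n y" for n x y
    by (rule bounded_clinear_diff[OF sqrt_iter_bounded_clinear[OF contraction_bounded_clinear[OF C]]])
  have "(\<lambda>n. sqrt_iter C n (sqrt_iter C n x) - sqrt_iter C n (Y x)) \<longlonglongrightarrow> 0"
  proof (rule Lim_null_comparison)
    show "\<forall>\<^sub>F n in sequentially. norm (sqrt_iter C n (sqrt_iter C n x) - sqrt_iter C n (Y x))
        \<le> norm (sqrt_iter C n x - Y x)"
    proof (intro always_eventually allI)
      fix n
      show "norm (sqrt_iter C n (sqrt_iter C n x) - sqrt_iter C n (Y x)) \<le> norm (sqrt_iter C n x - Y x)"
        using sqrt_iter_norm_le[OF C, of n "sqrt_iter C n x - Y x"]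
          mult_right_mono[OF sqrt_iter_bound_le_1[of n] norm_ge_zero[of "sqrt_iter C n x - Y x"]]
        by (simp add: diff)
    qed
    show "(\<lambda>n. norm (sqrt_iter C n x - Y x)) \<longlonglongrightarrow> 0"
      using Y[of x] by (simp add: LIM_zero tendsto_norm_zero)
  qed
  from tendsto_add[OF this Y[of "Y x"]]
  have "(\<lambda>n. sqrt_iter C n (sqrt_iter C n x)) \<longlonglongrightarrow> Y (Y x)" by simp
  then have "(\<lambda>n. sqrt_iter C (Suc n) x) \<longlonglongrightarrow> (1/2) *\<^sub>R (C x + Y (Y x))"
    unfolding sqrt_iter.simps by (intro tendsto_intros)
  moreover have "(\<lambda>n. sqrt_iter C (Suc n) x) \<longlonglongrightarrow> Y x"
    by (rule LIMSEQ_Suc[OF Y])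
  ultimately have "(1/2) *\<^sub>R (C x + Y (Y x)) = Y x"
    by (rule LIMSEQ_unique)
  then have "2 *\<^sub>R ((1/2) *\<^sub>R (C x + Y (Y x))) = 2 *\<^sub>R Y x" by simp
  then have "C x + Y (Y x) = Y x + Y x"
    by (simp only: scaleR_scaleR) (simp add: scaleR_2)
  then show ?thesis
    unfolding Y_def
    by (simp add: bounded_clinear_diff[OF sqrt_one_minus_bounded_clinear[OF C]] algebra_simps)
qed

lemma sqrt_iter_symmetric:
  assumes "\<And>x y. cinner (C x) y = cinner x (C y)"
  shows "cinner (sqrt_iter C n x) y = cinner x (sqrt_iter C n y)"
  by (induction n arbitrary: x y)
    (simp_all add: cinner_scaleR_left cinner_scaleR_right cinner_linear assms)

lemma sqrt_one_minus_positive: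
  assumes C: "contraction C" and sym: "\<And>x y. cinner (C x) y = cinner x (C y)"
  shows "positive_op (sqrt_one_minus C)"
  unfolding positive_op_def
proof
  fix x
  define Y where "Y = x - sqrt_one_minus C x"
  have lim: "(\<lambda>n. sqrt_iter C n x) \<longlonglongrightarrow> Y"
    unfolding Y_def by (rule sqrt_iter_convergent[OF C])
  have "(\<lambda>n. cinner (sqrt_iter C n x) x) \<longlonglongrightarrow> cinner Y x"
    by (rule bounded_linear.tendsto[OF bounded_linear_cinner_left lim])
  moreover have "(\<lambda>n. cinner x (sqrt_iter C n x)) \<longlonglongrightarrow> cinner x Y"
    by (rule bounded_linear.tendsto[OF bounded_linear_cinner_right lim])
  ultimately have "cinner Y x = cinner x Y"
    unfolding sqrt_iter_symmetric[of C, OF sym] by (rule LIMSEQ_unique)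
  then have im: "Im (cinner Y x) = 0"
    using cinner_commute[of x Y] by (simp add: complex_eq_iff)
  have "cmod (cinner Y x) \<le> norm x * norm x"
    using norm_cinner_le[of Y x] mult_right_mono[OF sqrt_one_minus_norm_le[OF C, of x] norm_ge_zero[of x]]
    by (simp add: Y_def)
  then have "Re (cinner Y x) \<le> (norm x)\<^sup>2"
    using complex_Re_le_cmod[of "cinner Y x"] by (simp add: power2_eq_square)
  moreover have "sqrt_one_minus C x = x - Y" by (simp add: Y_def)
  ultimately show "cinner (sqrt_one_minus C x) x \<in> \<real>\<^sub>\<ge>\<^sub>0"
    using im by (simp add: complex_nonneg_Reals_iff cinner_diff_left cinner_self del: of_real_power)
qed

lemma positive_op_symmetric:
  assumes S: "bounded_clinear S" "positive_op S"
  shows "cinner (S x) y = cinner x (S y)"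
proof -
  have real: "Im (cinner (S z) z) = 0" for z
    using S(2) by (simp add: positive_op_def complex_nonneg_Reals_iff)
  have "Im (cinner (S x) y) = - Im (cinner (S y) x)"
    using real[of "x + y"] real[of x] real[of y] by (simp add: bounded_clinear_simps[OF S(1)] cinner_linear)
  moreover have "Re (cinner (S x) y) = Re (cinner (S y) x)"
    using real[of "x + \<i> *\<^sub>C y"] real[of x] real[of y]
    by (simp add: bounded_clinear_simps[OF S(1)] cinner_linear)
  ultimately have "cinner (S x) y = cnj (cinner (S y) x)"
    by (simp add: complex_eq_iff)
  then show ?thesis
    by (simp add: cinner_commute[of x "S y"])
qed

text \<open>\<open>y\<close> minimizes the nonnegative quadratic form of \<open>S\<close>, so the
  first variation in the direction \<open>S y\<close>, which is
  \<open>2 * (norm (S y))\<^sup>2\<close>, vanishes.\<close>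

lemma positive_op_zero:
  assumes S: "bounded_clinear S" "positive_op S" and "cinner (S y) y = 0"
  shows "S y = 0"
proof -
  have nonneg: "0 \<le> Re (cinner (S z) z)" for z
    using S(2) by (simp add: positive_op_def complex_nonneg_Reals_iff)
  have "0 \<le> t\<^sup>2 * Re (cinner (S (S y)) (S y)) + 2 * t * (norm (S y))\<^sup>2" for t :: real
  proof -
    have "cinner (S (y + t *\<^sub>R S y)) (y + t *\<^sub>R S y)
        = of_real (2 * t * (norm (S y))\<^sup>2) + of_real (t\<^sup>2) * cinner (S (S y)) (S y)"
      using assms(3) positive_op_symmetric[OF S, of "S y" y]
      by (simp add: bounded_clinear_simps[OF S(1)] cinner_linear cinner_scaleR_left cinner_scaleR_right
          cinner_self scaleR_conv_of_real power2_eq_square algebra_simps)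
    then show ?thesis
      using nonneg[of "y + t *\<^sub>R S y"] by simp
  qed
  then have "(norm (S y))\<^sup>2 = 0"
    by (rule quadratic_nonneg_imp_zero)
  then show ?thesis by simp
qed

text \<open>Commutation gives \<open>(S + S') (S - S') = 0\<close>. On \<open>y = (S - S') x\<close>
  the two nonnegative forms therefore add up to zero, so \<open>S\<close> and \<open>S'\<close> both
  annihilate \<open>y\<close>, and \<open>cinner y y = 0\<close> by symmetry.\<close>

lemma positive_sqrt_unique:
  assumes S: "bounded_clinear S" "positive_op S" and S': "bounded_clinear S'" "positive_op S'"
    and comm: "\<And>x. S (S' x) = S' (S x)" and eq: "\<And>x. S (S x) = S' (S' x)"
  shows "S = S'"
proof
  fix x
  define y where "y = S x - S' x"
  have nonneg: "cinner (S y) y \<in> \<real>\<^sub>\<ge>\<^sub>0" "cinner (S' y) y \<in> \<real>\<^sub>\<ge>\<^sub>0"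
    using S(2) S'(2) by (auto simp: positive_op_def)
  have "S y + S' y = 0"
    by (simp add: y_def bounded_clinear_simps[OF S(1)] bounded_clinear_simps[OF S'(1)] comm eq)
  then have "cinner (S y) y + cinner (S' y) y = 0"
    by (metis cinner_add_left cinner_zero_left)
  with nonneg have "cinner (S y) y = 0" "cinner (S' y) y = 0"
    by (simp_all add: complex_nonneg_Reals_iff complex_eq_iff)
  then have "S y = 0" "S' y = 0"
    using positive_op_zero S S' by blast+
  then have "cinner (S x - S' x) y = 0"
    using positive_op_symmetric[OF S, of x y] positive_op_symmetric[OF S', of x y]
    by (simp add: cinner_diff_left)
  then have "cinner y y = 0" by (simp add: y_def)
  then show "S x = S' x" by (simp add: cinner_self y_def)
qed

lemma op_sqrt_eq_sqrt_one_minus: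
  assumes C: "contraction C" and sym: "\<And>x y. cinner (C x) y = cinner x (C y)"
  shows "op_sqrt (\<lambda>x. x - C x) = sqrt_one_minus C"
  unfolding op_sqrt_def
proof (rule the_equality)
  let ?S = "sqrt_one_minus C"
  note S = sqrt_one_minus_bounded_clinear[OF C] sqrt_one_minus_positive[OF C sym]
  show "bounded_clinear ?S \<and> positive_op ?S \<and> ?S \<circ> ?S = (\<lambda>x. x - C x)"
    using S by (simp add: fun_eq_iff sqrt_one_minus_square[OF C])
  fix R assume R: "bounded_clinear R \<and> positive_op R \<and> R \<circ> R = (\<lambda>x. x - C x)"
  then have RR: "R (R x) = x - C x" for x
    by (metis comp_apply)
  \<comment> \<open>Any square root commutes with its square \<open>1 - C\<close>, hence with
    \<open>C\<close> and with \<open>sqrt_one_minus C\<close>. This supplies the commutation that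
    the uniqueness lemma requires.\<close>
  have "R (C x) = C (R x)" for x
  proof -
    have "R (x - C x) = R x - C (R x)"
      using RR by metis
    then show ?thesis
      using R by (simp add: bounded_clinear_diff)
  qed
  then have "R (?S x) = ?S (R x)" for x
    using R C by (intro sqrt_one_minus_intertwine) auto
  then show "R = ?S"
    using R S RR sqrt_one_minus_square[OF C] by (intro positive_sqrt_unique) auto
qed

section \<open>Defect operators and the Julia operator\<close>

lemma cadjoint_mult_contraction:
  assumes "contraction A"
  shows "contraction (\<lambda>x. cadjoint A (A x))"
proof -
  have "norm (cadjoint A (A x)) \<le> norm x" for x
    using contraction_norm_le[OF cadjoint_contraction[OF assms], of "A x"]
      contraction_norm_le[OF assms, of x] by linarith
  then show ?thesis
    using assms by (simp add: contraction_iff bounded_clinear_compose cadjoint_bounded_clinear)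
qed

lemma cadjoint_mult_symmetric:
  assumes "bounded_clinear A"
  shows "cinner (cadjoint A (A x)) y = cinner x (cadjoint A (A y))"
  using assms by (simp add: cinner_cadjoint' cinner_cadjoint)

lemma defect_op_eq:
  assumes "contraction A"
  shows "defect_op A = sqrt_one_minus (\<lambda>x. cadjoint A (A x))"
  unfolding defect_op_def
  using assms by (intro op_sqrt_eq_sqrt_one_minus cadjoint_mult_contraction cadjoint_mult_symmetric
      contraction_bounded_clinear)

lemma defect_op_bounded_clinear:
  "contraction A \<Longrightarrow> bounded_clinear (defect_op A)"
  by (simp add: defect_op_eq sqrt_one_minus_bounded_clinear cadjoint_mult_contraction)

lemma defect_op_square:
  "contraction A \<Longrightarrow> defect_op A (defect_op A x) = x - cadjoint A (A x)"
  by (simp add: defect_op_eq sqrt_one_minus_square cadjoint_mult_contraction)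

lemma defect_op_symmetric:
  assumes "contraction A"
  shows "cinner (defect_op A x) y = cinner x (defect_op A y)"
proof (rule positive_op_symmetric[OF defect_op_bounded_clinear[OF assms]])
  show "positive_op (defect_op A)"
    using assms by (simp add: defect_op_eq sqrt_one_minus_positive cadjoint_mult_contraction
        cadjoint_mult_symmetric contraction_bounded_clinear)
qed

lemma defect_op_norm:
  assumes A: "contraction A"
  shows "(norm (defect_op A x))\<^sup>2 = (norm x)\<^sup>2 - (norm (A x))\<^sup>2"
proof -
  have "complex_of_real ((norm (defect_op A x))\<^sup>2) = cinner x (defect_op A (defect_op A x))"
    by (simp only: cinner_self[symmetric] defect_op_symmetric[OF A])
  also have "\<dots> = cinner x x - cinner (A x) (A x)"
    by (simp add: defect_op_square[OF A] cinner_diff_right cinner_cadjoint[OF contraction_bounded_clinear[OF A]])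
  also have "\<dots> = complex_of_real ((norm x)\<^sup>2 - (norm (A x))\<^sup>2)"
    by (simp only: cinner_self of_real_diff)
  finally show ?thesis
    by (simp only: of_real_eq_iff)
qed

lemma defect_op_norm_le: "contraction A \<Longrightarrow> norm (defect_op A x) \<le> norm x"
  by (rule power2_le_imp_le) (simp_all add: defect_op_norm)

lemma defect_op_commute:
  assumes "contraction A" and "bounded_clinear B"
    and "\<And>x. B (cadjoint A (A x)) = cadjoint A (A (B x))"
  shows "B (defect_op A x) = defect_op A (B x)"
  using assms by (simp add: defect_op_eq sqrt_one_minus_intertwine[of B] cadjoint_mult_contraction)

lemma defect_op_intertwine:
  assumes A: "contraction A"
  shows "A (defect_op A x) = defect_op (cadjoint A) (A x)"
  using sqrt_one_minus_intertwine[OF contraction_bounded_clinear[OF A] cadjoint_mult_contraction[OF A]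
      cadjoint_mult_contraction[OF cadjoint_contraction[OF A]], of x]
  by (simp add: defect_op_eq A cadjoint_contraction cadjoint_cadjoint contraction_bounded_clinear)

lemma defect_op_intertwine':
  assumes A: "contraction A"
  shows "cadjoint A (defect_op (cadjoint A) x) = defect_op A (cadjoint A x)"
  using defect_op_intertwine[OF cadjoint_contraction[OF A]] A
  by (simp add: cadjoint_cadjoint contraction_bounded_clinear)

lemma defect_op_cadjoint_norm_le:
  assumes A: "contraction A"
  shows "norm (defect_op (cadjoint A) (A x)) \<le> norm (defect_op A x)"
  using contraction_norm_le[OF A, of "defect_op A x"] by (simp add: defect_op_intertwine[OF A])

lemma defect_op_in_defect_space: "defect_op A x \<in> defect_space A"
  unfolding defect_space_def by (meson closure_subset rangeI subsetD)

text \<open>Isometry of the block operator with first row \<open>A, D_A*\<close> and second row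
  \<open>D_A, - A*\<close>. The cross terms of the two squares cancel because
  \<open>A D_A = D_A* A\<close>.\<close>

lemma Julia_operator_norm:
  assumes A: "contraction A"
  shows "(norm (A x + defect_op (cadjoint A) u))\<^sup>2 + (norm (defect_op A x - cadjoint A u))\<^sup>2
    = (norm x)\<^sup>2 + (norm u)\<^sup>2"
proof -
  note bA = contraction_bounded_clinear[OF A]
  have "cinner (A x) (defect_op (cadjoint A) u) = cinner (defect_op A x) (cadjoint A u)"
    by (simp add: defect_op_symmetric[OF cadjoint_contraction[OF A], symmetric]
        defect_op_intertwine[OF A, symmetric] cinner_cadjoint[OF bA])
  then show ?thesis
    by (simp add: norm_add_sqr norm_diff_sqr defect_op_norm[OF A]
        defect_op_norm[OF cadjoint_contraction[OF A]])
qed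

section \<open>Harnack domination and Toeplitz kernels\<close>

primrec horner :: "('a \<Rightarrow> 'a) \<Rightarrow> (nat \<Rightarrow> 'a::complex_hilbert_space) \<Rightarrow> nat \<Rightarrow> 'a" where
  "horner T h 0 = 0"
| "horner T h (Suc m) = h m + T (horner T h m)"

text \<open>The sesquilinear form of the kernel equal to \<open>T^k\<close> for
  \<open>k \<ge> 0\<close> and to the power \<open>- k\<close> of \<open>cadjoint T\<close> for
  \<open>k < 0\<close>. The adjoint is moved to the second argument, where it becomes a power of
  \<open>T\<close>.\<close>

definition toeplitz_coeff :: "('a::complex_hilbert_space \<Rightarrow> 'a) \<Rightarrow> int \<Rightarrow> 'a \<Rightarrow> 'a \<Rightarrow> complex" where
  "toeplitz_coeff T k x y =
    (if 0 \<le> k then cinner ((T ^^ nat k) x) y else cinner x ((T ^^ nat (- k)) y))"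

definition toeplitz_form :: "('a::complex_hilbert_space \<Rightarrow> 'a) \<Rightarrow> (nat \<Rightarrow> 'a) \<Rightarrow> nat \<Rightarrow> complex" where
  "toeplitz_form T h N = (\<Sum>i<N. \<Sum>j<N. toeplitz_coeff T (int j - int i) (h i) (h j))"

lemma horner_sum:
  assumes "bounded_clinear T"
  shows "T (horner T h N) = (\<Sum>i<N. (T ^^ (N - i)) (h i))"
proof (induction N)
  case (Suc N)
  have "T (T (horner T h N)) = (\<Sum>i<N. (T ^^ (Suc N - i)) (h i))"
    unfolding Suc by (simp add: bounded_clinear_sum[OF assms] Suc_diff_le)
  then show ?case
    by (simp add: bounded_clinear_add[OF assms] add.commute)
qed (simp add: bounded_clinear_zero[OF assms])

lemma toeplitz_form_Suc:
  assumes T: "bounded_clinear T"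
  shows "toeplitz_form T h (Suc N) = toeplitz_form T h N
    + of_real ((norm (h N))\<^sup>2 + 2 * Re (cinner (T (horner T h N)) (h N)))"
proof -
  have 1: "(\<Sum>i<N. toeplitz_coeff T (int N - int i) (h i) (h N)) = cinner (T (horner T h N)) (h N)"
    by (auto simp: horner_sum[OF T] cinner_sum_left toeplitz_coeff_def nat_diff_distrib intro!: sum.cong)
  have "(\<Sum>j<N. toeplitz_coeff T (int j - int N) (h N) (h j)) = cinner (h N) (T (horner T h N))"
    by (auto simp: horner_sum[OF T] cinner_sum_right toeplitz_coeff_def nat_diff_distrib intro!: sum.cong)
  then have 2: "(\<Sum>j<N. toeplitz_coeff T (int j - int N) (h N) (h j)) = cnj (cinner (T (horner T h N)) (h N))"
    by (metis cinner_commute)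
  have "toeplitz_form T h (Suc N) = toeplitz_form T h N
      + (\<Sum>i<N. toeplitz_coeff T (int N - int i) (h i) (h N))
      + (\<Sum>j<N. toeplitz_coeff T (int j - int N) (h N) (h j)) + cinner (h N) (h N)"
    by (simp add: toeplitz_form_def sum.distrib toeplitz_coeff_def)
  then show ?thesis
    unfolding 1 2 cinner_self by (simp add: complex_eq_iff)
qed

text \<open>
  The right-hand side is \<open>(norm (\<Sum>i<N. V ^ (N - 1 - i) (h i)))\<^sup>2\<close> for the minimal isometric
  dilation \<open>V\<close> of \<open>T\<close>.
\<close>

lemma toeplitz_form_eq:
  assumes T: "contraction T"
  shows "toeplitz_form T h N
    = of_real ((norm (horner T h N))\<^sup>2 + (\<Sum>m<N. (norm (defect_op T (horner T h m)))\<^sup>2))"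
proof (induction N)
  case 0
  show ?case by (simp add: toeplitz_form_def)
next
  case (Suc N)
  have "(norm (horner T h (Suc N)))\<^sup>2
      = (norm (h N))\<^sup>2 + 2 * Re (cinner (h N) (T (horner T h N))) + (norm (T (horner T h N)))\<^sup>2"
    by (simp add: norm_add_sqr)
  moreover have "Re (cinner (h N) (T (horner T h N))) = Re (cinner (T (horner T h N)) (h N))"
    by (subst cinner_commute) simp
  ultimately show ?case
    unfolding toeplitz_form_Suc[OF contraction_bounded_clinear[OF T]] Suc of_real_add[symmetric] of_real_eq_iff
    by (simp add: defect_op_norm[OF T])
qed

lemma toeplitz_form_real:
  "contraction T \<Longrightarrow> toeplitz_form T h N = of_real (Re (toeplitz_form T h N))"
  by (simp add: toeplitz_form_eq)

lemma toeplitz_form_nonneg: "contraction T \<Longrightarrow> 0 \<le> Re (toeplitz_form T h N)"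
  by (simp add: toeplitz_form_eq sum_nonneg)

subsection \<open>Polynomials of operators\<close>

lemma poly_op_eq:
  assumes "degree p \<le> n"
  shows "poly_op p T x = (\<Sum>k\<le>n. coeff p k *\<^sub>C (T ^^ k) x)"
  unfolding poly_op_def using assms
  by (intro sum.mono_neutral_left) (auto simp: coeff_eq_0)

lemma poly_op_bounded_clinear:
  assumes "bounded_clinear T"
  shows "bounded_clinear (poly_op p T)"
proof -
  have "bounded_clinear (\<lambda>x. \<Sum>k\<in>I. coeff p k *\<^sub>C (T ^^ k) x)" if "finite I" for I
    using that
  proof induction
    case empty
    show ?case by (rule bounded_clinearI[where K = 0]) simp_all
  next
    case (insert k I)
    then show ?case
      using bounded_clinear_add_op[OF bounded_clinear_scaleC_op[OF bounded_clinear_funpow[OF assms]]] by simp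
  qed
  then show ?thesis by (simp add: poly_op_def[abs_def])
qed

lemma cinner_op_Re:
  assumes "bounded_clinear A"
  shows "cinner (op_Re A x) x = of_real (Re (cinner (A x) x))"
proof -
  have "cinner (cadjoint A x) x = cnj (cinner (A x) x)"
    by (simp add: cinner_cadjoint'[OF assms]) (rule cinner_commute)
  then show ?thesis
    by (simp add: op_Re_def cinner_scaleR_left cinner_add_left complex_eq_iff)
qed

lemma Harnack_dominated_iff:
  assumes "bounded_clinear T" and "bounded_clinear T'"
  shows "Harnack_dominated T T' \<longleftrightarrow> (\<exists>c\<ge>1. \<forall>p. (\<forall>z. cmod z \<le> 1 \<longrightarrow> Re (poly p z) \<ge> 0) \<longrightarrow>
    (\<forall>x. Re (cinner (poly_op p T x) x) \<le> c * Re (cinner (poly_op p T' x) x)))"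
  unfolding Harnack_dominated_def op_le_def positive_op_def
  by (simp add: cinner_diff_left cinner_scaleR_left cinner_op_Re poly_op_bounded_clinear assms
      complex_nonneg_Reals_iff)

text \<open>\<open>N\<close> times the analytic completion of the Fejer kernel centred at
  \<open>w\<close>: on the unit circle its real part is the squared modulus of
  \<open>\<Sum>m<N. (cnj w * z) ^ m\<close> when \<open>cmod w = 1\<close>.\<close>

definition fejer_poly :: "complex \<Rightarrow> nat \<Rightarrow> complex poly" where
  "fejer_poly w N = (\<Sum>k<N. monom ((if k = 0 then 1 else 2) * of_nat (N - k) * cnj w ^ k) k)"

lemma coeff_fejer_poly:
  "coeff (fejer_poly w N) k
    = (if k < N then (if k = 0 then 1 else 2) * of_nat (N - k) * cnj w ^ k else 0)"
  by (simp add: fejer_poly_def coeff_sum)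

lemma degree_fejer_poly: "degree (fejer_poly w N) \<le> N"
  by (rule degree_le) (simp add: coeff_fejer_poly)

text \<open>On the family \<open>w ^ m *\<^sub>C x\<close> the entries of the Toeplitz form depend
  only on \<open>j - i\<close>. The weight \<open>N - k\<close> counts the entries on a diagonal and
  grows by one with each new row and column; the factor \<open>2\<close> joins the conjugate
  diagonals \<open>k\<close> and \<open>- k\<close>.\<close>

lemma fejer_poly_op:
  assumes T: "contraction T" and w: "cmod w = 1"
  shows "Re (cinner (poly_op (fejer_poly w N) T x) x) = Re (toeplitz_form T (\<lambda>m. w ^ m *\<^sub>C x) N)"
proof -
  note bT = contraction_bounded_clinear[OF T]
  define t where "t k = cnj w ^ k * cinner ((T ^^ k) x) x" for k
  have ww: "w * cnj w = 1" using w by (simp add: complex_norm_square[symmetric])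
  have "Re (toeplitz_form T (\<lambda>m. w ^ m *\<^sub>C x) N)
      = (\<Sum>k<N. (if k = 0 then 1 else 2) * real (N - k) * Re (t k))"
  proof (induction N)
    case 0
    show ?case by (simp add: toeplitz_form_def)
  next
    case (Suc N)
    let ?h = "\<lambda>m. w ^ m *\<^sub>C x"
    have "cinner (T (horner T ?h N)) (?h N) = (\<Sum>i<N. t (N - i))"
      unfolding horner_sum[OF bT] cinner_sum_left
    proof (rule sum.cong)
      fix i assume "i \<in> {..<N}"
      then have "cnj w ^ N = cnj w ^ (N - i) * cnj w ^ i"
        by (simp add: power_add[symmetric])
      moreover have "w ^ i * cnj w ^ i = 1"
        by (simp add: power_mult_distrib[symmetric] ww)
      ultimately have "w ^ i * cnj w ^ N = cnj w ^ (N - i)"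
        by (simp add: mult.commute mult.left_commute)
      then show "cinner ((T ^^ (N - i)) (w ^ i *\<^sub>C x)) (w ^ N *\<^sub>C x) = t (N - i)"
        by (simp add: bounded_clinear_scaleC[OF bounded_clinear_funpow[OF bT]] cinner_linear t_def
            mult.assoc[symmetric] mult.commute)
    qed simp
    also have "\<dots> = (\<Sum>i<N. t (Suc i))"
      using sum.nat_diff_reindex[of "\<lambda>i. t (Suc i)" N] by (simp add: Suc_diff_Suc)
    finally have inner: "Re (cinner (T (horner T ?h N)) (?h N)) = (\<Sum>i<N. Re (t (Suc i)))"
      by simp
    have "norm (?h N) = norm x"
      using w by (simp add: norm_scaleC norm_power)
    then have "Re (toeplitz_form T ?h (Suc N))
        = (\<Sum>k<N. (if k = 0 then 1 else 2) * real (N - k) * Re (t k)) + (Re (t 0) + 2 * (\<Sum>i<N. Re (t (Suc i))))"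
      unfolding toeplitz_form_Suc[OF bT] using inner by (simp add: Suc t_def cinner_self)
    also have "Re (t 0) + 2 * (\<Sum>i<N. Re (t (Suc i))) = (\<Sum>k<Suc N. (if k = 0 then 1 else 2) * Re (t k))"
      by (simp add: sum.lessThan_Suc_shift sum_distrib_left del: sum.lessThan_Suc)
    also have "(\<Sum>k<N. (if k = 0 then 1 else 2) * real (N - k) * Re (t k))
        = (\<Sum>k<Suc N. (if k = 0 then 1 else 2) * real (N - k) * Re (t k))"
      by simp
    also have "\<dots> + (\<Sum>k<Suc N. (if k = 0 then 1 else 2) * Re (t k))
        = (\<Sum>k<Suc N. (if k = 0 then 1 else 2) * real (Suc N - k) * Re (t k))"
      unfolding sum.distrib[symmetric]
      by (intro sum.cong) (auto simp: Suc_diff_le algebra_simps)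
    finally show ?case .
  qed
  also have "\<dots> = (\<Sum>k<N. Re (coeff (fejer_poly w N) k * cinner ((T ^^ k) x) x))"
    by (intro sum.cong) (auto simp: coeff_fejer_poly t_def mult.assoc simp flip: of_nat_mult)
  also have "\<dots> = (\<Sum>k\<le>N. Re (coeff (fejer_poly w N) k * cinner ((T ^^ k) x) x))"
    by (simp add: lessThan_Suc_atMost[symmetric] coeff_fejer_poly)
  also have "\<dots> = Re (cinner (poly_op (fejer_poly w N) T x) x)"
    by (simp add: poly_op_eq[OF degree_fejer_poly] cinner_sum_left cinner_scaleC_left)
  finally show ?thesis by simp
qed

text \<open>Multiplication by \<open>z\<close> is a contraction of the one-dimensional Hilbert space
  \<open>complex\<close>, so nonnegativity of its Toeplitz forms already gives positivity on the
  whole closed disc.\<close>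

lemma fejer_poly_nonneg:
  assumes "cmod w = 1" and z: "cmod z \<le> 1"
  shows "0 \<le> Re (poly (fejer_poly w N) z)"
proof -
  define M :: "complex \<Rightarrow> complex" where "M = (\<lambda>u. z * u)"
  have le: "cmod (M u) \<le> cmod u" for u
    using z by (simp add: M_def norm_mult mult_left_le_one_le)
  then have "contraction M"
    unfolding contraction_iff
    by (auto intro!: bounded_clinearI[where K = 1] simp: scaleC_complex_def M_def algebra_simps)
  moreover have "(M ^^ k) 1 = z ^ k" for k
    by (induction k) (simp_all add: M_def)
  then have "poly (fejer_poly w N) z = cinner (poly_op (fejer_poly w N) M 1) 1"
    by (simp add: poly_op_def poly_altdef cinner_complex_def scaleC_complex_def)
  ultimately show ?thesis
    using fejer_poly_op[of M w N 1] toeplitz_form_nonneg assms by simp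
qed

lemma Re_of_real_mult: "Re (complex_of_real r * z) = r * Re z"
  by simp

subsection \<open>Averaging over roots of unity\<close>

text \<open>Discrete replacement for integration over the circle. The bound on \<open>a\<close>
  excludes aliasing, that is, nonzero multiples of \<open>M\<close>.\<close>

lemma sum_cis_roots:
  fixes a :: int
  assumes "\<bar>a\<bar> < int M"
  shows "(\<Sum>l<M. cis (2 * pi * real l / real M * of_int a)) = (if a = 0 then of_nat M else 0)"
proof (cases "a = 0")
  case False
  have M: "real M > 0" using assms by auto
  define r where "r = cis (2 * pi / real M * of_int a)"
  have "cis (2 * pi * real l / real M * of_int a) = r ^ l" for l
    unfolding r_def Complex.DeMoivre by (rule arg_cong[where f = cis]) simp
  then have "(\<Sum>l<M. cis (2 * pi * real l / real M * of_int a)) = (\<Sum>l<M. r ^ l)"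
    by simp
  moreover have "r ^ M = 1"
    unfolding r_def Complex.DeMoivre using M cis_multiple_2pi[of "of_int a"]
    by (simp add: mult.commute mult.left_commute)
  moreover have "r \<noteq> 1"
  proof
    assume "r = 1"
    then obtain n :: int where "2 * pi / real M * of_int a = 2 * pi * of_int n"
      unfolding r_def cis_conv_exp exp_eq_1 by (auto simp: algebra_simps)
    then have "real_of_int a = of_int (n * int M)"
      using M by (simp add: field_simps)
    then have "a = n * int M"
      by (simp only: of_int_eq_iff)
    then have "int M \<le> \<bar>a\<bar>"
      using False by (auto simp: abs_mult)
    with assms show False by simp
  qed
  ultimately show ?thesis
    using False by (simp add: geometric_sum)
qed simp

text \<open>\<open>N\<close> times the Fejer mean at angle \<open>\<theta>\<close> of the Fourier
  series with coefficients \<open>toeplitz_coeff T k x y\<close>. Left as a double sum, it is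
  literally a Toeplitz form when \<open>x = y\<close>.\<close>

definition fejer_form :: "('a::complex_hilbert_space \<Rightarrow> 'a) \<Rightarrow> nat \<Rightarrow> real \<Rightarrow> 'a \<Rightarrow> 'a \<Rightarrow> complex" where
  "fejer_form T N \<theta> x y
    = (\<Sum>i<N. \<Sum>j<N. cis (\<theta> * of_int (int i - int j)) * toeplitz_coeff T (int j - int i) x y)"

lemma toeplitz_coeff_scaleC:
  assumes "bounded_clinear T"
  shows "toeplitz_coeff T k (a *\<^sub>C x) (b *\<^sub>C y) = a * cnj b * toeplitz_coeff T k x y"
  by (simp add: toeplitz_coeff_def bounded_clinear_scaleC[OF bounded_clinear_funpow[OF assms]] cinner_linear)

lemma toeplitz_coeff_sum:
  assumes "bounded_clinear T"
  shows "toeplitz_coeff T k (\<Sum>a\<in>I. f a) (\<Sum>b\<in>J. g b) = (\<Sum>a\<in>I. \<Sum>b\<in>J. toeplitz_coeff T k (f a) (g b))"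
  unfolding toeplitz_coeff_def bounded_clinear_sum[OF bounded_clinear_funpow[OF assms]]
    cinner_sum_left cinner_sum_right by (simp add: sum.swap[of _ I J])

lemma cis_mult_cnj: "cis (t * real a) * cnj (cis (t * real b)) = cis (t * of_int (int a - int b))"
  by (simp add: cis_cnj cis_mult algebra_simps)

lemma cis_minus_mult_cnj:
  "cis (- (t * real a)) * cnj (cis (- (t * real b))) = cis (t * of_int (int b - int a))"
  by (simp add: cis_cnj cis_mult algebra_simps)

lemma cis_mult_of_int: "cis (t * of_int a) * cis (t * of_int b) = cis (t * of_int (a + b))"
  by (simp add: cis_mult distrib_left)

lemma toeplitz_form_cis:
  assumes "bounded_clinear T"
  shows "toeplitz_form T (\<lambda>m. cis \<theta> ^ m *\<^sub>C x) N = fejer_form T N \<theta> x x"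
  unfolding toeplitz_form_def fejer_form_def
  by (simp only: toeplitz_coeff_scaleC[OF assms] Complex.DeMoivre mult.commute[of _ \<theta>] cis_mult_cnj)

lemma fejer_form_sum:
  assumes "bounded_clinear T"
  shows "fejer_form T N \<theta> (\<Sum>a\<in>I. \<alpha> a *\<^sub>C f a) (\<Sum>b\<in>J. \<beta> b *\<^sub>C g b)
    = (\<Sum>a\<in>I. \<Sum>b\<in>J. \<alpha> a * cnj (\<beta> b) * fejer_form T N \<theta> (f a) (g b))"
proof -
  have "fejer_form T N \<theta> (\<Sum>a\<in>I. \<alpha> a *\<^sub>C f a) (\<Sum>b\<in>J. \<beta> b *\<^sub>C g b)
      = (\<Sum>i<N. \<Sum>j<N. \<Sum>a\<in>I. \<Sum>b\<in>J. \<alpha> a * cnj (\<beta> b) *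
          (cis (\<theta> * of_int (int i - int j)) * toeplitz_coeff T (int j - int i) (f a) (g b)))"
    unfolding fejer_form_def toeplitz_coeff_sum[OF assms] toeplitz_coeff_scaleC[OF assms] sum_distrib_left
    by (intro sum.cong refl) (simp add: mult.commute mult.left_commute)
  also have "\<dots> = (\<Sum>a\<in>I. \<Sum>b\<in>J. \<Sum>i<N. \<Sum>j<N. \<alpha> a * cnj (\<beta> b) *
          (cis (\<theta> * of_int (int i - int j)) * toeplitz_coeff T (int j - int i) (f a) (g b)))"
    by (simp only: sum.swap[of _ I "{..<N}"] sum.swap[of _ J "{..<N}"])
  finally show ?thesis
    by (simp only: fejer_form_def sum_distrib_left)
qed

lemma count_diagonal:
  "(\<Sum>i<N. \<Sum>j<N. if int j - int i = n then 1 else (0::real)) = real (N - nat \<bar>n\<bar>)"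
proof -
  have pos: "(\<Sum>i<N. \<Sum>j<N. if int j - int i = int k then 1 else (0::real)) = real (N - k)" for k
  proof -
    have "(\<Sum>j<N. if int j - int i = int k then 1 else (0::real)) = (if i < N - k then 1 else 0)" for i
    proof -
      have "(int j - int i = int k) = (j = i + k)" for j by auto
      then show ?thesis by auto
    qed
    then have "(\<Sum>i<N. \<Sum>j<N. if int j - int i = int k then 1 else (0::real))
        = (\<Sum>i\<in>{..<N} \<inter> {i. i < N - k}. 1)"
      by (simp add: sum.If_cases)
    also have "{..<N} \<inter> {i. i < N - k} = {..<N - k}" by auto
    finally show ?thesis by simp
  qed
  show ?thesis
  proof (cases "n \<ge> 0")
    case True
    then show ?thesis using pos[of "nat n"] by simp
  next
    case False
    have "(int j - int i = n) = (int i - int j = int (nat (- n)))" for i j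
      using False by auto
    then have "(\<Sum>i<N. \<Sum>j<N. if int j - int i = n then 1 else (0::real))
        = (\<Sum>i<N. \<Sum>j<N. if int i - int j = int (nat (- n)) then 1 else 0)"
      by simp
    also have "\<dots> = real (N - nat (- n))"
      by (subst sum.swap) (rule pos)
    finally show ?thesis using False by simp
  qed
qed

text \<open>Fourier inversion on \<open>M\<close> points. The frequencies \<open>n + i - j\<close>
  stay below \<open>M\<close> in modulus, so only the diagonal \<open>j - i = n\<close> survives,
  and it has \<open>N - \<bar>n\<bar>\<close> entries (none if this is negative).\<close>

lemma fejer_form_average:
  assumes "nat \<bar>n\<bar> + N \<le> M"
  shows "(\<Sum>l<M. cis (2 * pi * real l / real M * of_int n) * fejer_form T N (2 * pi * real l / real M) x y)
    = of_nat M * of_nat (N - nat \<bar>n\<bar>) * toeplitz_coeff T n x y"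
proof -
  let ?\<theta> = "\<lambda>l. 2 * pi * real l / real M"
  have "(\<Sum>l<M. cis (?\<theta> l * of_int n) * fejer_form T N (?\<theta> l) x y)
      = (\<Sum>i<N. \<Sum>j<N. \<Sum>l<M. cis (?\<theta> l * of_int (n + (int i - int j))) * toeplitz_coeff T (int j - int i) x y)"
    unfolding fejer_form_def sum_distrib_left
    by (simp only: sum.swap[of _ "{..<N}" "{..<M}"] mult.assoc[symmetric] cis_mult_of_int)
  also have "\<dots> = (\<Sum>i<N. \<Sum>j<N. of_real (if int j - int i = n then 1 else 0) * (of_nat M * toeplitz_coeff T n x y))"
  proof (intro sum.cong refl)
    fix i j assume "i \<in> {..<N}" "j \<in> {..<N}"
    then have small: "\<bar>n + (int i - int j)\<bar> < int M"
      using assms by auto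
    have eq: "n + (int i - int j) = 0 \<longleftrightarrow> int j - int i = n"
      by auto
    show "(\<Sum>l<M. cis (?\<theta> l * of_int (n + (int i - int j))) * toeplitz_coeff T (int j - int i) x y)
        = of_real (if int j - int i = n then 1 else 0) * (of_nat M * toeplitz_coeff T n x y)"
      unfolding sum_distrib_right[symmetric] sum_cis_roots[OF small] eq
      by (cases "int j - int i = n") simp_all
  qed
  also have "\<dots> = of_real (\<Sum>i<N. \<Sum>j<N. if int j - int i = n then 1 else 0) * (of_nat M * toeplitz_coeff T n x y)"
    by (simp only: sum_distrib_right of_real_sum)
  also have "\<dots> = of_nat M * of_nat (N - nat \<bar>n\<bar>) * toeplitz_coeff T n x y"
    unfolding count_diagonal by (simp add: mult.commute mult.left_commute)
  finally show ?thesis .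
qed

text \<open>After division by \<open>N\<close> each Fejer weight tends to \<open>1\<close>, so the
  weights disappear in the limit.\<close>

lemma fejer_weights_limit:
  fixes f g :: "'i \<Rightarrow> real" and k :: "'i \<Rightarrow> nat"
  assumes "\<And>N. N > 0 \<Longrightarrow> (\<Sum>i\<in>I. real (N - k i) * f i) \<le> c * (\<Sum>i\<in>I. real (N - k i) * g i)"
  shows "sum f I \<le> c * sum g I"
proof -
  have lim: "(\<lambda>N. real (N - m) / real N) \<longlonglongrightarrow> 1" for m
  proof -
    have "(\<lambda>N. 1 - real m / real N) \<longlonglongrightarrow> 1 - 0"
      by (intro tendsto_diff tendsto_const lim_const_over_n)
    moreover have "\<forall>\<^sub>F N in sequentially. 1 - real m / real N = real (N - m) / real N"
      using eventually_ge_at_top[of "Suc m"]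
      by eventually_elim (simp add: of_nat_diff field_simps)
    ultimately show ?thesis
      by (simp add: Lim_transform_eventually)
  qed
  have sums: "(\<lambda>N. (\<Sum>i\<in>I. real (N - k i) * u i) / real N) \<longlonglongrightarrow> sum u I" for u :: "'i \<Rightarrow> real"
  proof -
    have "(\<lambda>N. \<Sum>i\<in>I. real (N - k i) / real N * u i) \<longlonglongrightarrow> (\<Sum>i\<in>I. 1 * u i)"
      by (intro tendsto_sum tendsto_mult lim tendsto_const)
    then show ?thesis by (simp add: sum_divide_distrib)
  qed
  show ?thesis
  proof (rule LIMSEQ_le[OF sums[of f] tendsto_mult[OF tendsto_const sums[of g]]])
    show "\<exists>n. \<forall>N\<ge>n. (\<Sum>i\<in>I. real (N - k i) * f i) / real N
        \<le> c * ((\<Sum>i\<in>I. real (N - k i) * g i) / real N)"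
    proof (intro exI[of _ 1] allI impI)
      fix N :: nat assume "1 \<le> N"
      then show "(\<Sum>i\<in>I. real (N - k i) * f i) / real N \<le> c * ((\<Sum>i\<in>I. real (N - k i) * g i) / real N)"
        using assms[of N] by (simp add: divide_right_mono)
    qed
  qed
qed

text \<open>At each angle the Fejer polynomial is tested on the angle-dependent vector
  \<open>\<Sum>a<L. cis (- (\<theta> * real a)) *\<^sub>C h a\<close>. Averaging over the angles
  retrieves all off-diagonal entries of the Toeplitz form, up to Fejer weights.\<close>

lemma Harnack_dominated_imp_toeplitz_form_le:
  assumes T: "contraction T" and T': "contraction T'" and "Harnack_dominated T T'"
  obtains c where "c \<ge> 1" and "\<And>h N. Re (toeplitz_form T h N) \<le> c * Re (toeplitz_form T' h N)"
proof -
  note bT = contraction_bounded_clinear[OF T] and bT' = contraction_bounded_clinear[OF T']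
  obtain c where c: "c \<ge> 1" and dom: "\<And>p x. (\<forall>z. cmod z \<le> 1 \<longrightarrow> Re (poly p z) \<ge> 0) \<Longrightarrow>
      Re (cinner (poly_op p T x) x) \<le> c * Re (cinner (poly_op p T' x) x)"
    using assms(3) unfolding Harnack_dominated_iff[OF bT bT'] by blast
  have fejer: "Re (fejer_form T N \<theta> x x) \<le> c * Re (fejer_form T' N \<theta> x x)" for N \<theta> x
    using dom[of "fejer_poly (cis \<theta>) N" x] fejer_poly_nonneg[of "cis \<theta>"]
    by (simp add: fejer_poly_op T T' toeplitz_form_cis bT bT')
  have "Re (toeplitz_form T h L) \<le> c * Re (toeplitz_form T' h L)" for h L
  proof -
    let ?f = "\<lambda>T (a, b). Re (toeplitz_coeff T (int b - int a) (h a) (h b))"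
    let ?k = "\<lambda>(a, b). nat \<bar>int b - int a\<bar>"
    let ?I = "{..<L} \<times> {..<L}"
    have avg: "(\<Sum>l<M. Re (fejer_form A N (2 * pi * real l / real M)
          (\<Sum>a<L. cis (- (2 * pi * real l / real M * real a)) *\<^sub>C h a)
          (\<Sum>b<L. cis (- (2 * pi * real l / real M * real b)) *\<^sub>C h b)))
        = real M * (\<Sum>i\<in>?I. real (N - ?k i) * ?f A i)"
      if A: "bounded_clinear A" and M: "M = N + L" for A N M
    proof -
      let ?\<theta> = "\<lambda>l. 2 * pi * real l / real M"
      have "(\<Sum>l<M. fejer_form A N (?\<theta> l) (\<Sum>a<L. cis (- (?\<theta> l * real a)) *\<^sub>C h a)
            (\<Sum>b<L. cis (- (?\<theta> l * real b)) *\<^sub>C h b))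
          = (\<Sum>l<M. \<Sum>a<L. \<Sum>b<L. cis (?\<theta> l * of_int (int b - int a)) * fejer_form A N (?\<theta> l) (h a) (h b))"
        unfolding fejer_form_sum[OF A]
        by (simp only: cis_minus_mult_cnj)
      also have "\<dots> = (\<Sum>a<L. \<Sum>b<L. \<Sum>l<M. cis (?\<theta> l * of_int (int b - int a)) * fejer_form A N (?\<theta> l) (h a) (h b))"
        by (simp only: sum.swap[of _ "{..<L}" "{..<M}"])
      also have "\<dots> = (\<Sum>a<L. \<Sum>b<L. of_nat M * of_nat (N - nat \<bar>int b - int a\<bar>) * toeplitz_coeff A (int b - int a) (h a) (h b))"
      proof (intro sum.cong refl)
        fix a b assume "a \<in> {..<L}" "b \<in> {..<L}"
        then have "nat \<bar>int b - int a\<bar> + N \<le> M"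
          using M by auto
        then show "(\<Sum>l<M. cis (?\<theta> l * of_int (int b - int a)) * fejer_form A N (?\<theta> l) (h a) (h b))
            = of_nat M * of_nat (N - nat \<bar>int b - int a\<bar>) * toeplitz_coeff A (int b - int a) (h a) (h b)"
          by (rule fejer_form_average)
      qed
      finally have "(\<Sum>l<M. fejer_form A N (?\<theta> l) (\<Sum>a<L. cis (- (?\<theta> l * real a)) *\<^sub>C h a)
            (\<Sum>b<L. cis (- (?\<theta> l * real b)) *\<^sub>C h b))
          = (\<Sum>a<L. \<Sum>b<L. of_real (real M * real (N - nat \<bar>int b - int a\<bar>)) * toeplitz_coeff A (int b - int a) (h a) (h b))"
        by simp
      then have "Re (\<Sum>l<M. fejer_form A N (?\<theta> l) (\<Sum>a<L. cis (- (?\<theta> l * real a)) *\<^sub>C h a)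
            (\<Sum>b<L. cis (- (?\<theta> l * real b)) *\<^sub>C h b))
          = (\<Sum>a<L. \<Sum>b<L. real M * real (N - nat \<bar>int b - int a\<bar>) * Re (toeplitz_coeff A (int b - int a) (h a) (h b)))"
        by (simp only: Re_sum Re_of_real_mult)
      then show ?thesis
        by (simp add: sum.cartesian_product sum_distrib_left mult.assoc split_def)
    qed
    have "sum (?f T) ?I \<le> c * sum (?f T') ?I"
    proof (rule fejer_weights_limit[where k = ?k])
      fix N :: nat assume "N > 0"
      \<comment> \<open>The frequencies \<open>b - a\<close> are below \<open>L\<close> in modulus,
        so \<open>N + L\<close> points average without aliasing.\<close>
      define M where "M = N + L"
      have "real M * (\<Sum>i\<in>?I. real (N - ?k i) * ?f T i) \<le> c * (real M * (\<Sum>i\<in>?I. real (N - ?k i) * ?f T' i))"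
        unfolding avg[OF bT M_def, symmetric] avg[OF bT' M_def, symmetric]
        by (subst sum_distrib_left) (intro sum_mono fejer)
      then have "real M * (\<Sum>i\<in>?I. real (N - ?k i) * ?f T i) \<le> real M * (c * (\<Sum>i\<in>?I. real (N - ?k i) * ?f T' i))"
        by (simp add: mult.left_commute)
      moreover have "real M > 0" using \<open>N > 0\<close> by (simp add: M_def)
      ultimately show "(\<Sum>i\<in>?I. real (N - ?k i) * ?f T i) \<le> c * (\<Sum>i\<in>?I. real (N - ?k i) * ?f T' i)"
        by (simp only: mult_le_cancel_left_pos)
    qed
    then show ?thesis
      by (simp add: toeplitz_form_def sum.cartesian_product split_def)
  qed
  with c show thesis by (rule that)
qed

text \<open>The numbers \<open>Re (poly p (cis \<theta>)) \<ge> 0\<close> serve as weights when the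
  inequality between Fejer forms is averaged over the angles; the average produces the quadratic
  form of \<open>poly_op p\<close>, again up to Fejer weights.\<close>

lemma Harnack_dominatedI:
  assumes T: "contraction T" and T': "contraction T'" and c: "c \<ge> 1"
    and le: "\<And>h N. Re (toeplitz_form T h N) \<le> c * Re (toeplitz_form T' h N)"
  shows "Harnack_dominated T T'"
proof -
  note bT = contraction_bounded_clinear[OF T] and bT' = contraction_bounded_clinear[OF T']
  have "Re (cinner (poly_op p T x) x) \<le> c * Re (cinner (poly_op p T' x) x)"
    if p: "\<forall>z. cmod z \<le> 1 \<longrightarrow> Re (poly p z) \<ge> 0" for p x
  proof -
    let ?d = "degree p"
    let ?f = "\<lambda>T n. Re (coeff p n * cinner ((T ^^ n) x) x)"
    have avg: "(\<Sum>l<M. Re (poly p (cis (2 * pi * real l / real M))) * Re (fejer_form A N (2 * pi * real l / real M) x x))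
        = real M * (\<Sum>n\<le>?d. real (N - n) * ?f A n)" if A: "contraction A" and M: "M = N + ?d" for A N M
    proof -
      let ?\<theta> = "\<lambda>l. 2 * pi * real l / real M"
      \<comment> \<open>The diagonal form is real, so \<open>Re\<close> can be taken after
        multiplying by the full value of \<open>p\<close>, which has only frequencies
        \<open>0\<close> to \<open>degree p\<close>.\<close>
      have "fejer_form A N \<theta> x x = of_real (Re (fejer_form A N \<theta> x x))" for \<theta>
        using toeplitz_form_real[OF A, of "\<lambda>m. cis \<theta> ^ m *\<^sub>C x" N]
        by (simp only: toeplitz_form_cis[OF contraction_bounded_clinear[OF A]])
      then have "Re (poly p (cis (?\<theta> l))) * Re (fejer_form A N (?\<theta> l) x x)
          = Re (poly p (cis (?\<theta> l)) * fejer_form A N (?\<theta> l) x x)" for l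
        by (metis Re_of_real_mult mult.commute)
      then have "(\<Sum>l<M. Re (poly p (cis (?\<theta> l))) * Re (fejer_form A N (?\<theta> l) x x))
          = Re (\<Sum>l<M. poly p (cis (?\<theta> l)) * fejer_form A N (?\<theta> l) x x)"
        by (simp only: Re_sum)
      also have "(\<Sum>l<M. poly p (cis (?\<theta> l)) * fejer_form A N (?\<theta> l) x x)
          = (\<Sum>l<M. \<Sum>n\<le>?d. coeff p n * (cis (?\<theta> l * of_int (int n)) * fejer_form A N (?\<theta> l) x x))"
        unfolding poly_altdef sum_distrib_right
        by (simp only: Complex.DeMoivre of_int_of_nat_eq mult.assoc mult.commute[of "real _" "_ / real M"])
      also have "\<dots> = (\<Sum>n\<le>?d. coeff p n * (\<Sum>l<M. cis (?\<theta> l * of_int (int n)) * fejer_form A N (?\<theta> l) x x))"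
        by (subst sum.swap) (simp only: sum_distrib_left)
      also have "\<dots> = (\<Sum>n\<le>?d. coeff p n * (of_nat M * of_nat (N - n) * cinner ((A ^^ n) x) x))"
      proof (intro sum.cong refl)
        fix n assume "n \<in> {..?d}"
        then have "nat \<bar>int n\<bar> + N \<le> M" using M by auto
        from fejer_form_average[OF this, of A x x]
        show "coeff p n * (\<Sum>l<M. cis (?\<theta> l * of_int (int n)) * fejer_form A N (?\<theta> l) x x)
            = coeff p n * (of_nat M * of_nat (N - n) * cinner ((A ^^ n) x) x)"
          by (simp add: toeplitz_coeff_def)
      qed
      also have "\<dots> = (\<Sum>n\<le>?d. of_real (real M * real (N - n)) * (coeff p n * cinner ((A ^^ n) x) x))"
        by (simp add: mult.commute mult.left_commute)
      also have "Re \<dots> = (\<Sum>n\<le>?d. real M * real (N - n) * ?f A n)"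
        by (simp only: Re_sum Re_of_real_mult)
      finally show ?thesis
        by (simp only: sum_distrib_left mult.assoc)
    qed
    have "(\<Sum>n\<le>?d. ?f T n) \<le> c * (\<Sum>n\<le>?d. ?f T' n)"
    proof (rule fejer_weights_limit[where k = "\<lambda>n. n"])
      fix N :: nat assume "N > 0"
      define M where "M = N + ?d"
      have "Re (fejer_form T N \<theta> x x) \<le> c * Re (fejer_form T' N \<theta> x x)" for \<theta>
        using le[of "\<lambda>m. cis \<theta> ^ m *\<^sub>C x" N] by (simp add: toeplitz_form_cis bT bT')
      then have "real M * (\<Sum>n\<le>?d. real (N - n) * ?f T n) \<le> c * (real M * (\<Sum>n\<le>?d. real (N - n) * ?f T' n))"
        unfolding avg[OF T M_def, symmetric] avg[OF T' M_def, symmetric]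
        using p by (subst sum_distrib_left, intro sum_mono) (simp add: mult.left_commute[of c] mult_left_mono)
      then have "real M * (\<Sum>n\<le>?d. real (N - n) * ?f T n) \<le> real M * (c * (\<Sum>n\<le>?d. real (N - n) * ?f T' n))"
        by (simp only: mult.left_commute)
      moreover have "real M > 0" using \<open>N > 0\<close> by (simp add: M_def)
      ultimately show "(\<Sum>n\<le>?d. real (N - n) * ?f T n) \<le> c * (\<Sum>n\<le>?d. real (N - n) * ?f T' n)"
        by (simp only: mult_le_cancel_left_pos)
    qed
    then show ?thesis
      by (simp add: poly_op_def cinner_sum_left cinner_scaleC_left)
  qed
  then show ?thesis
    unfolding Harnack_dominated_iff[OF bT bT'] using c by blast
qed

section \<open>Mixed domination\<close>

definition mixed_dominated :: "('a::complex_hilbert_space \<Rightarrow> 'a) \<Rightarrow> ('a \<Rightarrow> 'a) \<Rightarrow> bool" where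
  "mixed_dominated T T' \<longleftrightarrow> (\<exists>C\<ge>0. \<forall>x y.
    cmod (cinner (T x - T' x) y) \<le> C * norm (defect_op T' x) * norm (defect_op (cadjoint T) y))"

text \<open>If \<open>a\<close> exceeded the bound, then \<open>b \<le> a\<close>, so
  \<open>b\<^sup>2\<close> may be replaced by \<open>a * b\<close> and a factor \<open>a\<close>
  cancels.\<close>

lemma le_mult_if_quadratic_le:
  fixes a b C :: real
  assumes "0 \<le> a" and "0 \<le> b" and "0 \<le> C" and "0 \<le> E" and "a\<^sup>2 \<le> E * b\<^sup>2 + 2 * C * a * b"
  shows "a \<le> (1 + E + 2 * C) * b"
proof (rule ccontr)
  assume "\<not> ?thesis"
  then have gt: "(1 + E + 2 * C) * b < a" by simp
  then have "b \<le> a"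
    using assms mult_right_mono[of 1 "1 + E + 2 * C" b] by simp
  have "a > 0"
    using gt assms by (smt (verit) mult_nonneg_nonneg)
  have "E * b\<^sup>2 \<le> E * (a * b)"
    using assms \<open>b \<le> a\<close> by (intro mult_left_mono) (simp_all add: power2_eq_square mult_right_mono)
  with assms(5) have "a * a \<le> a * ((E + 2 * C) * b)"
    by (simp add: power2_eq_square algebra_simps)
  then have "a \<le> (E + 2 * C) * b"
    using \<open>a > 0\<close> by simp
  then show False
    using gt assms(2) by (simp add: algebra_simps)
qed

text \<open>The two squared defects differ by \<open>2 * Re (cinner (T x - T' x) (T x))\<close> and
  the square of \<open>norm (T x - T' x)\<close>. The choice \<open>y = T x\<close> is decisive:
  \<open>D_T* T x = T D_T x\<close> turns the adjoint defect into at most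
  \<open>norm (defect_op T x)\<close>, which leaves a quadratic inequality in each
  direction.\<close>

lemma mixed_dominated_defect_le:
  assumes T: "contraction T" and T': "contraction T'" and "mixed_dominated T T'"
  obtains K where "K \<ge> 0" and "\<And>x. norm (defect_op T x) \<le> K * norm (defect_op T' x)"
    and "\<And>x. norm (defect_op T' x) \<le> K * norm (defect_op T x)"
proof -
  obtain C where C: "C \<ge> 0"
    and M: "\<And>x y. cmod (cinner (T x - T' x) y) \<le> C * norm (defect_op T' x) * norm (defect_op (cadjoint T) y)"
    using assms(3) unfolding mixed_dominated_def by blast
  define K where "K = 1 + (1 + C\<^sup>2) + 2 * C"
  have "norm (defect_op T x) \<le> K * norm (defect_op T' x) \<and> norm (defect_op T' x) \<le> K * norm (defect_op T x)" for x
  proof -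
    let ?a = "norm (defect_op T' x)" and ?b = "norm (defect_op T x)"
    have "cmod (cinner (T x - T' x) (T x)) \<le> C * ?a * norm (defect_op (cadjoint T) (T x))"
      by (rule M)
    also have "\<dots> \<le> C * ?a * ?b"
      using C by (intro mult_left_mono defect_op_cadjoint_norm_le[OF T]) simp
    finally have cross: "\<bar>Re (cinner (T x - T' x) (T x))\<bar> \<le> C * ?a * ?b"
      using abs_Re_le_cmod order_trans by blast
    have "norm (T x - T' x) \<le> C * ?a"
    proof (rule norm_le_if_cinner_le)
      fix y
      have "C * ?a * norm (defect_op (cadjoint T) y) \<le> C * ?a * norm y"
        using C by (intro mult_left_mono defect_op_norm_le cadjoint_contraction T) simp
      then show "cmod (cinner (T x - T' x) y) \<le> C * ?a * norm y"
        using M[of x y] by linarith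
    qed (simp add: C)
    then have G: "(norm (T x - T' x))\<^sup>2 \<le> C\<^sup>2 * ?a\<^sup>2"
      by (metis norm_ge_zero power_mono power_mult_distrib)
    have "(norm (T' x))\<^sup>2 = (norm (T x))\<^sup>2 - 2 * Re (cinner (T x - T' x) (T x)) + (norm (T x - T' x))\<^sup>2"
      using norm_diff_sqr[of "T x - T' x" "T x"] by (simp add: norm_minus_commute)
    then have eq: "?a\<^sup>2 = ?b\<^sup>2 + 2 * Re (cinner (T x - T' x) (T x)) - (norm (T x - T' x))\<^sup>2"
      by (simp add: defect_op_norm[OF T] defect_op_norm[OF T'])
    have "?a\<^sup>2 \<le> ?b\<^sup>2 + 2 * (C * ?a * ?b)"
      using eq cross zero_le_power2[of "norm (T x - T' x)"] by linarith
    also have "\<dots> \<le> (1 + C\<^sup>2) * ?b\<^sup>2 + 2 * C * ?a * ?b"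
      by (simp add: distrib_right)
    finally have 1: "?a\<^sup>2 \<le> (1 + C\<^sup>2) * ?b\<^sup>2 + 2 * C * ?a * ?b" .
    have "?b\<^sup>2 \<le> ?a\<^sup>2 + 2 * (C * ?a * ?b) + C\<^sup>2 * ?a\<^sup>2"
      using eq cross G by linarith
    then have "?b\<^sup>2 \<le> (1 + C\<^sup>2) * ?a\<^sup>2 + 2 * C * ?b * ?a"
      by (simp add: algebra_simps)
    with 1 show ?thesis
      unfolding K_def using C by (intro conjI le_mult_if_quadratic_le) simp_all
  qed
  moreover have "K \<ge> 0" using C by (simp add: K_def)
  ultimately show thesis using that by blast
qed

text \<open>Douglas factorization twice: first \<open>U = D_A V\<close>, then the adjoint of
  \<open>V\<close> through \<open>D_B\<close>, using that \<open>V\<close> is bounded by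
  \<open>C * norm (defect_op B x)\<close>.\<close>

lemma factor_through_defects:
  fixes A B U :: "'a::complex_hilbert_space \<Rightarrow> 'a"
  assumes A: "contraction A" and B: "contraction B" and U: "bounded_clinear U" and C: "C \<ge> 0"
    and bound: "\<And>x y. cmod (cinner (U x) y) \<le> C * norm (defect_op B x) * norm (defect_op A y)"
  obtains W where "bounded_clinear W" and "W ` defect_space B \<subseteq> defect_space A"
    and "\<And>x. U x = defect_op A (W (defect_op B x))"
proof -
  obtain V where V: "bounded_clinear V" "\<And>x. U x = defect_op A (V x)"
    "\<And>x. norm (V x) \<le> C * norm (defect_op B x)" "range V \<subseteq> closure (range (defect_op A))"
  proof (rule factor_through_selfadjoint[OF defect_op_bounded_clinear[OF A] defect_op_symmetric[OF A] U])
    show "C * norm (defect_op B x) \<le> C * norm x" for x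
      using C by (intro mult_left_mono defect_op_norm_le B)
  qed (use bound C in auto)
  obtain Z where Z: "bounded_clinear Z" "\<And>y. cadjoint V y = defect_op B (Z y)"
  proof (rule factor_through_selfadjoint[OF defect_op_bounded_clinear[OF B] defect_op_symmetric[OF B]
        cadjoint_bounded_clinear[OF V(1)]])
    show "cmod (cinner (cadjoint V y) x) \<le> C * norm y * norm (defect_op B x)" for x y
      using norm_cinner_le[of y "V x"] mult_left_mono[OF V(3)[of x] norm_ge_zero[of y]]
      by (simp add: cinner_cadjoint'[OF V(1)] mult.commute mult.left_commute)
  qed (use C in auto)
  define W where "W = cadjoint Z"
  have bW: "bounded_clinear W"
    unfolding W_def by (rule cadjoint_bounded_clinear[OF Z(1)])
  have VW: "V x = W (defect_op B x)" for x
    by (rule cinner_eqI)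
      (simp add: W_def cinner_cadjoint[OF V(1)] cinner_cadjoint'[OF Z(1)] Z(2) defect_op_symmetric[OF B])
  \<comment> \<open>On the range of \<open>defect_op B\<close> the values of \<open>W\<close> are
    values of \<open>V\<close>; continuity carries the inclusion over to the closure.\<close>
  have "W ` closure (range (defect_op B)) \<subseteq> closure (W ` range (defect_op B))"
    using bounded_clinear_imp_bounded_linear[OF bW]
    by (intro closure_bounded_linear_image_subset)
  also have "\<dots> \<subseteq> closure (closure (range (defect_op A)))"
    using V(4) by (intro closure_mono) (auto simp flip: VW)
  finally have "W ` defect_space B \<subseteq> defect_space A"
    by (simp add: defect_space_def)
  with bW V(2) VW show thesis
    using that by simp
qed

text \<open>The difference \<open>d\<close> of the two recursions obeys
  \<open>d_(m+1) = T d_m + D_T* (V s'_m)\<close>, the first output of the Julia operator. Its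
  isometry is an energy balance that telescopes over \<open>m\<close>.\<close>

lemma horner_diff_norm:
  assumes T: "contraction T"
    and V: "\<And>x. T x - T' x = defect_op (cadjoint T) (V x)"
  shows "(norm (horner T h N - horner T' h N))\<^sup>2
      + (\<Sum>m<N. (norm (defect_op T (horner T h m - horner T' h m) - cadjoint T (V (horner T' h m))))\<^sup>2)
    = (\<Sum>m<N. (norm (V (horner T' h m)))\<^sup>2)"
proof (induction N)
  case (Suc N)
  have "horner T h (Suc N) - horner T' h (Suc N)
      = T (horner T h N - horner T' h N) + (T (horner T' h N) - T' (horner T' h N))"
    by (simp add: bounded_clinear_diff[OF contraction_bounded_clinear[OF T]])
  then have "horner T h (Suc N) - horner T' h (Suc N)
      = T (horner T h N - horner T' h N) + defect_op (cadjoint T) (V (horner T' h N))"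
    by (simp only: V)
  then show ?case
    using Julia_operator_norm[OF T, of "horner T h N - horner T' h N" "V (horner T' h N)"] Suc
    by simp
qed simp

lemma sum_three_squares_le: "(a + b + c :: real)\<^sup>2 \<le> 3 * (a\<^sup>2 + b\<^sup>2 + c\<^sup>2)"
proof -
  have "3 * (a\<^sup>2 + b\<^sup>2 + c\<^sup>2) - (a + b + c)\<^sup>2 = (a - b)\<^sup>2 + (b - c)\<^sup>2 + (a - c)\<^sup>2"
    by (simp add: power2_eq_square algebra_simps)
  then show ?thesis
    by (metis diff_ge_0_iff_ge add_nonneg_nonneg zero_le_power2)
qed

lemma mixed_dominated_imp_Harnack_dominated:
  assumes T: "contraction T" and T': "contraction T'" and M: "mixed_dominated T T'"
  shows "Harnack_dominated T T'"
proof -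
  obtain K where K: "\<And>x. norm (defect_op T x) \<le> K * norm (defect_op T' x)"
    by (rule mixed_dominated_defect_le[OF T T' M], rule that)
  obtain V C where C: "C \<ge> 0" and V: "\<And>x. T x - T' x = defect_op (cadjoint T) (V x)"
    and V_le: "\<And>x. norm (V x) \<le> C * norm (defect_op T' x)"
  proof -
    obtain C where "C \<ge> 0" and "\<And>x y. cmod (cinner (T x - T' x) y)
        \<le> C * norm (defect_op T' x) * norm (defect_op (cadjoint T) y)"
      using M unfolding mixed_dominated_def by blast
    then obtain W where W: "bounded_clinear W"
      "\<And>x. T x - T' x = defect_op (cadjoint T) (W (defect_op T' x))"
      using factor_through_defects[OF cadjoint_contraction[OF T] T' bounded_clinear_diff_op[OF
          contraction_bounded_clinear[OF T] contraction_bounded_clinear[OF T']]] by metis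
    obtain K where "K \<ge> 0" "\<And>x. norm (W x) \<le> K * norm x"
      using bounded_clinear_pos_bound[OF W(1)] by blast
    then show thesis
      using that[of K "\<lambda>x. W (defect_op T' x)"] W(2) by blast
  qed
  \<comment> \<open>The \<open>2\<close> is from splitting the final state into two terms, the
    \<open>3\<close> from splitting each defect into three; one \<open>C\<^sup>2\<close> comes from
    \<open>cadjoint T (V s')\<close>, the other from the energy balance, which absorbs both the
    final difference and the \<open>?e\<close> terms.\<close>
  define c where "c = 2 + 3 * (K\<^sup>2 + 2 * C\<^sup>2)"
  show ?thesis
  proof (rule Harnack_dominatedI[OF T T'])
    show "c \<ge> 1" by (simp add: c_def add_increasing2)
    fix h N
    let ?s = "horner T h" and ?s' = "horner T' h"
    let ?d = "\<lambda>m. norm (defect_op T' (?s' m))"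
    let ?e = "\<lambda>m. norm (defect_op T (?s m - ?s' m) - cadjoint T (V (?s' m)))"
    have u: "(norm (V (?s' m)))\<^sup>2 \<le> C\<^sup>2 * (?d m)\<^sup>2" for m
      using power_mono[OF V_le[of "?s' m"] norm_ge_zero, of 2] by (simp add: power_mult_distrib)
    have step: "(norm (defect_op T (?s m)))\<^sup>2 \<le> 3 * (K\<^sup>2 + C\<^sup>2) * (?d m)\<^sup>2 + 3 * (?e m)\<^sup>2" for m
    proof -
      \<comment> \<open>The splitting isolates \<open>?e m\<close>, the second Julia output, whose
        squares are summable by the energy balance.\<close>
      have "defect_op T (?s m) = defect_op T (?s' m)
          + (defect_op T (?s m - ?s' m) - cadjoint T (V (?s' m))) + cadjoint T (V (?s' m))"
        by (simp add: bounded_clinear_diff[OF defect_op_bounded_clinear[OF T]])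
      then have "norm (defect_op T (?s m))
          \<le> norm (defect_op T (?s' m)) + ?e m + norm (cadjoint T (V (?s' m)))"
        by (metis norm_triangle_mono order_refl)
      also have "\<dots> \<le> K * ?d m + ?e m + C * ?d m"
        using K[of "?s' m"] V_le[of "?s' m"] contraction_norm_le[OF cadjoint_contraction[OF T], of "V (?s' m)"]
        by linarith
      finally have "(norm (defect_op T (?s m)))\<^sup>2 \<le> (K * ?d m + ?e m + C * ?d m)\<^sup>2"
        by (rule power_mono) simp
      also have "\<dots> \<le> 3 * ((K * ?d m)\<^sup>2 + (?e m)\<^sup>2 + (C * ?d m)\<^sup>2)"
        by (rule sum_three_squares_le)
      finally show ?thesis
        by (simp add: power_mult_distrib algebra_simps)
    qed
    have diff: "(norm (?s N - ?s' N))\<^sup>2 + (\<Sum>m<N. (?e m)\<^sup>2) \<le> C\<^sup>2 * (\<Sum>m<N. (?d m)\<^sup>2)"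
      unfolding horner_diff_norm[OF T V] sum_distrib_left
      by (intro sum_mono u)
    have "norm (?s N) \<le> norm (?s' N) + norm (?s N - ?s' N) + 0"
      using norm_triangle_ineq[of "?s' N" "?s N - ?s' N"] by simp
    then have "(norm (?s N))\<^sup>2 \<le> (norm (?s' N) + norm (?s N - ?s' N))\<^sup>2"
      by (intro power_mono) simp_all
    also have "\<dots> \<le> 2 * (norm (?s' N))\<^sup>2 + 2 * (norm (?s N - ?s' N))\<^sup>2"
      using sum_squares_bound[of "norm (?s' N)" "norm (?s N - ?s' N)"] by (simp add: power2_sum)
    finally have end_term: "(norm (?s N))\<^sup>2 \<le> 2 * (norm (?s' N))\<^sup>2 + 2 * (norm (?s N - ?s' N))\<^sup>2" .
    have "(\<Sum>m<N. (norm (defect_op T (?s m)))\<^sup>2)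
        \<le> (\<Sum>m<N. 3 * (K\<^sup>2 + C\<^sup>2) * (?d m)\<^sup>2 + 3 * (?e m)\<^sup>2)"
      by (intro sum_mono step)
    also have "\<dots> = 3 * (K\<^sup>2 + C\<^sup>2) * (\<Sum>m<N. (?d m)\<^sup>2) + 3 * (\<Sum>m<N. (?e m)\<^sup>2)"
      by (simp only: sum.distrib sum_distrib_left)
    finally have "Re (toeplitz_form T h N) \<le> 2 * (norm (?s' N))\<^sup>2 + 3 * (K\<^sup>2 + C\<^sup>2) * (\<Sum>m<N. (?d m)\<^sup>2)
        + 3 * (C\<^sup>2 * (\<Sum>m<N. (?d m)\<^sup>2))"
      using end_term diff zero_le_power2[of "norm (?s N - ?s' N)"]
      unfolding toeplitz_form_eq[OF T] Re_complex_of_real by linarith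
    also have "\<dots> = 2 * (norm (?s' N))\<^sup>2 + 3 * (K\<^sup>2 + 2 * C\<^sup>2) * (\<Sum>m<N. (?d m)\<^sup>2)"
      by (simp add: algebra_simps)
    also have "\<dots> \<le> c * (norm (?s' N))\<^sup>2 + c * (\<Sum>m<N. (?d m)\<^sup>2)"
      unfolding c_def by (intro add_mono mult_right_mono) (simp_all add: sum_nonneg)
    also have "\<dots> = c * Re (toeplitz_form T' h N)"
      by (simp add: toeplitz_form_eq[OF T'] distrib_left)
    finally show "Re (toeplitz_form T h N) \<le> c * Re (toeplitz_form T' h N)" .
  qed
qed

section \<open>The row operator bound\<close>

text \<open>The operator \<open>B\<close> of condition (v), tested on finitely supported sequences in the range of
  \<open>defect_op T'\<close>.\<close>

definition row_bounded :: "('a::complex_hilbert_space \<Rightarrow> 'a) \<Rightarrow> ('a \<Rightarrow> 'a) \<Rightarrow> real \<Rightarrow> bool" where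
  "row_bounded T T' c \<longleftrightarrow> (\<forall>n x. (norm (\<Sum>k<n. (T ^^ k) (T (x k) - T' (x k))))\<^sup>2
    \<le> c * (\<Sum>k<n. (norm (defect_op T' (x k)))\<^sup>2))"

text \<open>The input \<open>h\<close> steers the \<open>T'\<close>-recursion through prescribed
  states and back to zero, so its Toeplitz form consists of defects alone. The final state of the
  \<open>T\<close>-recursion under the same input is the row sum.\<close>

lemma Harnack_dominated_imp_row_bounded:
  assumes T: "contraction T" and T': "contraction T'" and "Harnack_dominated T T'"
  obtains c where "c \<ge> 0" and "row_bounded T T' c"
proof -
  note bT = contraction_bounded_clinear[OF T] and bT' = contraction_bounded_clinear[OF T']
  obtain c where c: "c \<ge> 1"
    and le: "\<And>h N. Re (toeplitz_form T h N) \<le> c * Re (toeplitz_form T' h N)"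
    using Harnack_dominated_imp_toeplitz_form_le[OF assms] by blast
  have "(norm (\<Sum>k<n. (T ^^ k) (T (x k) - T' (x k))))\<^sup>2 \<le> c * (\<Sum>k<n. (norm (defect_op T' (x k)))\<^sup>2)"
    for n and x :: "nat \<Rightarrow> 'a"
  proof -
    \<comment> \<open>The state at time \<open>m\<close> reaches the end with the power
      \<open>T^(n-m)\<close>, hence the reversed order. The zero at time \<open>0\<close> matches
      the start of \<open>horner\<close>, the zero at time \<open>Suc n\<close> removes the final
      term for \<open>T'\<close>.\<close>
    define s where "s m = (if m = 0 \<or> m > n then 0 else x (n - m))" for m
    define h where "h m = s (Suc m) - T' (s m)" for m
    define g where "g m = T (s m) - T' (s m)" for m
    have hT': "horner T' h m = s m" for m
      by (induction m) (simp_all add: h_def s_def)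
    \<comment> \<open>Since \<open>h m = s (Suc m) - T (s m) + g m\<close>, the deviation from the
      prescribed states is the recursion driven by \<open>g\<close>.\<close>
    have hT: "horner T h m = s m + horner T g m" for m
      by (induction m) (simp_all add: h_def g_def bounded_clinear_simps[OF bT], simp add: s_def)
    have "horner T h (Suc n) = g n + T (horner T g n)"
      unfolding hT by (simp add: s_def)
    also have "\<dots> = (\<Sum>i<Suc n. (T ^^ (n - i)) (g i))"
      by (simp add: horner_sum[OF bT] add.commute)
    also have "\<dots> = (\<Sum>m<n. (T ^^ (n - Suc m)) (g (Suc m)))"
      using bounded_clinear_zero[OF bounded_clinear_funpow[OF bT]]
      by (subst sum.lessThan_Suc_shift) (simp add: g_def s_def bounded_clinear_zero[OF bT] bounded_clinear_zero[OF bT'])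
    also have "\<dots> = (\<Sum>m<n. (T ^^ (n - Suc m)) (T (x (n - Suc m)) - T' (x (n - Suc m))))"
      by (simp add: g_def s_def)
    also have "\<dots> = (\<Sum>k<n. (T ^^ k) (T (x k) - T' (x k)))"
      by (rule sum.nat_diff_reindex)
    finally have end_T: "horner T h (Suc n) = (\<Sum>k<n. (T ^^ k) (T (x k) - T' (x k)))" .
    have "(\<Sum>m<Suc n. (norm (defect_op T' (s m)))\<^sup>2) = (\<Sum>m<n. (norm (defect_op T' (x (n - Suc m))))\<^sup>2)"
      by (subst sum.lessThan_Suc_shift)
        (simp add: s_def bounded_clinear_zero[OF defect_op_bounded_clinear[OF T']])
    also have "\<dots> = (\<Sum>k<n. (norm (defect_op T' (x k)))\<^sup>2)"
      by (rule sum.nat_diff_reindex)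
    finally have "Re (toeplitz_form T' h (Suc n)) = (\<Sum>k<n. (norm (defect_op T' (x k)))\<^sup>2)"
      unfolding toeplitz_form_eq[OF T'] hT' Re_complex_of_real by (simp add: s_def)
    moreover have "(norm (horner T h (Suc n)))\<^sup>2 \<le> Re (toeplitz_form T h (Suc n))"
      unfolding toeplitz_form_eq[OF T] Re_complex_of_real by (simp add: sum_nonneg del: sum.lessThan_Suc horner.simps)
    ultimately show ?thesis
      using le[of h "Suc n"] end_T by simp
  qed
  with c show thesis
    by (intro that[of c]) (auto simp: row_bounded_def)
qed

section \<open>Consequences of the commutation relations\<close>

locale commuting_contractions =
  fixes T T' :: "'a::complex_hilbert_space \<Rightarrow> 'a"
  assumes T: "contraction T" and T': "contraction T'"
    and quasi_normal_adj: "quasi_normal (cadjoint T)"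
    and comm: "T \<circ> T' = T' \<circ> T"
    and comm_P: "T \<circ> (cadjoint T' \<circ> T') = (cadjoint T' \<circ> T') \<circ> T"
    and comm_Q: "T' \<circ> (T \<circ> cadjoint T) = (T \<circ> cadjoint T) \<circ> T'"
begin

abbreviation "T_adj \<equiv> cadjoint T"

abbreviation "T'_adj \<equiv> cadjoint T'"

lemma bT: "bounded_clinear T" and bT': "bounded_clinear T'"
  and T_adj: "contraction T_adj" and T'_adj: "contraction T'_adj"
  and bT_adj: "bounded_clinear T_adj" and bT'_adj: "bounded_clinear T'_adj"
  and adj_adj: "cadjoint T_adj = T" "cadjoint T'_adj = T'"
  using T T' by (simp_all add: contraction_bounded_clinear cadjoint_contraction cadjoint_cadjoint
      cadjoint_bounded_clinear)

definition Q :: "'a \<Rightarrow> 'a" where "Q x = T (T_adj x)"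

lemma bQ: "bounded_clinear Q"
  unfolding Q_def[abs_def] by (rule bounded_clinear_compose[OF bT bT_adj])

lemma Q_symmetric: "cinner (Q x) y = cinner x (Q y)"
  by (simp add: Q_def cinner_cadjoint[OF bT] cinner_cadjoint'[OF bT])

lemma Q_norm_le: "norm (Q x) \<le> norm x"
  using contraction_norm_le[OF T, of "T_adj x"] contraction_norm_le[OF T_adj, of x] by (simp add: Q_def)

lemma T_T': "T (T' x) = T' (T x)"
  using fun_cong[OF comm, of x] by simp

lemma T_adj_Q: "T_adj (Q x) = Q (T_adj x)"
  using fun_cong[OF quasi_normal_adj[unfolded quasi_normal_def], of x] by (simp add: Q_def adj_adj)

lemma T_Q: "T (Q x) = Q (T x)"
proof (rule cinner_eqI)
  fix y
  have "cinner (T (Q x)) y = cinner x (Q (T_adj y))"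
    by (simp add: cinner_cadjoint[OF bT] Q_symmetric)
  also have "\<dots> = cinner (Q (T x)) y"
    by (simp add: T_adj_Q[symmetric] cinner_cadjoint[OF bT, symmetric] Q_symmetric)
  finally show "cinner (T (Q x)) y = cinner (Q (T x)) y" .
qed

lemma T'_Q: "T' (Q x) = Q (T' x)"
  using fun_cong[OF comm_Q, of x] by (simp add: Q_def)

lemma T'_adj_Q: "T'_adj (Q x) = Q (T'_adj x)"
  by (rule cinner_eqI) (simp add: cinner_cadjoint'[OF bT'] Q_symmetric T'_Q)

lemma T_P: "T (T'_adj (T' x)) = T'_adj (T' (T x))"
  using fun_cong[OF comm_P, of x] by simp

lemma T_adj_P: "T_adj (T'_adj (T' x)) = T'_adj (T' (T_adj x))"
  by (rule cinner_eqI)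
    (simp add: cinner_cadjoint'[OF bT] cinner_cadjoint'[OF bT'] cinner_cadjoint[OF bT'] T_P)

definition D :: "'a \<Rightarrow> 'a" where "D = defect_op T_adj"

definition D' :: "'a \<Rightarrow> 'a" where "D' = defect_op T'"

lemma bD: "bounded_clinear D" and bD': "bounded_clinear D'"
  unfolding D_def D'_def by (simp_all add: defect_op_bounded_clinear T_adj T')

lemma D_commute:
  assumes "bounded_clinear A" and "\<And>x. A (Q x) = Q (A x)"
  shows "A (D x) = D (A x)"
  unfolding D_def using assms by (intro defect_op_commute T_adj) (simp_all add: Q_def adj_adj)

lemma D'_commute:
  assumes "bounded_clinear A" and "\<And>x. A (T'_adj (T' x)) = T'_adj (T' (A x))"
  shows "A (D' x) = D' (A x)"
  unfolding D'_def using assms by (intro defect_op_commute T')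

lemma T_adj_D: "T_adj (D x) = D (T_adj x)"
  by (intro D_commute bT_adj T_adj_Q)

lemma T'_adj_D: "T'_adj (D x) = D (T'_adj x)"
  by (intro D_commute bT'_adj T'_adj_Q)

lemma T_adj_D': "T_adj (D' x) = D' (T_adj x)"
  by (intro D'_commute bT_adj T_adj_P)

text \<open>\<open>T\<close> and its adjoint both commute with \<open>T'* T'\<close>, hence so does
  \<open>Q\<close>; the commutation then passes to the two square roots in turn.\<close>

lemma D'_D: "D' (D x) = D (D' x)"
proof (intro D_commute bD')
  show "D' (Q x) = Q (D' x)" for x
    by (rule D'_commute[symmetric, OF bQ]) (simp add: Q_def T_adj_P T_P)
qed

lemma D_D: "D (D x) = x - Q x"
  unfolding D_def by (simp add: defect_op_square[OF T_adj] Q_def adj_adj)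

lemma D_norm: "(norm (D x))\<^sup>2 = (norm x)\<^sup>2 - (norm (T_adj x))\<^sup>2"
  unfolding D_def by (rule defect_op_norm[OF T_adj])

definition G :: "'a \<Rightarrow> 'a" where "G x = T x - T' x"

lemma bG: "bounded_clinear G"
  unfolding G_def[abs_def] by (intro bounded_clinear_diff_op bT bT')

lemma T_G: "T (G x) = G (T x)"
  by (simp add: G_def bounded_clinear_diff[OF bT] T_T')

lemma T_pow_G: "(T ^^ k) (G x) = G ((T ^^ k) x)"
  by (induction k arbitrary: x) (simp_all add: T_G)

lemma G_Q: "G (Q x) = Q (G x)"
  by (simp add: G_def bounded_clinear_diff[OF bQ] T_Q T'_Q)

lemma T_pow_T_adj_pow: "(T ^^ k) ((T_adj ^^ k) x) = (Q ^^ k) x"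
proof (induction k arbitrary: x)
  case (Suc k)
  have Q_pow: "(T ^^ k) (Q y) = Q ((T ^^ k) y)" for k y
    by (induction k arbitrary: y) (simp_all add: T_Q)
  have "(T ^^ Suc k) ((T_adj ^^ Suc k) x) = (T ^^ k) (Q ((T_adj ^^ k) x))"
    unfolding funpow_Suc_right[of k T] by (simp add: Q_def)
  then show ?case
    by (simp add: Q_pow Suc)
qed simp

text \<open>
  With \<open>A = T T*\<close> and \<open>B = T* T\<close> quasi-normality gives
  \<open>(A - B) B = 0\<close>, so only the component of \<open>x\<close> in the kernel of \<open>B\<close> contributes to the
  quadratic form of \<open>A - B\<close>.
\<close>

lemma hyponormal: "norm (T x) \<le> norm (T_adj x)"
proof -
  define B where "B x = T_adj (T x)" for x
  have bB: "bounded_clinear B"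
    unfolding B_def[abs_def] by (rule bounded_clinear_compose[OF bT_adj bT])
  have B_sym: "cinner (B x) y = cinner x (B y)" for x y
    by (simp add: B_def cinner_cadjoint[OF bT] cinner_cadjoint'[OF bT])
  have QB: "Q (B x) = B (B x)" for x
    using T_adj_Q[of "T x"] by (simp add: B_def Q_def)
  have "cmod (cinner (B y) x) \<le> norm x * norm (B y)" for y
    using norm_cinner_le[of "B y" x] by (simp add: mult.commute)
  \<comment> \<open>\<open>u\<close> is the orthogonal projection of \<open>x\<close> onto the
    closure of the range of \<open>B\<close>, and \<open>x - u\<close> is the component in the
    kernel.\<close>
  then obtain u where u: "u \<in> closure (range B)" "\<And>y. cinner (B y) u = cinner (B y) x"
    using crepresentation_on_range[OF bB, of "\<lambda>y. cinner (B y) x" "norm x"]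
    by (auto simp: bounded_clinear_simps[OF bB] cinner_linear)
  define v where "v = x - u"
  have "B v = 0"
  proof (rule cinner_eqI)
    fix y
    show "cinner (B v) y = cinner 0 y"
      using u(2)[of y] by (subst cinner_commute) (simp add: v_def B_sym[symmetric] cinner_diff_right)
  qed
  have "Q u = B u"
  proof -
    from u(1) obtain d where d: "\<And>n. d n \<in> range B" "d \<longlonglongrightarrow> u"
      unfolding closure_sequential by blast
    have "Q (d n) = B (d n)" for n
      using d(1)[of n] QB by auto
    then have "(\<lambda>n. B (d n)) \<longlonglongrightarrow> Q u"
      using bounded_clinear_tendsto[OF bQ d(2)] by simp
    moreover have "(\<lambda>n. B (d n)) \<longlonglongrightarrow> B u"
      by (rule bounded_clinear_tendsto[OF bB d(2)])
    ultimately show ?thesis by (rule LIMSEQ_unique)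
  qed
  have x: "x = u + v" by (simp add: v_def)
  have "cinner (Q x) x - cinner (B x) x = cinner (Q v) x"
    by (subst (1 3) x) (simp add: bounded_clinear_add[OF bQ] bounded_clinear_add[OF bB] \<open>Q u = B u\<close>
        \<open>B v = 0\<close> cinner_add_left)
  also have "\<dots> = cinner v (Q u + Q v)"
    by (simp add: Q_symmetric x bounded_clinear_add[OF bQ])
  also have "\<dots> = cinner v (Q v)"
    using B_sym[of v u] by (simp add: \<open>Q u = B u\<close> \<open>B v = 0\<close> cinner_add_right)
  finally have "of_real ((norm (T_adj x))\<^sup>2) - of_real ((norm (T x))\<^sup>2) = (of_real ((norm (T_adj v))\<^sup>2) :: complex)"
    by (simp add: Q_def B_def cinner_cadjoint[OF bT] cinner_cadjoint'[OF bT] cinner_self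
        cinner_cadjoint'[OF bT, of v, symmetric] del: of_real_power)
  then have "(norm (T_adj x))\<^sup>2 - (norm (T x))\<^sup>2 = (norm (T_adj v))\<^sup>2"
    by (simp only: of_real_diff[symmetric] of_real_eq_iff)
  then show ?thesis
    by (metis diff_ge_0_iff_ge norm_ge_zero power2_le_imp_le zero_le_power2)
qed

text \<open>Since \<open>D\<close> commutes with \<open>T'_adj\<close> and with the defect operator
  of \<open>T'_adj\<close>, the square of \<open>norm (D y)\<close> splits into those of
  \<open>T'_adj (D y) = D (T'_adj y)\<close> and of a vector bounded by
  \<open>norm (defect_op T'_adj y)\<close>. For the first part, hyponormality replaces
  \<open>D\<close> by \<open>defect_op T\<close>, the hypothesis replaces that by \<open>D'\<close>,
  and \<open>D' T'_adj\<close> equals \<open>T'_adj\<close> after the adjoint defect of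
  \<open>T'\<close>.\<close>

lemma adjoint_defect_le:
  assumes K: "K \<ge> 0" "\<And>x. norm (defect_op T x) \<le> K * norm (D' x)"
  shows "(norm (D y))\<^sup>2 \<le> (1 + K\<^sup>2) * (norm (defect_op T'_adj y))\<^sup>2"
proof -
  let ?N = "\<lambda>y. norm (defect_op T'_adj y)"
  have "norm (D (T'_adj y)) \<le> norm (defect_op T (T'_adj y))"
    by (rule power2_le_imp_le) (simp_all add: D_norm defect_op_norm[OF T] power_mono hyponormal)
  also have "\<dots> \<le> K * norm (D' (T'_adj y))" by (rule K)
  also have "D' (T'_adj y) = T'_adj (defect_op T'_adj y)"
    unfolding D'_def by (rule defect_op_intertwine'[OF T', symmetric])
  also have "K * norm \<dots> \<le> K * ?N y"
    by (intro mult_left_mono contraction_norm_le[OF T'_adj] K)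
  finally have "(norm (D (T'_adj y)))\<^sup>2 \<le> (K * ?N y)\<^sup>2"
    by (rule power_mono) simp
  moreover have "(norm (D (T'_adj y)))\<^sup>2 = (norm (D y))\<^sup>2 - (?N (D y))\<^sup>2"
    by (simp add: T'_adj_D[symmetric] defect_op_norm[OF T'_adj])
  moreover have "?N (D y) \<le> ?N y"
  proof -
    have "defect_op T'_adj (Q x) = Q (defect_op T'_adj x)" for x
      by (rule defect_op_commute[OF T'_adj bQ, symmetric]) (simp add: adj_adj T'_Q T'_adj_Q)
    then have "defect_op T'_adj (D y) = D (defect_op T'_adj y)"
      by (intro D_commute defect_op_bounded_clinear T'_adj)
    then show ?thesis
      unfolding D_def by (simp add: defect_op_norm_le[OF T_adj])
  qed
  then have "(?N (D y))\<^sup>2 \<le> (?N y)\<^sup>2"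
    by (rule power_mono) simp
  ultimately show ?thesis
    unfolding power_mult_distrib distrib_right by linarith
qed

text \<open>The row sum of \<open>n + 1\<close> equal vectors has squared norm of order
  \<open>(n + 1)^2\<close>, against a bound of order \<open>n + 1\<close>. The resulting decay also
  covers vectors on which \<open>Q\<close> acts as the identity.\<close>

lemma row_bounded_G_Q_pow:
  assumes row: "row_bounded T T' c" and c: "c \<ge> 0"
  shows "(norm (G ((Q ^^ n) a)))\<^sup>2 * real (Suc n) \<le> c * (norm a)\<^sup>2"
proof -
  \<comment> \<open>The choice makes \<open>T^k G x_k\<close> independent of \<open>k\<close>: the
    missing powers of \<open>Q\<close> are put in beforehand.\<close>
  define x where "x k = (T_adj ^^ k) ((Q ^^ (n - k)) a)" for k
  have "(T ^^ k) (G (x k)) = G ((Q ^^ n) a)" if "k \<le> n" for k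
  proof -
    have "(T ^^ k) (G (x k)) = G ((Q ^^ k) ((Q ^^ (n - k)) a))"
      by (simp add: T_pow_G x_def T_pow_T_adj_pow)
    also have "(Q ^^ k) ((Q ^^ (n - k)) a) = (Q ^^ n) a"
      using that by (metis comp_apply funpow_add le_add_diff_inverse)
    finally show ?thesis .
  qed
  then have "(\<Sum>k<Suc n. (T ^^ k) (G (x k))) = real (Suc n) *\<^sub>R G ((Q ^^ n) a)"
    by (simp add: sum_constant_scaleR del: sum.lessThan_Suc)
  moreover have "(norm (\<Sum>k<Suc n. (T ^^ k) (G (x k))))\<^sup>2 \<le> c * (\<Sum>k<Suc n. (norm (D' (x k)))\<^sup>2)"
    using row unfolding row_bounded_def G_def D'_def by blast
  moreover have "norm (D' (x k)) \<le> norm a" for k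
  proof -
    have "norm ((T_adj ^^ k) y) \<le> norm y" for k y
      by (induction k) (use contraction_norm_le[OF T_adj] order_trans in \<open>simp, fastforce\<close>)
    moreover have "norm ((Q ^^ k) y) \<le> norm y" for k y
      by (induction k) (use Q_norm_le order_trans in \<open>simp, fastforce\<close>)
    moreover have "norm (D' (x k)) \<le> norm (x k)"
      unfolding D'_def by (rule defect_op_norm_le[OF T'])
    ultimately show ?thesis
      unfolding x_def by (meson order_trans)
  qed
  then have "(\<Sum>k<Suc n. (norm (D' (x k)))\<^sup>2) \<le> (\<Sum>k<Suc n. (norm a)\<^sup>2)"
    by (intro sum_mono power_mono) simp_all
  then have "c * (\<Sum>k<Suc n. (norm (D' (x k)))\<^sup>2) \<le> c * (real (Suc n) * (norm a)\<^sup>2)"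
    using c by (intro mult_left_mono) (simp_all del: sum.lessThan_Suc)
  ultimately have "(real (Suc n) * norm (G ((Q ^^ n) a)))\<^sup>2 \<le> c * (real (Suc n) * (norm a)\<^sup>2)"
    by (simp del: sum.lessThan_Suc)
  then have "real (Suc n) * ((norm (G ((Q ^^ n) a)))\<^sup>2 * real (Suc n)) \<le> real (Suc n) * (c * (norm a)\<^sup>2)"
    by (simp only: power2_eq_square ac_simps)
  then show ?thesis
    by (simp only: mult_le_cancel_left_pos of_nat_0_less_iff zero_less_Suc)
qed

lemma T_adj_pow_defect_sum: "(\<Sum>k<n. (norm (D ((T_adj ^^ k) w)))\<^sup>2) = (norm w)\<^sup>2 - (norm ((T_adj ^^ n) w))\<^sup>2"
  by (induction n) (simp_all add: D_norm)

text \<open>The row estimate on \<open>x_k = T*^k D x\<close> bounds \<open>G s\<close> with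
  \<open>s = (\<Sum>k<n. Q^k) D x\<close>. One more \<open>D\<close>, which commutes with
  \<open>G\<close>, completes the geometric sum: \<open>D s = x - Q^n x\<close>. This
  \<open>D\<close> then moves onto \<open>y\<close>.\<close>

lemma row_bounded_imp_bound:
  assumes c: "c \<ge> 0" and row: "row_bounded T T' c"
  shows "cmod (cinner (G (x - (Q ^^ n) x)) y) \<le> sqrt c * norm (D' x) * norm (D y)"
proof -
  have T_adj_pow: "(T_adj ^^ k) (D z) = D ((T_adj ^^ k) z)" "(T_adj ^^ k) (D' z) = D' ((T_adj ^^ k) z)" for k z
    by (induction k arbitrary: z) (simp_all add: T_adj_D T_adj_D')
  define s where "s = (\<Sum>k<n. (Q ^^ k) (D x))"
  have "(\<Sum>k<n. (T ^^ k) (G ((T_adj ^^ k) (D x)))) = G s"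
    by (simp add: T_pow_G T_pow_T_adj_pow s_def bounded_clinear_sum[OF bG])
  then have "(norm (G s))\<^sup>2 \<le> c * (\<Sum>k<n. (norm (D' ((T_adj ^^ k) (D x))))\<^sup>2)"
    using row[unfolded row_bounded_def, rule_format, of "\<lambda>k. (T_adj ^^ k) (D x)" n]
    by (simp add: G_def D'_def)
  \<comment> \<open>Exchanging the roles of \<open>D\<close> and \<open>D'\<close> turns the sum
    into a telescoping one started at \<open>D' x\<close>, so the bound does not depend on
    \<open>n\<close>.\<close>
  also have "(\<Sum>k<n. (norm (D' ((T_adj ^^ k) (D x))))\<^sup>2) = (\<Sum>k<n. (norm (D ((T_adj ^^ k) (D' x))))\<^sup>2)"
    by (simp add: T_adj_pow D'_D)
  also have "\<dots> \<le> (norm (D' x))\<^sup>2"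
    unfolding T_adj_pow_defect_sum by simp
  finally have "(norm (G s))\<^sup>2 \<le> (sqrt c * norm (D' x))\<^sup>2"
    using c by (simp add: power_mult_distrib mult_left_mono)
  then have Gs: "norm (G s) \<le> sqrt c * norm (D' x)"
    by (rule power2_le_imp_le) (simp add: c)
  have QD: "(Q ^^ k) (D z) = D ((Q ^^ k) z)" for k z
    by (induction k) (simp_all add: D_commute[OF bQ])
  have "D s = (\<Sum>k<n. (Q ^^ k) (x - Q x))"
    by (simp add: s_def bounded_clinear_sum[OF bD] QD[symmetric] D_D)
  also have "\<dots> = x - (Q ^^ n) x"
    by (induction n) (simp_all add: bounded_clinear_diff[OF bounded_clinear_funpow[OF bQ]] funpow_swap1)
  finally have "G (x - (Q ^^ n) x) = D (G s)"
    by (simp add: D_commute[OF bG G_Q, symmetric])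
  then have "cinner (G (x - (Q ^^ n) x)) y = cinner (G s) (D y)"
    by (simp add: D_def defect_op_symmetric[OF T_adj])
  then show ?thesis
    using norm_cinner_le[of "G s" "D y"] mult_right_mono[OF Gs norm_ge_zero[of "D y"]] by simp
qed

lemma row_bounded_imp_mixed_dominated:
  assumes c: "c \<ge> 0" and row: "row_bounded T T' c"
  shows "mixed_dominated T T'"
proof -
  have "cmod (cinner (G x) y) \<le> sqrt c * norm (D' x) * norm (D y)" for x y
  proof -
    have "(\<lambda>n. G ((Q ^^ n) x)) \<longlonglongrightarrow> 0"
    proof -
      let ?r = "\<lambda>n. sqrt (c * (norm x)\<^sup>2 * inverse (real (Suc n)))"
      have "norm (G ((Q ^^ n) x)) \<le> ?r n" for n
        using row_bounded_G_Q_pow[OF row c, of n x]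
        by (intro real_le_rsqrt) (simp add: field_simps del: of_nat_Suc)
      then have "\<forall>\<^sub>F n in sequentially. norm (G ((Q ^^ n) x)) \<le> ?r n"
        by (intro always_eventually allI)
      moreover have "?r \<longlonglongrightarrow> sqrt (c * (norm x)\<^sup>2 * 0)"
        by (intro tendsto_real_sqrt tendsto_mult tendsto_const LIMSEQ_inverse_real_of_nat)
      then have "?r \<longlonglongrightarrow> 0" by (simp only: mult_zero_right real_sqrt_zero)
      ultimately show ?thesis by (rule Lim_null_comparison)
    qed
    then have "(\<lambda>n. G x - G ((Q ^^ n) x)) \<longlonglongrightarrow> G x - 0"
      by (intro tendsto_diff tendsto_const)
    then have "(\<lambda>n. G (x - (Q ^^ n) x)) \<longlonglongrightarrow> G x"
      by (simp add: bounded_clinear_diff[OF bG])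
    then have "(\<lambda>n. cmod (cinner (G (x - (Q ^^ n) x)) y)) \<longlonglongrightarrow> cmod (cinner (G x) y)"
      by (intro tendsto_norm bounded_linear.tendsto[OF bounded_linear_cinner_left])
    then show ?thesis
      using row_bounded_imp_bound[OF c row] by (intro LIMSEQ_le_const2) blast+
  qed
  then show ?thesis
    unfolding mixed_dominated_def G_def D_def D'_def using c by (intro exI[of _ "sqrt c"]) simp
qed

end

section \<open>Shmul'yan domination\<close>

lemma Shmulyan_dominates_bound:
  assumes A: "contraction A" and "Shmulyan_dominates A B"
  obtains C where "C \<ge> 0"
    and "\<And>x y. cmod (cinner (B x - A x) y) \<le> C * norm (defect_op A x) * norm (defect_op (cadjoint A) y)"
proof -
  obtain X where X: "bounded_clinear_on (defect_space A) X"
    and B: "\<And>x. B x = A x + defect_op (cadjoint A) (X (defect_op A x))"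
    using assms(2) unfolding Shmulyan_dominates_def by blast
  obtain K where K: "K \<ge> 0" "\<And>x. x \<in> defect_space A \<Longrightarrow> norm (X x) \<le> K * norm x"
    using bounded_clinear_on_pos_bound[OF X] by blast
  have "cmod (cinner (B x - A x) y) \<le> K * norm (defect_op A x) * norm (defect_op (cadjoint A) y)" for x y
  proof -
    have "cinner (B x - A x) y = cinner (X (defect_op A x)) (defect_op (cadjoint A) y)"
      by (simp add: B defect_op_symmetric[OF cadjoint_contraction[OF A]])
    then show ?thesis
      using norm_cinner_le[of "X (defect_op A x)" "defect_op (cadjoint A) y"]
        mult_right_mono[OF K(2)[OF defect_op_in_defect_space[of A x]] norm_ge_zero[of "defect_op (cadjoint A) y"]]
      by simp
  qed
  with K(1) show thesis by (rule that)
qed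

lemma Shmulyan_dominatesI:
  fixes A B :: "'a::complex_hilbert_space \<Rightarrow> 'a"
  assumes A: "contraction A" and B: "bounded_clinear B" and "C \<ge> 0"
    and "\<And>x y. cmod (cinner (B x - A x) y) \<le> C * norm (defect_op A x) * norm (defect_op (cadjoint A) y)"
  shows "Shmulyan_dominates A B"
proof -
  obtain W where W: "bounded_clinear W" "W ` defect_space A \<subseteq> defect_space (cadjoint A)"
    "\<And>x. B x - A x = defect_op (cadjoint A) (W (defect_op A x))"
    by (rule factor_through_defects[OF cadjoint_contraction[OF A] A
          bounded_clinear_diff_op[OF B contraction_bounded_clinear[OF A]] assms(3,4)], rule that)
  have "bounded_clinear_on (defect_space A) W"
    using W(1) unfolding bounded_clinear_on_def by blast
  moreover have "B x = A x + defect_op (cadjoint A) (W (defect_op A x))" for x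
    unfolding W(3)[symmetric] by simp
  ultimately show ?thesis
    unfolding Shmulyan_dominates_def using W(2) by blast
qed

text \<open>In the expansion of \<open>(norm (B x))\<^sup>2\<close> around \<open>A x\<close> the
  square of the difference has a favourable sign and is dropped; the cross term is the bound at
  \<open>y = A x\<close>, where the adjoint defect is at most
  \<open>norm (defect_op A x)\<close>.\<close>

lemma Shmulyan_dominates_defect_le:
  assumes A: "contraction A" and B: "contraction B" and "Shmulyan_dominates A B"
  obtains K where "K \<ge> 0" and "\<And>x. norm (defect_op B x) \<le> K * norm (defect_op A x)"
proof -
  obtain C where C: "C \<ge> 0"
    and M: "\<And>x y. cmod (cinner (B x - A x) y) \<le> C * norm (defect_op A x) * norm (defect_op (cadjoint A) y)"
    using Shmulyan_dominates_bound[OF A assms(3)] by blast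
  have "norm (defect_op B x) \<le> (1 + 2 * C) * norm (defect_op A x)" for x
  proof (rule power2_le_imp_le)
    let ?a = "norm (defect_op A x)"
    have "cmod (cinner (B x - A x) (A x)) \<le> C * ?a * norm (defect_op (cadjoint A) (A x))"
      by (rule M)
    also have "\<dots> \<le> C * ?a * ?a"
      using C by (intro mult_left_mono defect_op_cadjoint_norm_le[OF A]) simp
    finally have "- Re (cinner (B x - A x) (A x)) \<le> C * ?a * ?a"
      using abs_Re_le_cmod[of "cinner (B x - A x) (A x)"] by linarith
    moreover have "(norm (B x))\<^sup>2 = (norm (B x - A x))\<^sup>2 + 2 * Re (cinner (B x - A x) (A x)) + (norm (A x))\<^sup>2"
      using norm_add_sqr[of "B x - A x" "A x"] by simp
    ultimately have "(norm (defect_op B x))\<^sup>2 \<le> ?a\<^sup>2 + 2 * (C * ?a * ?a)"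
      unfolding defect_op_norm[OF A] defect_op_norm[OF B]
      using zero_le_power2[of "norm (B x - A x)"] by linarith
    also have "\<dots> = (1 + 2 * C) * ?a\<^sup>2"
      by (simp add: power2_eq_square algebra_simps)
    \<comment> \<open>Squaring a constant that is at least \<open>1\<close> avoids a square root in
      the result.\<close>
    also have "\<dots> \<le> (1 + 2 * C) * ((1 + 2 * C) * ?a\<^sup>2)"
      using C mult_right_mono[of 1 "1 + 2 * C" "?a\<^sup>2"] by (intro mult_left_mono) simp_all
    finally show "(norm (defect_op B x))\<^sup>2 \<le> ((1 + 2 * C) * ?a)\<^sup>2"
      by (simp add: power2_eq_square algebra_simps)
  qed (use C in simp)
  with C show thesis by (intro that[of "1 + 2 * C"]) simp_all
qed

lemma mixed_dominatedI:
  assumes "C \<ge> 0" and "K \<ge> 0"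
    and bound: "\<And>x y. cmod (cinner (T x - T' x) y) \<le> C * norm (defect_op T x) * norm (defect_op (cadjoint T) y)"
    and K: "\<And>x. norm (defect_op T x) \<le> K * norm (defect_op T' x)"
  shows "mixed_dominated T T'"
proof -
  have "cmod (cinner (T x - T' x) y) \<le> (C * K) * norm (defect_op T' x) * norm (defect_op (cadjoint T) y)" for x y
  proof -
    have "C * norm (defect_op T x) * norm (defect_op (cadjoint T) y)
        \<le> C * (K * norm (defect_op T' x)) * norm (defect_op (cadjoint T) y)"
      using assms(1) by (intro mult_right_mono mult_left_mono K) simp_all
    then show ?thesis
      using bound[of x y] by (simp add: mult.assoc)
  qed
  then show ?thesis
    unfolding mixed_dominated_def using assms(1,2) by (intro exI[of _ "C * K"]) simp
qed

text \<open>Domination by \<open>T\<close> gives the bound with both defects of \<open>T\<close>;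
  domination by \<open>T'\<close> exchanges \<open>D_T\<close> for \<open>D_T'\<close>.\<close>

lemma Shmulyan_equivalent_imp_mixed_dominated:
  assumes T: "contraction T" and T': "contraction T'" and "Shmulyan_equivalent T T'"
  shows "mixed_dominated T T'"
proof -
  have dom: "Shmulyan_dominates T T'" "Shmulyan_dominates T' T"
    using assms(3) unfolding Shmulyan_equivalent_def by blast+
  obtain C where "C \<ge> 0"
    "\<And>x y. cmod (cinner (T' x - T x) y) \<le> C * norm (defect_op T x) * norm (defect_op (cadjoint T) y)"
    using Shmulyan_dominates_bound[OF T dom(1)] by blast
  moreover have "cmod (cinner (T x - T' x) y) = cmod (cinner (T' x - T x) y)" for x y
    by (simp add: cinner_diff_left norm_minus_commute)
  moreover obtain K where "K \<ge> 0" "\<And>x. norm (defect_op T x) \<le> K * norm (defect_op T' x)"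
    using Shmulyan_dominates_defect_le[OF T' T dom(2)] by blast
  ultimately show ?thesis
    using mixed_dominatedI[of C K T T'] by simp
qed

section \<open>Contractive analytic functions\<close>

lemma schwarz_pick_right_half_plane_strict:
  assumes f: "f holomorphic_on ball 0 1" and pos: "\<And>z. z \<in> ball 0 1 \<Longrightarrow> 0 < Re (f z)"
    and z: "cmod z < 1"
  shows "cmod (f z - f 0) \<le> cmod z * cmod (f z + cnj (f 0))"
proof -
  have ne: "f u + cnj (f 0) \<noteq> 0" if "cmod u < 1" for u
    using pos[of u] pos[of 0] that by (auto simp: complex_eq_iff)
  have lt: "cmod (f u - f 0) < cmod (f u + cnj (f 0))" if "cmod u < 1" for u
  proof (rule power2_less_imp_less)
    have "0 < Re (f u) * Re (f 0)"
      using pos[of u] pos[of 0] that by simp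
    then show "(cmod (f u - f 0))\<^sup>2 < (cmod (f u + cnj (f 0)))\<^sup>2"
      unfolding cmod_power2 by (simp add: power2_eq_square algebra_simps)
  qed simp
  \<comment> \<open>The Cayley transform sending the right half plane to the disc and
    \<open>f 0\<close> to the centre.\<close>
  define w where "w u = (f u - f 0) / (f u + cnj (f 0))" for u
  have "w holomorphic_on ball 0 1"
    unfolding w_def using ne by (intro holomorphic_intros f) auto
  moreover have "w 0 = 0" by (simp add: w_def)
  moreover have "cmod (w u) < 1" if "cmod u < 1" for u
    using lt[OF that] ne[OF that] by (simp add: w_def norm_divide)
  ultimately have "cmod (w z) \<le> cmod z"
    using Schwarz_Lemma(1) z by blast
  then show ?thesis
    using ne[OF z] by (simp add: w_def norm_divide divide_le_eq)
qed

lemma schwarz_pick_right_half_plane: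
  assumes f: "f holomorphic_on ball 0 1" and nonneg: "\<And>z. z \<in> ball 0 1 \<Longrightarrow> 0 \<le> Re (f z)"
    and z: "cmod z < 1"
  shows "cmod (f z - f 0) \<le> cmod z * cmod (f z + cnj (f 0))"
proof (rule field_le_epsilon)
  fix e :: real assume e: "e > 0"
  \<comment> \<open>The shift makes the real part strictly positive. It cancels in
    \<open>g z - g 0\<close> and adds up to \<open>e\<close> in
    \<open>g z + cnj (g 0)\<close>.\<close>
  define g where "g u = f u + of_real (e / 2)" for u
  have "g holomorphic_on ball 0 1"
    unfolding g_def by (intro holomorphic_intros f)
  moreover have "0 < Re (g u)" if "u \<in> ball 0 1" for u
    using nonneg[OF that] e by (simp add: g_def)
  ultimately have "cmod (g z - g 0) \<le> cmod z * cmod (g z + cnj (g 0))"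
    using schwarz_pick_right_half_plane_strict z by blast
  also have "g z + cnj (g 0) = (f z + cnj (f 0)) + of_real e"
    by (simp add: g_def complex_eq_iff)
  also have "cmod z * cmod \<dots> \<le> cmod z * (cmod (f z + cnj (f 0)) + e)"
    using e norm_triangle_ineq[of "f z + cnj (f 0)" "of_real e"] by (intro mult_left_mono) simp_all
  also have "\<dots> \<le> cmod z * cmod (f z + cnj (f 0)) + e"
    using z e mult_right_mono[of "cmod z" 1 e] by (simp add: distrib_left)
  finally show "cmod (f z - f 0) \<le> cmod z * cmod (f z + cnj (f 0)) + e"
    by (simp add: g_def)
qed

lemma harnack_holomorphic:
  assumes f: "f holomorphic_on ball 0 1" and nonneg: "\<And>z. z \<in> ball 0 1 \<Longrightarrow> 0 \<le> Re (f z)"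
    and z: "cmod z < 1"
  shows "cmod (f z - f 0) \<le> 2 * cmod z / (1 - cmod z) * Re (f 0)"
    and "Re (f 0) \<le> (1 + cmod z) / (1 - cmod z) * Re (f z)"
proof -
  define r where "r = cmod z"
  have r: "0 \<le> r" "r < 1" using z by (simp_all add: r_def)
  have le: "cmod (f z - f 0) \<le> r * cmod (f z + cnj (f 0))"
    unfolding r_def by (rule schwarz_pick_right_half_plane[OF assms])
  have eq: "f z + cnj (f 0) = (f z - f 0) + of_real (2 * Re (f 0))"
    by (simp add: complex_eq_iff)
  have "cmod (f z + cnj (f 0)) \<le> cmod (f z - f 0) + 2 * Re (f 0)"
    unfolding eq using norm_triangle_ineq[of "f z - f 0" "of_real (2 * Re (f 0))"] nonneg[of 0]
    by (simp del: of_real_mult)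
  then have "cmod (f z - f 0) \<le> r * (cmod (f z - f 0) + 2 * Re (f 0))"
    using le mult_left_mono[OF _ r(1)] order_trans by blast
  then show "cmod (f z - f 0) \<le> 2 * cmod z / (1 - cmod z) * Re (f 0)"
    using r unfolding r_def[symmetric] by (simp add: field_simps)
  define a a0 b where "a = Re (f z)" and "a0 = Re (f 0)" and "b = Im (f z) - Im (f 0)"
  have nn: "0 \<le> a" "0 \<le> a0"
    using nonneg[of z] nonneg[of 0] z by (simp_all add: a_def a0_def)
  have "(cmod (f z - f 0))\<^sup>2 \<le> (r * cmod (f z + cnj (f 0)))\<^sup>2"
    using le by (rule power_mono) simp
  then have "(a - a0)\<^sup>2 + b\<^sup>2 \<le> r\<^sup>2 * ((a + a0)\<^sup>2 + b\<^sup>2)"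
    by (simp add: cmod_power2 power_mult_distrib a_def a0_def b_def)
  \<comment> \<open>The imaginary parts can be discarded since \<open>r < 1\<close>, leaving an
    inequality between the real parts alone.\<close>
  moreover have "r\<^sup>2 * b\<^sup>2 \<le> 1 * b\<^sup>2"
    using r by (intro mult_right_mono) (simp_all add: power_le_one)
  ultimately have "(a - a0)\<^sup>2 \<le> r\<^sup>2 * (a + a0)\<^sup>2"
    unfolding distrib_left[of "r\<^sup>2"] by linarith
  then have "(a - a0)\<^sup>2 \<le> (r * (a + a0))\<^sup>2"
    by (simp only: power_mult_distrib)
  then have "\<bar>a - a0\<bar> \<le> r * (a + a0)"
    using r nn by (simp add: abs_le_square_iff[symmetric])
  then have "a0 * (1 - r) \<le> (1 + r) * a"
    by (simp add: algebra_simps abs_le_iff)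
  then show "Re (f 0) \<le> (1 + cmod z) / (1 - cmod z) * Re (f z)"
    using r unfolding r_def[symmetric] by (simp add: a_def a0_def field_simps)
qed

lemma contractive_analytic_cinner_holomorphic:
  assumes "contractive_analytic F"
  shows "(\<lambda>z. cinner (F z x) y) holomorphic_on ball 0 1"
proof (rule holomorphic_onI)
  fix z :: complex assume z: "z \<in> ball 0 1"
  from assms z obtain L where L: "bounded_clinear L"
    and lim: "((\<lambda>w. onorm (\<lambda>x. inverse (w - z) *\<^sub>C (F w x - F z x) - L x)) \<longlongrightarrow> 0) (at z)"
    unfolding contractive_analytic_def by blast
  have F: "bounded_clinear (F w)" if "w \<in> ball 0 1" for w
    using assms that unfolding contractive_analytic_def contraction_def by blast
  have "((\<lambda>w. (cinner (F w x) y - cinner (F z x) y) / (w - z) - cinner (L x) y) \<longlongrightarrow> 0) (at z)"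
  proof (rule Lim_null_comparison)
    have "eventually (\<lambda>w. w \<in> ball 0 1) (at z)"
      using z by (intro eventually_at_in_open' open_ball)
    then show "\<forall>\<^sub>F w in at z. norm ((cinner (F w x) y - cinner (F z x) y) / (w - z) - cinner (L x) y)
        \<le> onorm (\<lambda>x. inverse (w - z) *\<^sub>C (F w x - F z x) - L x) * norm x * norm y"
    proof eventually_elim
      case (elim w)
      let ?R = "\<lambda>x. inverse (w - z) *\<^sub>C (F w x - F z x) - L x"
      have R: "bounded_linear ?R"
        using elim z by (intro bounded_clinear_imp_bounded_linear bounded_clinear_diff_op
            bounded_clinear_scaleC_op F L)
      have "(cinner (F w x) y - cinner (F z x) y) / (w - z) - cinner (L x) y = cinner (?R x) y"
        by (simp add: cinner_linear divide_inverse mult.commute)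
      then show ?case
        using norm_cinner_le[of "?R x" y] mult_right_mono[OF onorm[OF R, of x] norm_ge_zero[of y]] by simp
    qed
    have "((\<lambda>w. onorm (\<lambda>x. inverse (w - z) *\<^sub>C (F w x - F z x) - L x) * norm x * norm y)
        \<longlongrightarrow> 0 * norm x * norm y) (at z)"
      by (intro tendsto_mult tendsto_const lim)
    then show "((\<lambda>w. onorm (\<lambda>x. inverse (w - z) *\<^sub>C (F w x - F z x) - L x) * norm x * norm y) \<longlongrightarrow> 0) (at z)"
      by simp
  qed
  then have "((\<lambda>z. cinner (F z x) y) has_field_derivative cinner (L x) y) (at z)"
    unfolding has_field_derivative_iff by (rule LIM_zero_cancel)
  then show "(\<lambda>z. cinner (F z x) y) field_differentiable (at z within ball 0 1)"
    by (meson field_differentiable_def field_differentiable_at_within)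
qed

text \<open>The choice \<open>s\<^sup>2 = e / b\<close> balances the two squares. Either number may
  be zero, so both are first enlarged by \<open>d > 0\<close>.\<close>

lemma le_mult_if_le_scaled_sum:
  fixes A b e k :: real
  assumes "0 \<le> b" and "0 \<le> e" and "0 \<le> k" and le: "\<And>s. s > 0 \<Longrightarrow> A \<le> k * ((s * b)\<^sup>2 + (e / s)\<^sup>2)"
  shows "A \<le> 2 * k * b * e"
proof (rule tendsto_lowerbound)
  show "((\<lambda>d. 2 * k * (b + d) * (e + d)) \<longlongrightarrow> 2 * k * b * e) (at_right 0)"
    by (rule tendsto_eq_intros refl)+ simp
  show "\<forall>\<^sub>F d in at_right 0. A \<le> 2 * k * (b + d) * (e + d)"
    using eventually_at_right_less[of "0::real"]
  proof eventually_elim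
    case (elim d)
    define s where "s = sqrt ((e + d) / (b + d))"
    have pos: "b + d > 0" "e + d > 0" using assms elim by auto
    then have s: "s > 0" "s\<^sup>2 = (e + d) / (b + d)" by (simp_all add: s_def)
    have "A \<le> k * ((s * b)\<^sup>2 + (e / s)\<^sup>2)" by (rule le[OF s(1)])
    also have "\<dots> \<le> k * ((s * (b + d))\<^sup>2 + ((e + d) / s)\<^sup>2)"
      using assms s(1) elim by (intro mult_left_mono add_mono power_mono divide_right_mono) simp_all
    also have "(s * (b + d))\<^sup>2 = (b + d) * (e + d)"
      unfolding power_mult_distrib s(2) using pos by (simp add: power2_eq_square)
    also have "((e + d) / s)\<^sup>2 = (b + d) * (e + d)"
      unfolding power_divide s(2) using pos by (simp add: power2_eq_square)
    finally show ?case by (simp add: algebra_simps)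
  qed
qed simp

text \<open>
  The harmonic function \<open>(norm x)\<^sup>2 + (norm y)\<^sup>2 + 2 * Re (cinner (F z x) y)\<close> is nonnegative.
  Harnack's inequality for it, tested on the vectors \<open>(x, - T x) + w (- T* y, y)\<close> with
  \<open>w\<^sup>4 = 1\<close>, gives by polarization an operator Schwarz-Pick inequality.
\<close>

lemma analytic_imp_mixed_dominated:
  fixes T T' :: "'a::complex_hilbert_space \<Rightarrow> 'a"
  assumes T: "contraction T" and T': "contraction T'" and F: "contractive_analytic F"
    and z0: "z0 \<in> ball 0 1" and F0: "F 0 = T" and Fz0: "F z0 = T'"
  shows "mixed_dominated T T'"
proof -
  note bT = contraction_bounded_clinear[OF T] and bT' = contraction_bounded_clinear[OF T']
  define r where "r = cmod z0"
  have r: "0 \<le> r" "r < 1" using z0 by (simp_all add: r_def)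
  define q where "q A x y = (norm x)\<^sup>2 + (norm y)\<^sup>2 + 2 * Re (cinner (A x) y)" for A :: "'a \<Rightarrow> 'a" and x y
  define H where "H x = T' x - T x" for x
  have bH: "bounded_clinear H"
    unfolding H_def[abs_def] by (intro bounded_clinear_diff_op bT bT')
  define k where "k = r / (1 - r)"
  have k: "k \<ge> 0" using r by (simp add: k_def)
  have main: "cmod (cinner (H x) y) \<le> k * q T x y" "q T x y \<le> (1 + r) / (1 - r) * q T' x y" for x y
  proof -
    define f where "f z = of_real ((norm x)\<^sup>2 + (norm y)\<^sup>2) + 2 * cinner (F z x) y" for z
    have hol: "f holomorphic_on ball 0 1"
      unfolding f_def by (intro holomorphic_intros contractive_analytic_cinner_holomorphic F)
    have Re_f: "Re (f z) = q (F z) x y" for z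
      by (simp add: f_def q_def)
    have nonneg: "0 \<le> Re (f z)" if "z \<in> ball 0 1" for z
    proof -
      have "contraction (F z)"
        using F that unfolding contractive_analytic_def by blast
      then have "cmod (cinner (F z x) y) \<le> norm x * norm y"
        using norm_cinner_le[of "F z x" y] mult_right_mono[OF contraction_norm_le norm_ge_zero[of y]]
        by (meson order_trans)
      then have "- (norm x * norm y) \<le> Re (cinner (F z x) y)"
        using abs_Re_le_cmod[of "cinner (F z x) y"] by linarith
      then show ?thesis
        unfolding Re_f q_def using sum_squares_bound[of "norm x" "norm y"] by simp
    qed
    have "f z0 - f 0 = 2 * cinner (H x) y"
      by (simp add: f_def F0 Fz0 H_def cinner_diff_left)
    then have "2 * cmod (cinner (H x) y) \<le> 2 * r / (1 - r) * q T x y"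
      using harnack_holomorphic(1)[OF hol nonneg, of z0] z0 Re_f[of 0] F0
      by (simp add: norm_mult r_def)
    then show "cmod (cinner (H x) y) \<le> k * q T x y"
      by (simp add: k_def)
    show "q T x y \<le> (1 + r) / (1 - r) * q T' x y"
      using harnack_holomorphic(2)[OF hol nonneg, of z0] z0 Re_f[of 0] Re_f[of z0] F0 Fz0
      by (simp add: r_def)
  qed
  have q_eq: "q A x y = (norm (y + A x))\<^sup>2 + (norm (defect_op A x))\<^sup>2" if "contraction A" for A x y
  proof -
    have "Re (cinner y (A x)) = Re (cinner (A x) y)" by (subst cinner_commute) simp
    then show ?thesis
      by (simp add: q_def norm_add_sqr defect_op_norm[OF that])
  qed
  \<comment> \<open>By \<open>q_eq\<close>, the choice \<open>y = - T' x\<close> reduces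
    \<open>q T'\<close> to the squared defect of \<open>T'\<close>, while \<open>q T\<close> is
    still at least the squared defect of \<open>T\<close>.\<close>
  have defect: "norm (defect_op T x) \<le> sqrt ((1 + r) / (1 - r)) * norm (defect_op T' x)" for x
  proof (rule power2_le_imp_le)
    have "(norm (defect_op T x))\<^sup>2 \<le> q T x (- T' x)"
      by (simp add: q_eq[OF T])
    also have "\<dots> \<le> (1 + r) / (1 - r) * q T' x (- T' x)" by (rule main)
    finally show "(norm (defect_op T x))\<^sup>2 \<le> (sqrt ((1 + r) / (1 - r)) * norm (defect_op T' x))\<^sup>2"
      using r by (simp add: q_eq[OF T'] power_mult_distrib)
  qed (use r in simp)
  let ?D = "defect_op (cadjoint T)"
  have pol: "cmod (cinner (H x) y) \<le> (3 * k) * ((norm (defect_op T x))\<^sup>2 + (norm (?D y))\<^sup>2)" for x y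
  proof -
    \<comment> \<open>With these vectors \<open>T x\<close> cancels in the first square of
      \<open>q_eq\<close>, leaving \<open>w *\<^sub>C ?D (?D y)\<close>, and the second square also
      contains only defects.\<close>
    define g where "g w = cinner (H (x - w *\<^sub>C cadjoint T y)) (- T x + w *\<^sub>C y)" for w
    have g_le: "cmod (g w) \<le> k * (3 * ((norm (defect_op T x))\<^sup>2 + (norm (?D y))\<^sup>2))" if w: "cmod w = 1" for w
    proof -
      have 1: "(- T x + w *\<^sub>C y) + T (x - w *\<^sub>C cadjoint T y) = w *\<^sub>C ?D (?D y)"
        by (simp add: defect_op_square[OF cadjoint_contraction[OF T]] cadjoint_cadjoint[OF bT]
            bounded_clinear_simps[OF bT] scaleC_diff_right)
      have 2: "defect_op T (x - w *\<^sub>C cadjoint T y) = defect_op T x - w *\<^sub>C cadjoint T (?D y)"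
        by (simp add: bounded_clinear_simps[OF defect_op_bounded_clinear[OF T]] defect_op_intertwine'[OF T])
      have "norm (w *\<^sub>C ?D (?D y)) \<le> norm (?D y)"
        using w by (simp add: norm_scaleC defect_op_norm_le[OF cadjoint_contraction[OF T]])
      then have 3: "(norm (w *\<^sub>C ?D (?D y)))\<^sup>2 \<le> (norm (?D y))\<^sup>2"
        by (rule power_mono) simp
      have "norm (w *\<^sub>C cadjoint T (?D y)) \<le> norm (?D y)"
        using w by (simp add: norm_scaleC contraction_norm_le[OF cadjoint_contraction[OF T]])
      then have "norm (defect_op T x - w *\<^sub>C cadjoint T (?D y)) \<le> norm (defect_op T x) + norm (?D y)"
        using norm_triangle_ineq4[of "defect_op T x" "w *\<^sub>C cadjoint T (?D y)"] by linarith
      then have "(norm (defect_op T x - w *\<^sub>C cadjoint T (?D y)))\<^sup>2 \<le> (norm (defect_op T x) + norm (?D y))\<^sup>2"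
        by (rule power_mono) simp
      also have "\<dots> \<le> 2 * (norm (defect_op T x))\<^sup>2 + 2 * (norm (?D y))\<^sup>2"
        using sum_squares_bound[of "norm (defect_op T x)" "norm (?D y)"] by (simp add: power2_sum)
      finally have "q T (x - w *\<^sub>C cadjoint T y) (- T x + w *\<^sub>C y)
          \<le> (norm (?D y))\<^sup>2 + (2 * (norm (defect_op T x))\<^sup>2 + 2 * (norm (?D y))\<^sup>2)"
        unfolding q_eq[OF T] 1 2 by (rule add_mono[OF 3])
      also have "\<dots> \<le> 3 * ((norm (defect_op T x))\<^sup>2 + (norm (?D y))\<^sup>2)"
        by simp
      finally have "q T (x - w *\<^sub>C cadjoint T y) (- T x + w *\<^sub>C y)
          \<le> 3 * ((norm (defect_op T x))\<^sup>2 + (norm (?D y))\<^sup>2)" .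
      then have "k * q T (x - w *\<^sub>C cadjoint T y) (- T x + w *\<^sub>C y)
          \<le> k * (3 * ((norm (defect_op T x))\<^sup>2 + (norm (?D y))\<^sup>2))"
        using k by (rule mult_left_mono)
      then show ?thesis
        unfolding g_def by (rule order_trans[OF main(1)])
    qed
    \<comment> \<open>Summing \<open>w * g w\<close> over the fourth roots of unity extracts the
      coefficient of \<open>cnj w\<close> in \<open>g\<close>.\<close>
    have "4 * cinner (H x) y = g 1 + \<i> * g \<i> + (- 1) * g (- 1) + (- \<i>) * g (- \<i>)"
      by (simp add: g_def bounded_clinear_simps[OF bH] cinner_linear algebra_simps)
    also have "cmod \<dots> \<le> cmod (g 1) + cmod (g \<i>) + cmod (g (- 1)) + cmod (g (- \<i>))"
      by (intro norm_triangle_le add_mono) (simp_all add: norm_mult)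
    also have "\<dots> \<le> 4 * (k * (3 * ((norm (defect_op T x))\<^sup>2 + (norm (?D y))\<^sup>2)))"
      using g_le[of 1] g_le[of \<i>] g_le[of "- 1"] g_le[of "- \<i>"] by simp
    finally have "4 * cmod (cinner (H x) y) \<le> 4 * (k * (3 * ((norm (defect_op T x))\<^sup>2 + (norm (?D y))\<^sup>2)))"
      by (simp only: norm_mult norm_numeral)
    then show ?thesis
      by (simp only: mult_le_cancel_left_pos zero_less_numeral mult.assoc mult.left_commute[of k])
  qed
  have "cmod (cinner (T x - T' x) y) \<le> (6 * k) * norm (defect_op T x) * norm (?D y)" for x y
  proof -
    \<comment> \<open>The left side is unchanged under \<open>s *\<^sub>R x\<close> and
      \<open>(1 / s) *\<^sub>R y\<close>, so optimizing \<open>s\<close> turns the sum of squares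
      into a product.\<close>
    have "cmod (cinner (H x) y) \<le> (3 * k) * ((s * norm (defect_op T x))\<^sup>2 + (norm (?D y) / s)\<^sup>2)" if s: "s > 0" for s
    proof -
      have "cinner (H (s *\<^sub>R x)) ((1 / s) *\<^sub>R y) = cinner (H x) y"
        using s by (simp add: bounded_clinear_scaleR[OF bH] cinner_scaleR_left cinner_scaleR_right)
      then show ?thesis
        using pol[of "s *\<^sub>R x" "(1 / s) *\<^sub>R y"] s
        by (simp add: bounded_clinear_scaleR[OF defect_op_bounded_clinear[OF T]]
            bounded_clinear_scaleR[OF defect_op_bounded_clinear[OF cadjoint_contraction[OF T]]] abs_of_pos)
    qed
    then have "cmod (cinner (H x) y) \<le> 2 * (3 * k) * norm (defect_op T x) * norm (?D y)"
      using k by (intro le_mult_if_le_scaled_sum) simp_all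
    moreover have "cmod (cinner (T x - T' x) y) = cmod (cinner (H x) y)"
      by (simp add: H_def cinner_diff_left norm_minus_commute)
    ultimately show ?thesis by simp
  qed
  then show ?thesis
    using defect k r by (intro mixed_dominatedI[where C = "6 * k" and K = "sqrt ((1 + r) / (1 - r))"]) simp_all
qed

section \<open>An analytic function through \<open>T\<close> and \<open>T'\<close>\<close>

lemma disc_map_near_segment:
  fixes e :: real
  assumes "e > 0"
  obtains \<phi> z0 where "\<phi> holomorphic_on ball 0 1" and "z0 \<in> ball 0 1" and "\<phi> 0 = 0" and "\<phi> z0 = 1"
    and "\<And>z. z \<in> ball 0 1 \<Longrightarrow> \<exists>t\<in>{0..1}. cmod (\<phi> z - of_real t) \<le> e"
proof -
  \<comment> \<open>An open rectangle exceeding the segment by \<open>e / 2\<close> on every side;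
    its Riemann map is the required function up to a disc automorphism.\<close>
  define S where "S = box (Complex (- e / 2) (- e / 2)) (Complex (1 + e / 2) (e / 2))"
  have mem: "z \<in> S \<longleftrightarrow> - e / 2 < Re z \<and> Re z < 1 + e / 2 \<and> - e / 2 < Im z \<and> Im z < e / 2" for z
    by (auto simp: S_def in_box_complex_iff)
  have in_S: "0 \<in> S" "1 \<in> S" using assms by (simp_all add: mem)
  have "S \<noteq> UNIV"
    using mem[of "Complex 0 e"] assms by auto
  moreover have "open S" "simply_connected S"
    unfolding S_def by (simp_all add: convex_imp_simply_connected open_box)
  ultimately obtain f g where g: "g holomorphic_on ball 0 1"
    and fg: "\<And>z. z \<in> S \<Longrightarrow> f z \<in> ball 0 1 \<and> g (f z) = z" "\<And>z. z \<in> ball 0 1 \<Longrightarrow> g z \<in> S"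
    using Riemann_mapping_theorem[of S] in_S by blast
  have f0: "f 0 \<in> ball 0 1" and f1: "f 1 \<in> ball 0 1"
    using fg(1) in_S by blast+
  \<comment> \<open>The automorphism moves the preimage of \<open>0\<close> to the centre of the
    disc.\<close>
  obtain m n where m: "m (f 0) = 0" "m ` ball 0 1 \<subseteq> ball 0 1"
    and n: "n holomorphic_on ball 0 1" "n ` ball 0 1 \<subseteq> ball 0 1"
    and mn: "\<And>z. z \<in> ball 0 1 \<Longrightarrow> n (m z) = z"
    by (rule ball_biholomorphism_exists[OF f0], rule that)
  show thesis
  proof (rule that[of "g \<circ> n" "m (f 1)"])
    show "g \<circ> n holomorphic_on ball 0 1"
      using holomorphic_on_compose_gen[OF n(1) g n(2)] .
    show "m (f 1) \<in> ball 0 1" using m(2) f1 by blast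
    show "(g \<circ> n) 0 = 0"
      using mn[OF f0] fg(1)[OF in_S(1)] m(1) by simp
    show "(g \<circ> n) (m (f 1)) = 1"
      using mn[OF f1] fg(1)[OF in_S(2)] by simp
    fix z :: complex assume "z \<in> ball 0 1"
    then have z: "(g \<circ> n) z \<in> S"
      using n(2) fg(2) by (simp add: image_subset_iff)
    define w where "w = (g \<circ> n) z"
    define t where "t = max 0 (min 1 (Re w))"
    have "\<bar>Re w - t\<bar> \<le> e / 2" "\<bar>Im w\<bar> \<le> e / 2"
      using z assms unfolding w_def[symmetric] mem t_def by (auto simp: max_def min_def)
    then have "cmod (w - of_real t) \<le> e"
      using cmod_le[of "w - of_real t"] by simp
    then show "\<exists>t\<in>{0..1}. cmod ((g \<circ> n) z - of_real t) \<le> e"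
      unfolding w_def by (intro bexI[of _ t]) (auto simp: t_def)
  qed
qed

text \<open>On the segment, convexity of the squared norm leaves a margin of \<open>c0\<close> times
  the squared defect of \<open>T\<close>. Leaving the segment costs terms in
  \<open>T' x - T x\<close>, which the mixed bound also measures by that defect, so \<open>e\<close>
  does not depend on \<open>x\<close>.\<close>

lemma mixed_dominated_imp_segment_contraction:
  assumes T: "contraction T" and T': "contraction T'" and M: "mixed_dominated T T'"
  obtains e where "e > 0"
    and "\<And>t w x. t \<in> {0..1} \<Longrightarrow> cmod (w - of_real t) \<le> e \<Longrightarrow> norm (T x + w *\<^sub>C (T' x - T x)) \<le> norm x"
proof -
  obtain K where K: "K \<ge> 0" "\<And>x. norm (defect_op T x) \<le> K * norm (defect_op T' x)"
    "\<And>x. norm (defect_op T' x) \<le> K * norm (defect_op T x)"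
    by (rule mixed_dominated_defect_le[OF T T' M], rule that)
  obtain C where C: "C \<ge> 0" and G: "\<And>x y. cmod (cinner (T x - T' x) y)
      \<le> C * norm (defect_op T' x) * norm (defect_op (cadjoint T) y)"
    using M unfolding mixed_dominated_def by blast
  define c0 where "c0 = 1 / (1 + K\<^sup>2)"
  have c0: "0 < c0" "c0 \<le> 1" by (simp_all add: c0_def add_pos_nonneg)
  define C1 where "C1 = C * K + (C * K)\<^sup>2 + 1"
  have C1: "C1 \<ge> 1" and CK_le: "C * K \<le> C1" using C K by (simp_all add: C1_def)
  \<comment> \<open>The cost of a displacement is \<open>2 * 2\<close> for the cross term and
    \<open>1\<close> for the square, each times \<open>e * C1 * ?b\<^sup>2\<close>; together they
    equal the margin \<open>c0 * ?b\<^sup>2\<close>.\<close>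
  define e where "e = c0 / (5 * C1)"
  have e: "0 < e" "e \<le> 1"
    using c0 C1 by (simp_all add: e_def)
  have "norm (T x + w *\<^sub>C (T' x - T x)) \<le> norm x" if t: "t \<in> {0..1}" and w: "cmod (w - of_real t) \<le> e" for t w x
  proof (rule power2_le_imp_le)
    let ?b = "norm (defect_op T x)" and ?a = "norm (defect_op T' x)"
    define H where "H = T' x - T x"
    define A where "A = T x + t *\<^sub>R H"
    have H_le: "cmod (cinner H y) \<le> C * K * ?b * norm (defect_op (cadjoint T) y)" for y
    proof -
      have "cmod (cinner H y) \<le> C * ?a * norm (defect_op (cadjoint T) y)"
        using G[of x y] by (simp add: H_def cinner_diff_left norm_minus_commute)
      also have "\<dots> \<le> C * (K * ?b) * norm (defect_op (cadjoint T) y)"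
        using C by (intro mult_right_mono mult_left_mono K) simp_all
      finally show ?thesis by (simp add: mult.assoc)
    qed
    have "cmod (cinner H (T x)) \<le> C * K * ?b * ?b"
      using H_le[of "T x"] mult_left_mono[OF defect_op_cadjoint_norm_le[OF T, of x], of "C * K * ?b"] C K(1) by simp
    then have HT: "cmod (cinner H (T x)) \<le> C1 * ?b\<^sup>2"
      using mult_right_mono[OF CK_le zero_le_power2[of ?b]] by (simp add: power2_eq_square mult.assoc)
    have "norm H \<le> C * K * ?b"
    proof (rule norm_le_if_cinner_le)
      fix y
      show "cmod (cinner H y) \<le> C * K * ?b * norm y"
        using H_le[of y] mult_left_mono[OF defect_op_norm_le[OF cadjoint_contraction[OF T], of y], of "C * K * ?b"] C K(1)
        by simp
    qed (simp add: C K)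
    then have "(norm H)\<^sup>2 \<le> (C * K * ?b)\<^sup>2"
      by (rule power_mono) simp
    also have "\<dots> \<le> C1 * ?b\<^sup>2"
      unfolding power_mult_distrib[of "C * K"] using C K by (intro mult_right_mono) (simp_all add: C1_def)
    finally have HH: "(norm H)\<^sup>2 \<le> C1 * ?b\<^sup>2" .
    have "?b\<^sup>2 \<le> K\<^sup>2 * ?a\<^sup>2"
      using power_mono[OF K(2)[of x] norm_ge_zero, of 2] by (simp add: power_mult_distrib)
    also have "\<dots> \<le> (1 + K\<^sup>2) * ?a\<^sup>2" by (simp add: distrib_right)
    finally have a: "c0 * ?b\<^sup>2 \<le> ?a\<^sup>2"
      by (simp add: c0_def divide_le_eq mult.commute add_pos_nonneg)
    have "(norm A)\<^sup>2 \<le> (norm x)\<^sup>2 - c0 * ?b\<^sup>2"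
    proof -
      have 1: "(norm A)\<^sup>2 = (norm (T x))\<^sup>2 + 2 * t * Re (cinner (T x) H) + t\<^sup>2 * (norm H)\<^sup>2"
        by (simp add: A_def norm_add_sqr cinner_scaleR_right power_mult_distrib)
      have 2: "(norm (T' x))\<^sup>2 = (norm (T x))\<^sup>2 + 2 * Re (cinner (T x) H) + (norm H)\<^sup>2"
        using norm_add_sqr[of "T x" H] by (simp add: H_def)
      \<comment> \<open>\<open>t\<^sup>2 \<le> t\<close> on the unit interval is exactly convexity
        of the squared norm between \<open>T x\<close> and \<open>T' x\<close>.\<close>
      have "t\<^sup>2 * (norm H)\<^sup>2 \<le> t * (norm H)\<^sup>2"
        using t by (intro mult_right_mono) (simp_all add: power2_eq_square mult_left_le)
      then have "(norm A)\<^sup>2 \<le> (1 - t) * (norm (T x))\<^sup>2 + t * (norm (T' x))\<^sup>2"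
        unfolding 1 2 by (simp add: algebra_simps)
      also have "\<dots> = (norm x)\<^sup>2 - ((1 - t) * ?b\<^sup>2 + t * ?a\<^sup>2)"
        by (simp add: defect_op_norm[OF T] defect_op_norm[OF T'] algebra_simps)
      also have "(1 - t) * (c0 * ?b\<^sup>2) + t * (c0 * ?b\<^sup>2) \<le> (1 - t) * ?b\<^sup>2 + t * ?a\<^sup>2"
        using t c0 a by (intro add_mono mult_left_mono) (simp_all add: mult_left_le_one_le)
      then have "(norm x)\<^sup>2 - ((1 - t) * ?b\<^sup>2 + t * ?a\<^sup>2) \<le> (norm x)\<^sup>2 - c0 * ?b\<^sup>2"
        by (simp add: algebra_simps)
      finally show ?thesis .
    qed
    moreover define d where "d = w - of_real t"
    have dH: "T x + w *\<^sub>C (T' x - T x) = A + d *\<^sub>C H"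
      by (simp add: A_def d_def H_def scaleC_diff_left scaleR_scaleC)
    have d: "cmod d \<le> e" "cmod d \<le> 1" using w e by (simp_all add: d_def)
    have "cmod (cinner A H) \<le> 2 * (C1 * ?b\<^sup>2)"
    proof -
      have "cinner A H = cinner (T x) H + of_real (t * (norm H)\<^sup>2)"
        by (simp add: A_def cinner_add_left cinner_scaleR_left cinner_self scaleR_conv_of_real)
      then have "cmod (cinner A H) \<le> cmod (cinner (T x) H) + t * (norm H)\<^sup>2"
        using norm_triangle_ineq[of "cinner (T x) H" "of_real (t * (norm H)\<^sup>2)"] t
        by (simp add: norm_mult norm_power)
      moreover have "cmod (cinner (T x) H) = cmod (cinner H (T x))"
        by (subst cinner_commute) simp
      moreover have "t * (norm H)\<^sup>2 \<le> (norm H)\<^sup>2"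
        using t by (simp add: mult_left_le_one_le)
      ultimately show ?thesis using HT HH by linarith
    qed
    then have "cmod (cinner A (d *\<^sub>C H)) \<le> e * (2 * (C1 * ?b\<^sup>2))"
      using d e C1 by (simp add: cinner_scaleC_right norm_mult mult_mono)
    moreover have "(norm (d *\<^sub>C H))\<^sup>2 \<le> e * (C1 * ?b\<^sup>2)"
    proof -
      have "(cmod d)\<^sup>2 \<le> e"
        using d by (simp add: power2_eq_square mult_left_le order_trans[of _ "cmod d" e])
      then show ?thesis
        unfolding norm_scaleC power_mult_distrib using HH e by (intro mult_mono) simp_all
    qed
    moreover have "(norm (A + d *\<^sub>C H))\<^sup>2 = (norm A)\<^sup>2 + 2 * Re (cinner A (d *\<^sub>C H)) + (norm (d *\<^sub>C H))\<^sup>2"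
      by (rule norm_add_sqr)
    moreover have "Re (cinner A (d *\<^sub>C H)) \<le> cmod (cinner A (d *\<^sub>C H))"
      by (rule complex_Re_le_cmod)
    moreover have "5 * (e * (C1 * ?b\<^sup>2)) = c0 * ?b\<^sup>2"
      using C1 by (simp add: e_def)
    ultimately show "(norm (T x + w *\<^sub>C (T' x - T x)))\<^sup>2 \<le> (norm x)\<^sup>2"
      unfolding dH by linarith
  qed simp
  with e(1) show thesis by (rule that)
qed

lemma mixed_dominated_imp_analytic:
  fixes T T' :: "'a::complex_hilbert_space \<Rightarrow> 'a"
  assumes T: "contraction T" and T': "contraction T'" and M: "mixed_dominated T T'"
  shows "\<exists>z0\<in>ball 0 1. \<exists>F. contractive_analytic F \<and> F 0 = T \<and> F z0 = T'"
proof -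
  obtain e where e: "e > 0" and le: "\<And>t w x. t \<in> {0..1} \<Longrightarrow> cmod (w - of_real t) \<le> e
      \<Longrightarrow> norm (T x + w *\<^sub>C (T' x - T x)) \<le> norm x"
    by (rule mixed_dominated_imp_segment_contraction[OF T T' M], rule that)
  obtain \<phi> z0 where hol: "\<phi> holomorphic_on ball 0 1" and z0: "z0 \<in> ball 0 1" "\<phi> 0 = 0" "\<phi> z0 = 1"
    and near: "\<And>z. z \<in> ball 0 1 \<Longrightarrow> \<exists>t\<in>{0..1}. cmod (\<phi> z - of_real t) \<le> e"
    by (rule disc_map_near_segment[OF e], rule that)
  define H where "H x = T' x - T x" for x
  have bH: "bounded_clinear H"
    unfolding H_def[abs_def] by (intro bounded_clinear_diff_op contraction_bounded_clinear T T')
  obtain K where K: "K \<ge> 0" "\<And>x. norm (H x) \<le> K * norm x"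
    using bounded_clinear_pos_bound[OF bH] by blast
  define F where "F z x = T x + \<phi> z *\<^sub>C H x" for z x
  have "contraction (F z)" if "z \<in> ball 0 1" for z
  proof -
    have "bounded_clinear (F z)"
      unfolding F_def[abs_def] by (intro bounded_clinear_add_op bounded_clinear_scaleC_op bH contraction_bounded_clinear T)
    moreover have "norm (F z x) \<le> norm x" for x
      using near[OF that] le unfolding F_def H_def by blast
    ultimately show ?thesis by (simp add: contraction_iff)
  qed
  moreover have "\<exists>L. bounded_clinear L \<and>
      ((\<lambda>w. onorm (\<lambda>x. inverse (w - z) *\<^sub>C (F w x - F z x) - L x)) \<longlongrightarrow> 0) (at z)" if z: "z \<in> ball 0 1" for z
  proof (intro exI conjI)
    let ?p = "deriv \<phi> z"
    show "bounded_clinear (\<lambda>x. ?p *\<^sub>C H x)"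
      by (rule bounded_clinear_scaleC_op[OF bH])
    have eq: "inverse (w - z) *\<^sub>C (F w x - F z x) - ?p *\<^sub>C H x = ((\<phi> w - \<phi> z) / (w - z) - ?p) *\<^sub>C H x" for w x
      by (simp add: F_def scaleC_diff_left[symmetric] scaleC_scaleC divide_inverse mult.commute)
    have "(\<phi> has_field_derivative ?p) (at z)"
      using hol z by (intro holomorphic_derivI[OF hol open_ball])
    then have "((\<lambda>w. (\<phi> w - \<phi> z) / (w - z)) \<longlongrightarrow> ?p) (at z)"
      by (simp only: has_field_derivative_iff)
    then have "((\<lambda>w. cmod ((\<phi> w - \<phi> z) / (w - z) - ?p) * K) \<longlongrightarrow> 0 * K) (at z)"
      by (intro tendsto_mult tendsto_const tendsto_norm_zero LIM_zero)
    then have lim: "((\<lambda>w. cmod ((\<phi> w - \<phi> z) / (w - z) - ?p) * K) \<longlongrightarrow> 0) (at z)" by simp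
    show "((\<lambda>w. onorm (\<lambda>x. inverse (w - z) *\<^sub>C (F w x - F z x) - ?p *\<^sub>C H x)) \<longlongrightarrow> 0) (at z)"
      unfolding eq
    proof (rule tendsto_sandwich[OF _ _ tendsto_const lim])
      show "\<forall>\<^sub>F w in at z. 0 \<le> onorm (\<lambda>x. ((\<phi> w - \<phi> z) / (w - z) - ?p) *\<^sub>C H x)"
        by (intro always_eventually allI onorm_pos_le bounded_clinear_imp_bounded_linear bounded_clinear_scaleC_op bH)
      have "onorm (\<lambda>x. a *\<^sub>C H x) \<le> cmod a * K" for a
        using K mult_left_mono[OF K(2) norm_ge_zero[of a]]
        by (intro onorm_bound) (simp_all add: norm_scaleC mult.assoc)
      then show "\<forall>\<^sub>F w in at z. onorm (\<lambda>x. ((\<phi> w - \<phi> z) / (w - z) - ?p) *\<^sub>C H x)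
          \<le> cmod ((\<phi> w - \<phi> z) / (w - z) - ?p) * K"
        by (intro always_eventually allI)
    qed
  qed
  ultimately have "contractive_analytic F"
    unfolding contractive_analytic_def by blast
  moreover have "F 0 = T" "F z0 = T'"
    by (simp_all add: F_def H_def z0 fun_eq_iff)
  ultimately show ?thesis using z0(1) by blast
qed

section \<open>Row operators on square-summable sequences\<close>

text \<open>Splitting off \<open>w 0\<close> writes the sum as \<open>T s + D_T* (w 0)\<close> with
  \<open>s\<close> a shorter sum of the same kind, the first output of the Julia operator; its norm
  is controlled by the two inputs.\<close>

lemma row_sum_norm_le:
  assumes T: "contraction T"
  shows "(norm (\<Sum>k<n. (T ^^ k) (defect_op (cadjoint T) (w k))))\<^sup>2 \<le> (\<Sum>k<n. (norm (w k))\<^sup>2)"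
proof (induction n arbitrary: w)
  case (Suc n)
  let ?s = "\<Sum>k<n. (T ^^ k) (defect_op (cadjoint T) (w (Suc k)))"
  have "(\<Sum>k<Suc n. (T ^^ k) (defect_op (cadjoint T) (w k))) = T ?s + defect_op (cadjoint T) (w 0)"
    unfolding sum.lessThan_Suc_shift by (simp add: bounded_clinear_sum[OF contraction_bounded_clinear[OF T]] add.commute)
  moreover have "(norm (T ?s + defect_op (cadjoint T) (w 0)))\<^sup>2 \<le> (norm ?s)\<^sup>2 + (norm (w 0))\<^sup>2"
    unfolding Julia_operator_norm[OF T, of ?s "w 0", symmetric] by simp
  ultimately have "(norm (\<Sum>k<Suc n. (T ^^ k) (defect_op (cadjoint T) (w k))))\<^sup>2
      \<le> (norm ?s)\<^sup>2 + (norm (w 0))\<^sup>2"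
    by (simp only:)
  also have "\<dots> \<le> (\<Sum>k<n. (norm (w (Suc k)))\<^sup>2) + (norm (w 0))\<^sup>2"
    using Suc[of "\<lambda>k. w (Suc k)"] by simp
  finally show ?case
    unfolding sum.lessThan_Suc_shift[of "\<lambda>k. (norm (w k))\<^sup>2"] by simp
qed simp

instance complex_hilbert_space \<subseteq> banach ..

lemma row_series:
  assumes T: "contraction T" and w: "summable (\<lambda>k. (norm (w k))\<^sup>2)"
  shows "summable (\<lambda>k. (T ^^ k) (defect_op (cadjoint T) (w k)))"
    and "norm (\<Sum>k. (T ^^ k) (defect_op (cadjoint T) (w k))) \<le> sqrt (\<Sum>k. (norm (w k))\<^sup>2)"
proof -
  let ?f = "\<lambda>k. (T ^^ k) (defect_op (cadjoint T) (w k))"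
  have block: "(norm (sum ?f {m..<n}))\<^sup>2 \<le> (\<Sum>k=m..<n. (norm (w k))\<^sup>2)" for m n
  proof -
    \<comment> \<open>Padding with zeros turns a block into an initial segment, so the finite
      estimate becomes a Cauchy criterion.\<close>
    let ?v = "\<lambda>k. if k \<in> {m..<n} then w k else 0"
    have D0: "defect_op (cadjoint T) 0 = 0" and pow0: "(T ^^ k) 0 = 0" for k
      by (simp_all add: bounded_clinear_zero bounded_clinear_funpow defect_op_bounded_clinear
          cadjoint_contraction contraction_bounded_clinear T)
    have "sum ?f {m..<n} = (\<Sum>k<n. (T ^^ k) (defect_op (cadjoint T) (?v k)))"
      by (rule sum.mono_neutral_cong_left) (auto simp: D0 pow0)
    moreover have "(\<Sum>k=m..<n. (norm (w k))\<^sup>2) = (\<Sum>k<n. (norm (?v k))\<^sup>2)"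
      by (rule sum.mono_neutral_cong_left) auto
    ultimately show ?thesis
      using row_sum_norm_le[OF T, of ?v n] by simp
  qed
  show sm: "summable ?f"
    unfolding summable_Cauchy
  proof (intro allI impI)
    fix e :: real assume e: "e > 0"
    then obtain N where N: "\<And>m n. m \<ge> N \<Longrightarrow> norm (\<Sum>k=m..<n. (norm (w k))\<^sup>2) < e\<^sup>2"
      using w unfolding summable_Cauchy by (meson zero_less_power)
    have "norm (sum ?f {m..<n}) < e" if "m \<ge> N" for m n
    proof (rule power2_less_imp_less)
      show "(norm (sum ?f {m..<n}))\<^sup>2 < e\<^sup>2"
        using block[of m n] N[OF that, of n] by (simp add: sum_nonneg)
    qed (use e in simp)
    then show "\<exists>N. \<forall>m\<ge>N. \<forall>n. norm (sum ?f {m..<n}) < e" by blast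
  qed
  show "norm (suminf ?f) \<le> sqrt (\<Sum>k. (norm (w k))\<^sup>2)"
  proof (rule LIMSEQ_le_const2)
    show "(\<lambda>n. norm (sum ?f {..<n})) \<longlonglongrightarrow> norm (suminf ?f)"
      by (intro tendsto_norm summable_LIMSEQ sm)
    have "norm (sum ?f {..<n}) \<le> sqrt (\<Sum>k. (norm (w k))\<^sup>2)" for n
    proof (rule real_le_rsqrt)
      have "(norm (sum ?f {..<n}))\<^sup>2 \<le> (\<Sum>k<n. (norm (w k))\<^sup>2)"
        by (rule row_sum_norm_le[OF T])
      also have "\<dots> \<le> (\<Sum>k. (norm (w k))\<^sup>2)"
        by (rule sum_le_suminf[OF w]) simp_all
      finally show "(norm (sum ?f {..<n}))\<^sup>2 \<le> (\<Sum>k. (norm (w k))\<^sup>2)" .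
    qed
    then show "\<exists>N. \<forall>n\<ge>N. norm (sum ?f {..<n}) \<le> sqrt (\<Sum>k. (norm (w k))\<^sup>2)" by blast
  qed
qed

text \<open>The two equations dictate \<open>B\<close>: on the coordinate \<open>k\<close> it must
  be \<open>T^k\<close> after its action on coordinate zero, and there the factorization of
  \<open>T - T'\<close> provides \<open>D_T* W\<close>.\<close>

lemma mixed_dominated_imp_row_operator:
  fixes T T' :: "'a::complex_hilbert_space \<Rightarrow> 'a"
  assumes T: "contraction T" and T': "contraction T'" and M: "mixed_dominated T T'"
  shows "\<exists>B. ell2_bounded_clinear (defect_space T') B \<and>
        (\<forall>x. T x = T' x + B (ell2_incl (defect_op T' x))) \<and>
        (\<forall>f\<in>ell2 (defect_space T'). B (ell2_shift f) = T (B f))"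
proof -
  note bT = contraction_bounded_clinear[OF T]
  obtain C where C: "C \<ge> 0" "\<And>x y. cmod (cinner (T x - T' x) y)
      \<le> C * norm (defect_op T' x) * norm (defect_op (cadjoint T) y)"
    using M unfolding mixed_dominated_def by blast
  obtain W where W: "bounded_clinear W" "\<And>x. T x - T' x = defect_op (cadjoint T) (W (defect_op T' x))"
    by (rule factor_through_defects[OF cadjoint_contraction[OF T] T' bounded_clinear_diff_op[OF
          bT contraction_bounded_clinear[OF T']] C], rule that)
  obtain K where K: "K \<ge> 0" "\<And>x. norm (W x) \<le> K * norm x"
    using bounded_clinear_pos_bound[OF W(1)] by blast
  define E where "E k x = (T ^^ k) (defect_op (cadjoint T) (W x))" for k x
  have bE: "bounded_clinear (E k)" for k
    unfolding E_def[abs_def]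
    by (rule bounded_clinear_compose[OF bounded_clinear_funpow[OF bT] bounded_clinear_compose[OF
          defect_op_bounded_clinear[OF cadjoint_contraction[OF T]] W(1)]])
  define B where "B f = (\<Sum>k. E k (f k))" for f
  have W_sq: "(norm (W x))\<^sup>2 \<le> K\<^sup>2 * (norm x)\<^sup>2" for x
    using power_mono[OF K(2)[of x] norm_ge_zero, of 2] by (simp add: power_mult_distrib)
  have W_sum: "summable (\<lambda>k. (norm (W (f k)))\<^sup>2)"
    if "f \<in> ell2 (defect_space T')" for f :: "nat \<Rightarrow> 'a"
  proof (rule summable_comparison_test')
    show "summable (\<lambda>k. K\<^sup>2 * (norm (f k))\<^sup>2)"
      using that by (intro summable_mult) (simp add: ell2_def)
  qed (use W_sq in simp)
  have sm: "summable (\<lambda>k. E k (f k))" if "f \<in> ell2 (defect_space T')" for f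
    unfolding E_def by (rule row_series(1)[OF T W_sum[OF that]])
  have "ell2_bounded_clinear (defect_space T') B"
    unfolding ell2_bounded_clinear_def
  proof (intro conjI ballI allI exI[of _ K])
    fix f g :: "nat \<Rightarrow> 'a" and a :: complex
    assume f: "f \<in> ell2 (defect_space T')"
    show "B (\<lambda>n. a *\<^sub>C f n) = a *\<^sub>C B f"
      unfolding B_def by (simp add: bounded_clinear_scaleC[OF bE]
          bounded_linear.suminf[OF bounded_linear_scaleC_right sm[OF f]])
    have "norm (B f) \<le> sqrt (\<Sum>k. (norm (W (f k)))\<^sup>2)"
      unfolding B_def E_def by (rule row_series(2)[OF T W_sum[OF f]])
    also have "\<dots> \<le> sqrt (\<Sum>k. K\<^sup>2 * (norm (f k))\<^sup>2)"
      using f by (intro real_sqrt_le_mono suminf_le W_sq W_sum summable_mult) (simp_all add: ell2_def)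
    also have "\<dots> = K * ell2_norm f"
      using f K(1) by (simp add: ell2_norm_def ell2_def suminf_mult real_sqrt_mult)
    finally show "norm (B f) \<le> K * ell2_norm f" .
    assume g: "g \<in> ell2 (defect_space T')"
    show "B (\<lambda>n. f n + g n) = B f + B g"
      unfolding B_def by (simp add: bounded_clinear_add[OF bE] suminf_add[OF sm[OF f] sm[OF g]])
  qed
  moreover have "T x = T' x + B (ell2_incl (defect_op T' x))" for x
  proof -
    have "B (ell2_incl (defect_op T' x)) = (\<Sum>k\<in>{0}. E k (ell2_incl (defect_op T' x) k))"
      unfolding B_def by (rule suminf_finite) (simp_all add: ell2_incl_def bounded_clinear_zero[OF bE])
    then have "B (ell2_incl (defect_op T' x)) = T x - T' x"
      by (simp add: ell2_incl_def E_def W(2))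
    then show ?thesis by simp
  qed
  moreover have "B (ell2_shift f) = T (B f)" if f: "f \<in> ell2 (defect_space T')" for f
  proof -
    have Suc: "E (Suc k) x = T (E k x)" for k x
      by (simp add: E_def)
    have "(\<lambda>k. E (Suc k) (ell2_shift f (Suc k))) sums T (B f)"
      unfolding Suc B_def ell2_shift_def
      using bounded_linear.sums[OF bounded_clinear_imp_bounded_linear[OF bT] summable_sums[OF sm[OF f]]] by simp
    then have "(\<lambda>k. E k (ell2_shift f k)) sums (T (B f) + E 0 (ell2_shift f 0))"
      by (rule sums_Suc)
    then have "(\<lambda>k. E k (ell2_shift f k)) sums T (B f)"
      by (simp add: ell2_shift_def bounded_clinear_zero[OF bE])
    then show ?thesis
      unfolding B_def[of "ell2_shift f"] by (rule sums_unique[symmetric])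
  qed
  ultimately show ?thesis by blast
qed

text \<open>A finitely supported sequence is its zeroth coordinate plus the shift of its tail.
  Applying \<open>B\<close> to this decomposition repeatedly produces the powers of \<open>T\<close>
  in the row sum.\<close>

lemma row_operator_imp_row_bounded:
  assumes T: "contraction T" and T': "contraction T'"
    and B: "ell2_bounded_clinear (defect_space T') B"
    and incl: "\<And>x. T x = T' x + B (ell2_incl (defect_op T' x))"
    and shift: "\<And>f. f \<in> ell2 (defect_space T') \<Longrightarrow> B (ell2_shift f) = T (B f)"
  obtains c where "c \<ge> 0" and "row_bounded T T' c"
proof -
  note bT = contraction_bounded_clinear[OF T]
  let ?M = "defect_space T'"
  obtain K where K: "\<And>f. f \<in> ell2 ?M \<Longrightarrow> norm (B f) \<le> K * ell2_norm f"
    and add: "\<And>f g. f \<in> ell2 ?M \<Longrightarrow> g \<in> ell2 ?M \<Longrightarrow> B (\<lambda>n. f n + g n) = B f + B g"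
    and scale: "\<And>a f. f \<in> ell2 ?M \<Longrightarrow> B (\<lambda>n. a *\<^sub>C f n) = a *\<^sub>C B f"
    using B unfolding ell2_bounded_clinear_def by blast
  have zero: "0 \<in> ?M"
    using defect_op_in_defect_space[of T' 0] bounded_clinear_zero[OF defect_op_bounded_clinear[OF T']] by simp
  have finite_supp: "f \<in> ell2 ?M" if "\<And>k. f k \<in> ?M" "\<And>k. k \<ge> n \<Longrightarrow> f k = 0" for f :: "nat \<Rightarrow> 'a" and n
  proof -
    have "summable (\<lambda>k. (norm (f k))\<^sup>2)"
      by (rule summable_finite[of "{..<n}"]) (simp_all add: that)
    then show ?thesis
      using that(1) by (simp add: ell2_def)
  qed
  define s where "s x n k = (if k < n then defect_op T' (x k) else 0)" for x :: "nat \<Rightarrow> 'a" and n k :: nat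
  have s_mem: "s x n \<in> ell2 ?M" for x n
    by (rule finite_supp[of _ n]) (simp_all add: s_def zero defect_op_in_defect_space)
  have B_zero: "B (\<lambda>k. 0) = 0"
    using scale[OF s_mem[of x 0], of 0] by (simp add: s_def)
  have B_s: "B (s x n) = (\<Sum>k<n. (T ^^ k) (T (x k) - T' (x k)))" for x n
  proof (induction n arbitrary: x)
    case 0
    then show ?case by (simp add: s_def B_zero)
  next
    case (Suc n)
    let ?x = "\<lambda>k. x (Suc k)"
    have incl_mem: "ell2_incl (defect_op T' (x 0)) \<in> ell2 ?M"
      by (rule finite_supp[of _ 1]) (simp_all add: ell2_incl_def zero defect_op_in_defect_space)
    have shift_mem: "ell2_shift (s ?x n) \<in> ell2 ?M"
      by (rule finite_supp[of _ "Suc n"])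
        (simp_all add: ell2_shift_def s_def zero defect_op_in_defect_space split: nat.split)
    have "s x (Suc n) = (\<lambda>k. ell2_incl (defect_op T' (x 0)) k + ell2_shift (s ?x n) k)"
      by (auto simp: s_def ell2_incl_def ell2_shift_def fun_eq_iff split: nat.split)
    then have "B (s x (Suc n)) = B (ell2_incl (defect_op T' (x 0))) + T (B (s ?x n))"
      by (simp add: add[OF incl_mem shift_mem] shift[OF s_mem])
    also have "B (ell2_incl (defect_op T' (x 0))) = T (x 0) - T' (x 0)"
      using incl[of "x 0"] by simp
    also have "T (B (s ?x n)) = (\<Sum>k<n. (T ^^ Suc k) (T (x (Suc k)) - T' (x (Suc k))))"
      by (simp add: Suc bounded_clinear_sum[OF bT])
    finally show ?case
      by (simp add: sum.lessThan_Suc_shift del: sum.lessThan_Suc)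
  qed
  have "row_bounded T T' (K\<^sup>2)"
    unfolding row_bounded_def
  proof (intro allI)
    fix n and x :: "nat \<Rightarrow> 'a"
    have "(\<Sum>k. (norm (s x n k))\<^sup>2) = (\<Sum>k<n. (norm (s x n k))\<^sup>2)"
      by (rule suminf_finite) (simp_all add: s_def)
    then have "(ell2_norm (s x n))\<^sup>2 = (\<Sum>k<n. (norm (defect_op T' (x k)))\<^sup>2)"
      by (simp add: ell2_norm_def s_def sum_nonneg)
    moreover have "(norm (B (s x n)))\<^sup>2 \<le> (K * ell2_norm (s x n))\<^sup>2"
      using K[OF s_mem] by (rule power_mono) simp
    ultimately show "(norm (\<Sum>k<n. (T ^^ k) (T (x k) - T' (x k))))\<^sup>2
        \<le> K\<^sup>2 * (\<Sum>k<n. (norm (defect_op T' (x k)))\<^sup>2)"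
      by (simp add: B_s power_mult_distrib)
  qed
  then show thesis
    using that[of "K\<^sup>2"] by simp
qed

section \<open>The equivalences\<close>

context commuting_contractions
begin

text \<open>The three defect pairs serve, in order, Shmul'yan domination by \<open>T\<close>,
  Shmul'yan domination by \<open>T'\<close>, and the mixed bound with \<open>T\<close> and
  \<open>T'\<close> exchanged.\<close>

lemma mixed_dominated_bounds:
  assumes M: "mixed_dominated T T'"
  obtains C where "C \<ge> 0"
    and "\<And>x y. cmod (cinner (T x - T' x) y) \<le> C * norm (defect_op T x) * norm (defect_op T_adj y)"
    and "\<And>x y. cmod (cinner (T x - T' x) y) \<le> C * norm (defect_op T' x) * norm (defect_op T'_adj y)"
    and "\<And>x y. cmod (cinner (T x - T' x) y) \<le> C * norm (defect_op T x) * norm (defect_op T'_adj y)"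
proof -
  obtain K where K: "K \<ge> 0" "\<And>x. norm (defect_op T x) \<le> K * norm (defect_op T' x)"
    "\<And>x. norm (defect_op T' x) \<le> K * norm (defect_op T x)"
    by (rule mixed_dominated_defect_le[OF T T' M], rule that)
  obtain C where C: "C \<ge> 0" and G: "\<And>x y. cmod (cinner (T x - T' x) y)
      \<le> C * norm (defect_op T' x) * norm (defect_op T_adj y)"
    using M unfolding mixed_dominated_def by blast
  \<comment> \<open>A common upper bound for the factors \<open>1\<close>, \<open>K\<close> and
    \<open>sqrt (1 + K\<^sup>2)\<close>, so that one constant serves all three bounds.\<close>
  define L where "L = 1 + K + sqrt (1 + K\<^sup>2)"
  have L: "L \<ge> 1" "L \<ge> K" "L \<ge> sqrt (1 + K\<^sup>2)"
    using K(1) by (simp_all add: L_def)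
  have left: "norm (defect_op T_adj y) \<le> L * norm (defect_op T'_adj y)" for y
  proof -
    have "(norm (defect_op T_adj y))\<^sup>2 \<le> (1 + K\<^sup>2) * (norm (defect_op T'_adj y))\<^sup>2"
      using adjoint_defect_le[of K y] K unfolding D_def D'_def by blast
    then have "norm (defect_op T_adj y) \<le> sqrt ((1 + K\<^sup>2) * (norm (defect_op T'_adj y))\<^sup>2)"
      by (rule real_le_rsqrt)
    also have "\<dots> = sqrt (1 + K\<^sup>2) * norm (defect_op T'_adj y)"
      by (simp add: real_sqrt_mult)
    also have "\<dots> \<le> L * norm (defect_op T'_adj y)"
      using L by (intro mult_right_mono) simp_all
    finally show ?thesis .
  qed
  have right: "norm (defect_op T' x) \<le> L * norm (defect_op T x)" for x
    using K(3)[of x] mult_right_mono[OF L(2) norm_ge_zero[of "defect_op T x"]] by linarith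
  have up: "a \<le> L * a" if "0 \<le> a" for a
    using mult_right_mono[OF L(1) that] by simp
  have gen: "cmod (cinner (T x - T' x) y) \<le> (C * L * L) * a * b"
    if "norm (defect_op T' x) \<le> L * a" "norm (defect_op T_adj y) \<le> L * b" "0 \<le> a" "0 \<le> b" for x y a b
  proof -
    have "C * norm (defect_op T' x) * norm (defect_op T_adj y) \<le> C * (L * a) * (L * b)"
      using C L that by (intro mult_mono mult_left_mono) simp_all
    then show ?thesis
      using G[of x y] by (simp add: mult.assoc mult.left_commute)
  qed
  show thesis
  proof (rule that[of "C * L * L"])
    show "C * L * L \<ge> 0" using C L by simp
  qed (intro gen left right up norm_ge_zero)+
qed

lemma mixed_dominated_imp_Shmulyan_equivalent:
  assumes M: "mixed_dominated T T'"
  shows "Shmulyan_equivalent T T'"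
proof -
  obtain C where C: "C \<ge> 0"
    "\<And>x y. cmod (cinner (T x - T' x) y) \<le> C * norm (defect_op T x) * norm (defect_op T_adj y)"
    "\<And>x y. cmod (cinner (T x - T' x) y) \<le> C * norm (defect_op T' x) * norm (defect_op T'_adj y)"
    by (rule mixed_dominated_bounds[OF M], rule that)
  have "cmod (cinner (T' x - T x) y) \<le> C * norm (defect_op T x) * norm (defect_op T_adj y)" for x y
    using C(2)[of x y] by (simp add: cinner_diff_left norm_minus_commute)
  then show ?thesis
    unfolding Shmulyan_equivalent_def
    using Shmulyan_dominatesI[OF T bT' C(1)] Shmulyan_dominatesI[OF T' bT C(1,3)] by blast
qed

lemma mixed_dominated_imp_Harnack_equivalent:
  assumes M: "mixed_dominated T T'"
  shows "Harnack_equivalent T T'"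
proof -
  obtain C where C: "C \<ge> 0"
    "\<And>x y. cmod (cinner (T x - T' x) y) \<le> C * norm (defect_op T x) * norm (defect_op T'_adj y)"
    by (rule mixed_dominated_bounds[OF M], rule that)
  have "cmod (cinner (T' x - T x) y) \<le> C * norm (defect_op T x) * norm (defect_op T'_adj y)" for x y
    using C(2)[of x y] by (simp add: cinner_diff_left norm_minus_commute)
  then have "mixed_dominated T' T"
    unfolding mixed_dominated_def using C(1) by blast
  then show ?thesis
    unfolding Harnack_equivalent_def
    using mixed_dominated_imp_Harnack_dominated T T' M by blast
qed

lemma Harnack_dominated_iff_mixed_dominated: "Harnack_dominated T T' \<longleftrightarrow> mixed_dominated T T'"
proof
  assume "Harnack_dominated T T'"
  then obtain c where "c \<ge> 0" "row_bounded T T' c"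
    using Harnack_dominated_imp_row_bounded[OF T T'] by blast
  then show "mixed_dominated T T'" by (rule row_bounded_imp_mixed_dominated)
qed (rule mixed_dominated_imp_Harnack_dominated[OF T T'])

lemma row_operator_imp_mixed_dominated:
  assumes "\<exists>B. ell2_bounded_clinear (defect_space T') B \<and>
        (\<forall>x. T x = T' x + B (ell2_incl (defect_op T' x))) \<and>
        (\<forall>f\<in>ell2 (defect_space T'). B (ell2_shift f) = T (B f))"
  shows "mixed_dominated T T'"
proof -
  from assms obtain B where B: "ell2_bounded_clinear (defect_space T') B"
    "\<And>x. T x = T' x + B (ell2_incl (defect_op T' x))"
    "\<And>f. f \<in> ell2 (defect_space T') \<Longrightarrow> B (ell2_shift f) = T (B f)"
    by blast
  obtain c where "c \<ge> 0" "row_bounded T T' c"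
    using row_operator_imp_row_bounded[OF T T' B(1)] B(2,3) by metis
  then show ?thesis by (rule row_bounded_imp_mixed_dominated)
qed

end

theorem theorem2p9:
  fixes T T' :: "'a::complex_hilbert_space \<Rightarrow> 'a"
  assumes "contraction T" and "contraction T'"
    and "quasi_normal (cadjoint T)"
    and "T \<circ> T' = T' \<circ> T"
    and "T \<circ> (cadjoint T' \<circ> T') = (cadjoint T' \<circ> T') \<circ> T"
    and "T' \<circ> (T \<circ> cadjoint T) = (T \<circ> cadjoint T) \<circ> T'"
  shows "(Harnack_dominated T T' \<longleftrightarrow> Harnack_equivalent T T') \<and>
    (Harnack_dominated T T' \<longleftrightarrow> Shmulyan_equivalent T T') \<and>
    (Harnack_dominated T T' \<longleftrightarrow>
      (\<exists>z\<^sub>0\<in>ball 0 1. \<exists>F. contractive_analytic F \<and> F 0 = T \<and> F z\<^sub>0 = T')) \<and>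
    (Harnack_dominated T T' \<longleftrightarrow>
      (\<exists>B. ell2_bounded_clinear (defect_space T') B \<and>
        (\<forall>x. T x = T' x + B (ell2_incl (defect_op T' x))) \<and>
        (\<forall>f\<in>ell2 (defect_space T'). B (ell2_shift f) = T (B f))))"
proof -
  interpret commuting_contractions T T'
    by unfold_locales (fact assms)+
  show ?thesis
  proof (intro conjI)
    show "Harnack_dominated T T' \<longleftrightarrow> Harnack_equivalent T T'"
      unfolding Harnack_dominated_iff_mixed_dominated
      using mixed_dominated_imp_Harnack_equivalent Harnack_dominated_iff_mixed_dominated
      by (auto simp: Harnack_equivalent_def)
    show "Harnack_dominated T T' \<longleftrightarrow> Shmulyan_equivalent T T'"
      unfolding Harnack_dominated_iff_mixed_dominated
      using mixed_dominated_imp_Shmulyan_equivalent Shmulyan_equivalent_imp_mixed_dominated[OF T T'] by blast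
    show "Harnack_dominated T T' \<longleftrightarrow>
        (\<exists>z\<^sub>0\<in>ball 0 1. \<exists>F. contractive_analytic F \<and> F 0 = T \<and> F z\<^sub>0 = T')"
      unfolding Harnack_dominated_iff_mixed_dominated
      using mixed_dominated_imp_analytic[OF T T'] analytic_imp_mixed_dominated[OF T T'] by blast
    show "Harnack_dominated T T' \<longleftrightarrow>
        (\<exists>B. ell2_bounded_clinear (defect_space T') B \<and>
          (\<forall>x. T x = T' x + B (ell2_incl (defect_op T' x))) \<and>
          (\<forall>f\<in>ell2 (defect_space T'). B (ell2_shift f) = T (B f)))"
      unfolding Harnack_dominated_iff_mixed_dominated
      using mixed_dominated_imp_row_operator[OF T T'] row_operator_imp_mixed_dominated by blast
  qed
qed

end
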